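(* For every deterministic sink-finding algorithm $\mathcal{A}$ (in the vertex evaluation query model) and every $n\geq 2$, there exists an $n$-dimensional Matoušek-type USO on which $\mathcal{A}$ requires at least $n$ vertex evaluations to find the sink.
   Context: All vectors and matrices are over $GF(2)$; $\oplus$ denotes addition in $GF(2)$ (xor). The $n$-dimensional hypercube has vertex set $\{0,1\}^n$, and two vertices are adjacent iff they differ in exactly one coordinate. An orientation of the hypercube is given by an outmap function $o:\{0,1\}^n\to\{0,1\}^n$, where the edge $\{v,v\oplus e_i\}$ is directed away from $v$ iff $o(v)_i=1$; consistency requires $o(v)_i\neq o(v\oplus e_i)_i$ for all $v$ and $i$. A Unique Sink Orientation (USO) is an orientation in which every non-empty face of the hypercube has a unique sink (vertex with no outgoing edges within the face). An $n$-dimensional Matoušek-type USO is an orientation of the form $o(v)=M(v\oplus s)$ for all $v\in\{0,1\}^n$, where $M=PAP^T$ for some $n\times n$ permutation matrix $P$ and some invertible upper-triangular matrix $A\in\{0,1\}^{n\times n}$, and $s\in\{0,1\}^n$ (the sink). A sink-finding algorithm accesses the USO only through a vertex evaluation oracle: querying a vertex $v$ returns $o(v)$; its cost is the number of such queries, and it has found the sink when it can output the vertex $s$ with $o(s)=0$. *)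

theory Defs
  imports Main
begin

text \<open>GF(2) is represented by bool (True = 1, addition = xor = (\<noteq>)).
  An n-dimensional vector is a function nat \<Rightarrow> bool, of which only the
  coordinates 0..n-1 are relevant; the hypercube vertex set is cube n.
  An n \<times> n matrix is a function nat \<Rightarrow> nat \<Rightarrow> bool, of which only
  the entries with indices below n are relevant.\<close>

type_synonym vec = "nat \<Rightarrow> bool"
type_synonym mat = "nat \<Rightarrow> nat \<Rightarrow> bool"

definition cube :: "nat \<Rightarrow> vec set" where
  "cube n = {v. \<forall>i. n \<le> i \<longrightarrow> \<not> v i}"

definition vxor :: "nat \<Rightarrow> vec \<Rightarrow> vec \<Rightarrow> vec" where
  "vxor n u v = (\<lambda>i. i < n \<and> (u i \<noteq> v i))"

definition mat_vec :: "nat \<Rightarrow> mat \<Rightarrow> vec \<Rightarrow> vec" where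
  "mat_vec n M v = (\<lambda>i. i < n \<and> odd (card {j. j < n \<and> M i j \<and> v j}))"

definition mat_mult :: "nat \<Rightarrow> mat \<Rightarrow> mat \<Rightarrow> mat" where
  "mat_mult n A B = (\<lambda>i j. i < n \<and> j < n \<and> odd (card {k. k < n \<and> A i k \<and> B k j}))"

definition mat_transpose :: "nat \<Rightarrow> mat \<Rightarrow> mat" where
  "mat_transpose n A = (\<lambda>i j. i < n \<and> j < n \<and> A j i)"

definition id_mat :: "nat \<Rightarrow> mat" where
  "id_mat n = (\<lambda>i j. i < n \<and> i = j)"

definition mat_eq :: "nat \<Rightarrow> mat \<Rightarrow> mat \<Rightarrow> bool" where
  "mat_eq n A B \<longleftrightarrow> (\<forall>i<n. \<forall>j<n. A i j = B i j)"

definition invertible_mat :: "nat \<Rightarrow> mat \<Rightarrow> bool" where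
  "invertible_mat n A \<longleftrightarrow> (\<exists>B. mat_eq n (mat_mult n A B) (id_mat n) \<and> mat_eq n (mat_mult n B A) (id_mat n))"

definition upper_triangular :: "nat \<Rightarrow> mat \<Rightarrow> bool" where
  "upper_triangular n A \<longleftrightarrow> (\<forall>i<n. \<forall>j<n. j < i \<longrightarrow> \<not> A i j)"

definition perm_mat :: "nat \<Rightarrow> mat \<Rightarrow> bool" where
  "perm_mat n P \<longleftrightarrow> (\<forall>i<n. \<exists>!j. j < n \<and> P i j) \<and> (\<forall>j<n. \<exists>!i. i < n \<and> P i j)"

definition matousek_outmap :: "nat \<Rightarrow> mat \<Rightarrow> mat \<Rightarrow> vec \<Rightarrow> vec \<Rightarrow> vec" where
  "matousek_outmap n P A s =
     (\<lambda>v. mat_vec n (mat_mult n (mat_mult n P A) (mat_transpose n P)) (vxor n v s))"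

text \<open>A deterministic algorithm in the vertex evaluation model: a function choosing
  the next query from the history of (query, answer) pairs so far, together with
  a function giving the vertex it outputs (claims is the sink) from a history.
  run query orc k is the history after k queries against outmap orc.\<close>
primrec run :: "((vec \<times> vec) list \<Rightarrow> vec) \<Rightarrow> (vec \<Rightarrow> vec) \<Rightarrow> nat \<Rightarrow> (vec \<times> vec) list" where
  "run query orc 0 = []"
| "run query orc (Suc k) = run query orc k @ [(query (run query orc k), orc (query (run query orc k)))]"

end

theory Submission
  imports Defs Complex_Main
begin

text \<open>
  After the first query \<open>q0\<close> a possible sink \<open>t\<close> is the set \<open>\<sigma> t\<close> of coordinates in which it differs
  from \<open>q0\<close>, and the first answer says that the unknown matrix maps \<open>\<sigma> t\<close> to the all-ones vector.
  The adversary maintains a set \<open>R\<close> of coordinates on which a whole unipotent acyclic matrix is still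
  free, and a family of possible sinks in which every nonempty subset of \<open>R\<close> is the label of the
  same number of sinks. It answers a query with relative vector \<open>d\<close> by one of two moves. Fixing some \<open>i\<close> in \<open>d\<close>
  makes row \<open>i\<close> the unit vector, removes \<open>i\<close> from \<open>R\<close>, and keeps the sinks whose label contains \<open>i\<close> and
  differs from \<open>d\<close>. Splitting off a set \<open>D\<close> containing \<open>d\<close> lets the rows in \<open>D\<close>, off the diagonal, involve only coordinates outside \<open>D\<close>, and
  multiplies the number of sinks per label by \<open>2 ^ card D\<close>. Both moves send \<open>d\<close> to the zero vector,
  so all past queries stay uninformative about the remaining rows.

  Each query also lets the algorithm guess one vertex, so the adversary has to keep few sinks guessed
  already. A guessed sink gets a weight depending on \<open>R\<close> and the size of its label, such that averaging the
  fixing move over \<open>i\<close> in \<open>d\<close> does not increase the total weight; singletons and pairs \<open>d\<close> are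
  answered by splitting. The total weight of the guesses is then small enough for an unguessed sink
  to survive until the end.
\<close>

section \<open>Unipotent acyclic matrices\<close>

text \<open>A guess is tested on every history of length 0 to \<open>n - 1\<close>, so
  \<open>n\<close> guesses must fail against \<open>n - 1\<close> queries. After the first query,
  \<open>n - 2\<close> queries face \<open>n\<close> free coordinates: two are spare. Fixing a
  coordinate or splitting a singleton keeps this slack; splitting a pair spends one spare
  coordinate, so it is used sparingly.

  Let a label have \<open>b\<close> zeros among \<open>r = card R\<close> coordinates, and let
  \<open>d\<close> have \<open>a\<close> elements inside it and \<open>be\<close> outside. The guess
  survives \<open>a\<close> of the \<open>a + be\<close> possible fixings, and \<open>b\<close>
  becomes \<open>b - be + a - 1\<close>. A decreasing price of \<open>2 * r + b\<close> sees its
  argument change by \<open>a - be - 3\<close>: three or more elements inside the label do no harm,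
  whereas singletons and pairs inside it would raise the price. That is why those are split. After a
  split a price of \<open>r + b\<close>, whose argument changes by \<open>a - be - 2\<close>, is
  enough; pairs can then be fixed and only singletons are split. Hence the two price families
  \<open>weight\<close> and \<open>cost\<close>. Potentials are too coarse in the lowest dimensions,
  where exact counts take over and dictate the irregular initial values.\<close>

definition par :: "nat set \<Rightarrow> nat set \<Rightarrow> bool" where
  "par A U \<longleftrightarrow> odd (card (A \<inter> U))"

lemma par_empty [simp]: "par A {} = False" "par {} U = False"
  by (simp_all add: par_def)

lemma par_singleton [simp]: "par A {i} \<longleftrightarrow> i \<in> A" "par {i} U \<longleftrightarrow> i \<in> U"
  by (cases "i \<in> A"; simp add: par_def) (cases "i \<in> U"; simp add: par_def)

lemma odd_card_sym_diff:
  assumes "finite A" "finite B"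
  shows "odd (card (sym_diff A B)) \<longleftrightarrow> odd (card A) \<noteq> odd (card B)"
proof -
  have 1: "card A = card (A - B) + card (A \<inter> B)" 
    using assms by (metis Int_Diff_disjoint Un_Diff_Int add.commute card_Un_disjoint finite_Diff finite_Int inf_commute)
  have 2: "card B = card (B - A) + card (A \<inter> B)"
    using assms by (metis Int_Diff_disjoint Un_Diff_Int add.commute card_Un_disjoint finite_Diff finite_Int inf_commute)
  have "card (sym_diff A B) = card (A - B) + card (B - A)"
    using assms by (intro card_Un_disjoint) auto
  then show ?thesis using 1 2 by auto
qed

lemma par_sym_diff:
  assumes "finite U" "finite V"
  shows "par A (sym_diff U V) \<longleftrightarrow> par A U \<noteq> par A V"
proof -
  have "A \<inter> sym_diff U V = sym_diff (A \<inter> U) (A \<inter> V)" by auto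
  then show ?thesis unfolding par_def using odd_card_sym_diff assms by (metis finite_Int)
qed

lemma par_sym_diff_left:
  assumes "finite U"
  shows "par (sym_diff A B) U \<longleftrightarrow> par A U \<noteq> par B U"
proof -
  have "sym_diff A B \<inter> U = sym_diff (A \<inter> U) (B \<inter> U)" by auto
  then show ?thesis unfolding par_def using odd_card_sym_diff assms by (metis finite_Int)
qed

lemma par_insert:
  assumes "finite U" "i \<notin> A"
  shows "par (insert i A) U \<longleftrightarrow> par A U \<noteq> (i \<in> U)"
proof -
  have "insert i A = sym_diff A {i}" using assms(2) by auto
  then show ?thesis using par_sym_diff_left[OF assms(1), of A "{i}"] by simp
qed

text \<open>Unitriangularity up to an unnamed order: \<open>rk\<close> only witnesses that the
  off-diagonal support is acyclic, so coordinates can leave or join \<open>R\<close> without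
  renumbering.\<close>

definition unip :: "nat set \<Rightarrow> (nat \<Rightarrow> nat set) \<Rightarrow> bool" where
  "unip R N \<longleftrightarrow> (\<exists>rk :: nat \<Rightarrow> nat. \<forall>i\<in>R. N i \<subseteq> R \<and> i \<in> N i \<and> (\<forall>j\<in>N i. j \<noteq> i \<longrightarrow> rk j < rk i))"

lemma unipI:
  fixes rk :: "nat \<Rightarrow> nat"
  assumes "\<And>i. i \<in> R \<Longrightarrow> N i \<subseteq> R" "\<And>i. i \<in> R \<Longrightarrow> i \<in> N i"
    "\<And>i j. i \<in> R \<Longrightarrow> j \<in> N i \<Longrightarrow> j \<noteq> i \<Longrightarrow> rk j < rk i"
  shows "unip R N"
  using assms unfolding unip_def by blast

text \<open>At an element \<open>i\<close> of least rank in the symmetric difference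
  \<open>W\<close>, row \<open>i\<close> meets \<open>W\<close> in \<open>i\<close> alone, so this
  row separates \<open>U\<close> from \<open>V\<close>.\<close>

lemma unip_inj:
  assumes N: "unip R N" and U: "U \<subseteq> R" "finite U" and V: "V \<subseteq> R" "finite V"
    and eq: "\<And>i. i \<in> R \<Longrightarrow> par (N i) U = par (N i) V"
  shows "U = V"
proof (rule ccontr)
  assume "U \<noteq> V"
  obtain rk :: "nat \<Rightarrow> nat" where rk: "\<forall>i\<in>R. N i \<subseteq> R \<and> i \<in> N i \<and> (\<forall>j\<in>N i. j \<noteq> i \<longrightarrow> rk j < rk i)"
    using N unfolding unip_def by blast
  define W where "W = sym_diff U V"
  have W: "W \<subseteq> R" "W \<noteq> {}" using U V \<open>U \<noteq> V\<close> by (auto simp: W_def)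
  then obtain i where i: "i \<in> W" "\<forall>j. j \<in> W \<longrightarrow> rk i \<le> rk j"
    using arg_min_nat_lemma[of "\<lambda>x. x \<in> W" _ rk] by (metis all_not_in_conv)
  have "N i \<inter> W = {i}"
  proof -
    have "j = i" if "j \<in> N i" "j \<in> W" for j
      using that i rk W by (metis leD subsetD)
    then show ?thesis using i rk W by blast
  qed
  then have "par (N i) W" by (simp add: par_def)
  moreover have "\<not> par (N i) W" unfolding W_def
    using par_sym_diff[OF U(2) V(2)] eq i(1) W(1) by blast
  ultimately show False by blast
qed

section \<open>From unipotent row systems to Matousek-type matrices\<close>

lemma unip_right_inverse:
  assumes "unip {..<n} N"
  shows "\<exists>Y. \<forall>k. Y k \<subseteq> {..<n} \<and> (k < n \<longrightarrow> (\<forall>i<n. par (N i) (Y k) \<longleftrightarrow> i = k))"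
proof -
  define f where "f U = {i. i < n \<and> par (N i) U}" for U
  have "inj_on f (Pow {..<n})"
  proof (rule inj_onI)
    fix U V assume "U \<in> Pow {..<n}" "V \<in> Pow {..<n}" "f U = f V"
    then show "U = V"
      by (intro unip_inj[OF assms]) (auto simp: f_def set_eq_iff intro: finite_subset)
  qed
  moreover have "f ` Pow {..<n} \<subseteq> Pow {..<n}" by (auto simp: f_def)
  \<comment> \<open>An injective self-map of a finite power set is onto; the preimages of singletons
    are the columns of the inverse.\<close>
  ultimately have im: "f ` Pow {..<n} = Pow {..<n}"
    by (intro card_subset_eq) (auto simp: card_image)
  have "\<exists>U\<subseteq>{..<n}. k < n \<longrightarrow> f U = {k}" for k
  proof (cases "k < n")
    case True
    then have "{k} \<in> f ` Pow {..<n}" unfolding im by simp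
    then show ?thesis by auto
  qed auto
  then obtain Y where "\<forall>k. Y k \<subseteq> {..<n} \<and> (k < n \<longrightarrow> f (Y k) = {k})" by metis
  then have "\<forall>k. Y k \<subseteq> {..<n} \<and> (k < n \<longrightarrow> (\<forall>i<n. par (N i) (Y k) \<longleftrightarrow> i = k))"
    by (auto simp: f_def)
  then show ?thesis by blast
qed

text \<open>\<open>Y\<close> is an inverse on one side by construction. For the other side,
  \<open>c S\<close> sums the columns \<open>Y k\<close> over \<open>k\<close> in \<open>S\<close>
  and is thus a preimage of \<open>S\<close>. Column \<open>j\<close> of the matrix has the preimage
  \<open>{j}\<close>, and injectivity identifies the two.\<close>

lemma unip_invertible_mat:
  assumes "unip {..<n} N"
  shows "invertible_mat n (\<lambda>i j. j \<in> N i)"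
proof -
  obtain Y where Y0: "\<forall>k. Y k \<subseteq> {..<n} \<and> (k < n \<longrightarrow> (\<forall>i<n. par (N i) (Y k) \<longleftrightarrow> i = k))"
    using unip_right_inverse[OF assms] by blast
  have Y: "\<And>k. Y k \<subseteq> {..<n}" "\<And>i k. i < n \<Longrightarrow> k < n \<Longrightarrow> par (N i) (Y k) \<longleftrightarrow> i = k"
    using Y0 by auto
  have fY: "finite (Y k)" for k using Y(1) by (rule finite_subset) simp
  define c where "c S = {l. l < n \<and> odd (card {k\<in>S. l \<in> Y k})}" for S
  have cS: "par (N i) (c S) \<longleftrightarrow> i \<in> S" if "S \<subseteq> {..<n}" "i < n" for S i
  proof -
    have "finite S" using that(1) by (rule finite_subset) simp
    then show ?thesis using that(1)
    proof (induction S rule: finite_induct)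
      case empty then show ?case by (simp add: c_def)
    next
      case (insert k S)
      have "c (insert k S) = sym_diff (c S) (Y k)"
      proof -
        have "odd (card {k'\<in>insert k S. l \<in> Y k'}) \<longleftrightarrow> odd (card {k'\<in>S. l \<in> Y k'}) \<noteq> (l \<in> Y k)" for l
        proof -
          have "{k'\<in>insert k S. l \<in> Y k'} = (if l \<in> Y k then insert k {k'\<in>S. l \<in> Y k'} else {k'\<in>S. l \<in> Y k'})"
            by auto
          then show ?thesis using insert.hyps by simp
        qed
        then show ?thesis using Y(1)[of k] by (auto simp: c_def)
      qed
      moreover have "finite (c S)" by (simp add: c_def)
      ultimately show ?case
        using par_sym_diff[of "c S" "Y k" "N i"] fY insert that(2) Y(2)[of i k] by auto
    qed
  qed
  have par_eq: "odd (card {k. k < n \<and> k \<in> N i \<and> k \<in> U}) = par (N i) U" if "U \<subseteq> {..<n}" for i U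
  proof -
    have "{k. k < n \<and> k \<in> N i \<and> k \<in> U} = N i \<inter> U" using that by auto
    then show ?thesis by (simp add: par_def)
  qed
  have *: "c {k. k < n \<and> j \<in> N k} = {j}" if "j < n" for j
  proof (rule unip_inj[OF assms])
    show "par (N i) (c {k. k < n \<and> j \<in> N k}) = par (N i) {j}" if "i \<in> {..<n}" for i
      using cS[of "{k. k < n \<and> j \<in> N k}" i] that by auto
  qed (use that in \<open>auto simp: c_def\<close>)
  have "odd (card {k. k < n \<and> i \<in> Y k \<and> j \<in> N k}) \<longleftrightarrow> i = j" if "i < n" "j < n" for i j
  proof -
    have "{k. k < n \<and> i \<in> Y k \<and> j \<in> N k} = {k \<in> {k. k < n \<and> j \<in> N k}. i \<in> Y k}" by auto
    then show ?thesis using *[OF that(2)] that by (auto simp: c_def)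
  qed
  then show ?thesis unfolding invertible_mat_def mat_eq_def mat_mult_def id_mat_def
    by (intro exI[of _ "\<lambda>i j. i \<in> Y j"]) (use Y par_eq in auto)
qed

lemma matousek_of_unip:
  assumes N: "unip {..<n} N"
  obtains P A where "perm_mat n P" "upper_triangular n A" "invertible_mat n A"
    "\<And>t v i. i < n \<Longrightarrow> matousek_outmap n P A t v i \<longleftrightarrow> par (N i) {j. j < n \<and> v j \<noteq> t j}"
proof -
  obtain rk :: "nat \<Rightarrow> nat" where rk0: "\<forall>i\<in>{..<n}. N i \<subseteq> {..<n} \<and> i \<in> N i \<and> (\<forall>j\<in>N i. j \<noteq> i \<longrightarrow> rk j < rk i)"
    using N unfolding unip_def by blast
  have rk: "N i \<subseteq> {..<n}" "i \<in> N i" "j \<in> N i \<Longrightarrow> j \<noteq> i \<Longrightarrow> rk j < rk i" if "i \<in> {..<n}" for i j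
    using rk0 that by auto
  \<comment> \<open>Off the diagonal a row involves only smaller ranks, so listing the coordinates
    by decreasing rank puts all entries on or above the diagonal.\<close>
  define xs where "xs = rev (sort_key rk [0..<n])"
  have len: "length xs = n" by (simp add: xs_def)
  have set: "set xs = {..<n}" by (auto simp: xs_def)
  have dist: "distinct xs" by (simp add: xs_def)
  have srt: "sorted_wrt (\<lambda>a b. rk b \<le> rk a) xs"
    using sorted_sort_key[of rk "[0..<n]"]
    by (simp add: xs_def sorted_wrt_rev sorted_map)
  have bij: "bij_betw (\<lambda>a. xs ! a) {..<n} {..<n}"
    using bij_betw_nth[OF dist] len set by auto
  define pos where "pos = the_inv_into {..<n} (\<lambda>a. xs ! a)"
  have pos: "pos i < n" "xs ! pos i = i" if "i < n" for i
    using that bij f_the_inv_into_f_bij_betw[OF bij] bij_betw_the_inv_into[OF bij]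
    unfolding pos_def by (auto simp: bij_betw_def)
  have xsn: "xs ! a < n" if "a < n" for a using that set len nth_mem[of a xs] by auto
  have pos': "pos (xs ! a) = a" if "a < n" for a
    using that bij unfolding pos_def by (intro the_inv_into_f_f) (auto simp: bij_betw_def)
  have xs_eq: "xs ! a = i \<longleftrightarrow> a = pos i" if "a < n" "i < n" for a i
    using that pos pos' by auto
  define A where "A a b \<longleftrightarrow> xs ! b \<in> N (xs ! a)" for a b
  define P where "P i a \<longleftrightarrow> xs ! a = i" for i a
  have 1: "perm_mat n P" unfolding perm_mat_def P_def
  proof (intro conjI allI impI)
    show "\<exists>!a. a < n \<and> xs ! a = i" if "i < n" for i
      by (rule ex1I[of _ "pos i"]) (use that pos xs_eq in auto)
    show "\<exists>!i. i < n \<and> xs ! a = i" if "a < n" for a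
      by (rule ex1I[of _ "xs ! a"]) (use that xsn in auto)
  qed
  have le: "a \<le> b" if "xs ! b \<in> N (xs ! a)" "a < n" "b < n" for a b
  proof (rule ccontr)
    assume "\<not> a \<le> b"
    then have "b < a" by simp
    then have "rk (xs ! a) \<le> rk (xs ! b)" "xs ! a \<noteq> xs ! b"
      using srt that len dist by (auto simp: sorted_wrt_iff_nth_less nth_eq_iff_index_eq)
    then show False using rk(3)[of "xs ! a" "xs ! b"] that xsn by auto
  qed
  have 2: "upper_triangular n A" unfolding upper_triangular_def A_def using le by (metis leD)
  have "unip {..<n} (\<lambda>a. {b. b < n \<and> A a b})"
  proof (rule unipI[where rk = "\<lambda>a. n - a"])
    show "a \<in> {b. b < n \<and> A a b}" if "a \<in> {..<n}" for a
      using that rk(2)[of "xs ! a"] xsn by (simp add: A_def)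
    show "n - b < n - a" if "a \<in> {..<n}" "b \<in> {b. b < n \<and> A a b}" "b \<noteq> a" for a b
      using le[of b a] that by (auto simp: A_def)
  qed auto
  from unip_invertible_mat[OF this] have 3: "invertible_mat n A"
    unfolding invertible_mat_def mat_eq_def mat_mult_def by (simp cong: conj_cong)
  have odd1: "odd (card {k. k < n \<and> k = c \<and> Q k}) \<longleftrightarrow> c < n \<and> Q c" for c Q
  proof -
    have "{k. k < n \<and> k = c \<and> Q k} = (if c < n \<and> Q c then {c} else {})" by auto
    then show ?thesis by simp
  qed
  have PA: "mat_mult n P A i b \<longleftrightarrow> A (pos i) b" if "i < n" "b < n" for i b
  proof -
    have "{k. k < n \<and> P i k \<and> A k b} = {k. k < n \<and> k = pos i \<and> A k b}"
      using that xs_eq by (auto simp: P_def)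
    then show ?thesis using odd1[of "pos i" "\<lambda>k. A k b"] that pos by (simp add: mat_mult_def)
  qed
  have M: "mat_mult n (mat_mult n P A) (mat_transpose n P) i j \<longleftrightarrow> j \<in> N i" if "i < n" "j < n" for i j
  proof -
    have "{k. k < n \<and> mat_mult n P A i k \<and> mat_transpose n P k j} = {k. k < n \<and> k = pos j \<and> A (pos i) k}"
      using that xs_eq PA by (auto simp: P_def mat_transpose_def)
    then show ?thesis using odd1[of "pos j" "\<lambda>k. A (pos i) k"] that pos
      by (simp add: mat_mult_def[of n "mat_mult n P A"] A_def)
  qed
  have 4: "matousek_outmap n P A t v i = par (N i) {j. j < n \<and> v j \<noteq> t j}" if "i < n" for t v i
  proof -
    have "{j. j < n \<and> mat_mult n (mat_mult n P A) (mat_transpose n P) i j \<and> vxor n v t j}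
       = N i \<inter> {j. j < n \<and> v j \<noteq> t j}" using M[OF that] by (auto simp: vxor_def)
    then show ?thesis using that by (simp add: matousek_outmap_def mat_vec_def par_def)
  qed
  show ?thesis by (rule that[OF 1 2 3 4])
qed

section \<open>The game on relative vectors\<close>

text \<open>\<open>z\<close> is the zero set of an answer to \<open>d\<close> compatible with sink
  label \<open>W\<close>: the value of a free row is the complement of its parity, so rows odd on
  \<open>d\<close> answer 0.\<close>

definition realz :: "nat set \<Rightarrow> nat set \<Rightarrow> nat set \<Rightarrow> nat set \<Rightarrow> bool" where
  "realz R d z W \<longleftrightarrow> (\<exists>N. unip R N \<and> (\<forall>i\<in>R. par (N i) W) \<and> (\<forall>i\<in>R. par (N i) d \<longleftrightarrow> i \<in> z))"

text \<open>
  \<open>q\<close> is the number of remaining queries, \<open>G\<close> the set of earlier guesses, and \<open>p\<close> says that no splitting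
  move has been made. The third alternative is a move for the last query only: a single answer,
  with zero set \<open>z\<close> inside \<open>R\<close>, that is compatible with all sinks in \<open>X\<close>.
\<close>

primrec awin :: "nat \<Rightarrow> bool \<Rightarrow> nat set \<Rightarrow> 'a set \<Rightarrow> ('a \<Rightarrow> nat set) \<Rightarrow> 'a set \<Rightarrow> bool" where
  "awin 0 p R T \<sigma> G \<longleftrightarrow> (\<forall>h. \<exists>t\<in>T. t \<notin> insert h G)"
| "awin (Suc q) p R T \<sigma> G \<longleftrightarrow> R \<noteq> {} \<and> (\<forall>h d. d \<subseteq> R \<and> d \<noteq> {} \<longrightarrow>
     (\<exists>i\<in>d. awin q p (R - {i}) {t\<in>T. i \<in> \<sigma> t \<and> \<sigma> t \<noteq> d}
        (\<lambda>t. (if i \<in> \<sigma> t then sym_diff (\<sigma> t) d else \<sigma> t) - {i}) (insert h G)) \<or>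
     (\<exists>D. d \<subseteq> D \<and> D \<subseteq> R \<and> awin q False (R - D) {t\<in>T. \<not> \<sigma> t \<subseteq> D} (\<lambda>t. \<sigma> t - D) (insert h G)) \<or>
     (p \<and> q = 0 \<and> (\<exists>X\<subseteq>T. \<exists>z. (\<forall>t\<in>X. realz R d z (\<sigma> t)) \<and> (\<forall>h'. \<exists>t\<in>X. t \<notin> insert h' (insert h G)))))"

definition inst :: "nat \<Rightarrow> vec \<Rightarrow> (vec \<Rightarrow> vec) \<Rightarrow> bool" where
  "inst n t f \<longleftrightarrow> (\<exists>P A. perm_mat n P \<and> upper_triangular n A \<and> invertible_mat n A \<and> t \<in> cube n \<and>
     matousek_outmap n P A t = f)"

text \<open>
  The outmap after some moves: rows \<open>N\<close> on the free coordinates \<open>R\<close> and, on the coordinates \<open>B\<close> that have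
  been split off, a part \<open>\<kappa>\<close> already known to the adversary plus the still free linear part \<open>X\<close>. Since a
  free row is odd on the relative vector of the sink, its value is complemented.
\<close>

definition orc :: "nat \<Rightarrow> nat set \<Rightarrow> nat set \<Rightarrow> (vec \<Rightarrow> nat set) \<Rightarrow> (vec \<Rightarrow> vec) \<Rightarrow> (nat \<Rightarrow> nat set) \<Rightarrow> (nat \<Rightarrow> nat set) \<Rightarrow> vec \<Rightarrow> vec" where
  "orc n R B \<rho> \<kappa> N X v i \<longleftrightarrow> i < n \<and>
     (if i \<in> R then \<not> par (N i) (\<rho> v) else \<kappa> v i \<noteq> (i \<in> B \<and> par (X i) (\<rho> v)))"

text \<open>Quantifying over all completions \<open>N\<close> and \<open>X\<close> expresses that
  nothing beyond the moves made so far is committed: for whichever sink survives, the remaining rows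
  may be chosen afterwards.\<close>

definition realizable :: "nat \<Rightarrow> nat set \<Rightarrow> nat set \<Rightarrow> (vec \<Rightarrow> nat set) \<Rightarrow> (vec \<Rightarrow> vec) \<Rightarrow> vec set \<Rightarrow> bool" where
  "realizable n R B \<rho> \<kappa> T \<longleftrightarrow> (\<forall>t\<in>T. \<forall>N X. unip R N \<longrightarrow> (\<forall>i\<in>R. par (N i) (\<rho> t)) \<longrightarrow>
     (\<forall>k\<in>B. X k \<subseteq> R \<and> (par (X k) (\<rho> t) \<longleftrightarrow> \<kappa> t k)) \<longrightarrow> inst n t (orc n R B \<rho> \<kappa> N X))"

lemma realizableD:
  assumes "realizable n R B \<rho> \<kappa> T" "t \<in> T" "unip R N" "\<And>i. i \<in> R \<Longrightarrow> par (N i) (\<rho> t)"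
    "\<And>k. k \<in> B \<Longrightarrow> X k \<subseteq> R" "\<And>k. k \<in> B \<Longrightarrow> par (X k) (\<rho> t) \<longleftrightarrow> \<kappa> t k"
  shows "inst n t (orc n R B \<rho> \<kappa> N X)"
  using assms unfolding realizable_def by blast

text \<open>A row of the smaller game is lifted by adding \<open>i\<close> exactly if it is odd on
  \<open>d\<close>. The lift is then even on \<open>d\<close>, so its parity is defined modulo
  \<open>d\<close>, and \<rho>' picks the representative that avoids \<open>i\<close>.\<close>

lemma realizable_fix:
  assumes R: "realizable n R B \<rho> \<kappa> T" and fin: "finite R" and sub: "\<And>v. \<rho> v \<subseteq> R" and i: "i \<in> d" "d \<subseteq> R" and BR: "B \<inter> R = {}"
  defines "\<rho>' \<equiv> \<lambda>v. (if i \<in> \<rho> v then sym_diff (\<rho> v) d else \<rho> v) - {i}"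
  shows "realizable n (R - {i}) B \<rho>' (\<lambda>v k. if k = i then i \<notin> \<rho> v else \<kappa> v k) {t\<in>T. i \<in> \<rho> t \<and> \<rho> t \<noteq> d}"
  unfolding realizable_def
proof (intro ballI allI impI)
  let ?\<kappa> = "\<lambda>v k. if k = i then i \<notin> \<rho> v else \<kappa> v k"
  fix t N X
  assume t: "t \<in> {t\<in>T. i \<in> \<rho> t \<and> \<rho> t \<noteq> d}" and N: "unip (R - {i}) N" "\<forall>l\<in>R - {i}. par (N l) (\<rho>' t)"
    and X: "\<forall>k\<in>B. X k \<subseteq> R - {i} \<and> (par (X k) (\<rho>' t) \<longleftrightarrow> ?\<kappa> t k)"
  define E where "E A = A \<union> (if par A d then {i} else {})" for A
  have fd: "finite d" "\<And>v. finite (\<rho> v)" using fin sub i by (auto intro: finite_subset)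
  have E: "par (E A) (\<rho> v) \<longleftrightarrow> par A (\<rho>' v)" if "A \<subseteq> R - {i}" for A v
  proof -
    have iA: "i \<notin> A" using that by auto
    have 1: "par A (U - {i}) \<longleftrightarrow> par A U" for U
    proof -
      have "A \<inter> (U - {i}) = A \<inter> U" using iA by auto
      then show ?thesis by (simp add: par_def)
    qed
    have "par (E A) (\<rho> v) \<longleftrightarrow> par A (\<rho> v) \<noteq> (par A d \<and> i \<in> \<rho> v)"
      using par_insert[OF fd(2) iA, of v] by (simp add: E_def)
    then show ?thesis using par_sym_diff[OF fd(2) fd(1), of A v] by (simp add: \<rho>'_def 1)
  qed
  define N' where "N' l = (if l = i then {i} else E (N l))" for l
  define X' where "X' k = E (X k)" for k
  obtain rk :: "nat \<Rightarrow> nat" where rk: "\<forall>l\<in>R - {i}. N l \<subseteq> R - {i} \<and> l \<in> N l \<and> (\<forall>j\<in>N l. j \<noteq> l \<longrightarrow> rk j < rk l)"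
    using N(1) unfolding unip_def by blast
  \<comment> \<open>Any lifted row may have acquired \<open>i\<close>, so \<open>i\<close> is ranked
    below all other coordinates.\<close>
  have "unip R N'"
  proof (rule unipI[where rk = "\<lambda>l. if l = i then 0 else Suc (rk l)"])
    show "N' l \<subseteq> R" if "l \<in> R" for l using rk that i by (auto simp: N'_def E_def)
    show "l \<in> N' l" if "l \<in> R" for l using rk that i by (auto simp: N'_def E_def)
    show "(if j = i then 0 else Suc (rk j)) < (if l = i then 0 else Suc (rk l))"
      if "l \<in> R" "j \<in> N' l" "j \<noteq> l" for l j
      using rk that i by (auto simp: N'_def E_def split: if_splits)
  qed
  moreover have "par (N' l) (\<rho> t)" if "l \<in> R" for l
    using that t N(2) E[of "N l" t] rk by (auto simp: N'_def)
  moreover have "X' k \<subseteq> R" if "k \<in> B" for k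
    using X that i by (auto simp: X'_def E_def)
  moreover have "par (X' k) (\<rho> t) \<longleftrightarrow> \<kappa> t k" if "k \<in> B" for k
    using X that i E[of "X k" t] BR by (auto simp: X'_def)
  ultimately have "inst n t (orc n R B \<rho> \<kappa> N' X')"
    using realizableD[OF R] t by blast
  moreover have "orc n R B \<rho> \<kappa> N' X' v k = orc n (R - {i}) B \<rho>' ?\<kappa> N X v k" for v k
    using E[of "N k" v] E[of "X k" v] rk X BR i unfolding orc_def X'_def N'_def by auto
  then have "orc n R B \<rho> \<kappa> N' X' = orc n (R - {i}) B \<rho>' ?\<kappa> N X" by blast
  ultimately show "inst n t (orc n (R - {i}) B \<rho>' ?\<kappa> N X)" by simp
qed

text \<open>No row outside \<open>D\<close> mentions \<open>D\<close>, so the rows of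
  \<open>D\<close> can be ranked on top, by a bound \<open>m\<close> for all other ranks. Their
  diagonal entry contributes a known bit, which together with the complement goes into the new
  \<kappa>; the part \<open>X l\<close> stays free.\<close>

lemma realizable_split:
  assumes R: "realizable n R B \<rho> \<kappa> T" and fin: "finite R" and sub: "\<And>v. \<rho> v \<subseteq> R" and D: "D \<subseteq> R" and BR: "B \<inter> R = {}"
  shows "realizable n (R - D) (B \<union> D) (\<lambda>v. \<rho> v - D) (\<lambda>v k. if k \<in> D then k \<notin> \<rho> v else \<kappa> v k) {t\<in>T. \<not> \<rho> t \<subseteq> D}"
  unfolding realizable_def
proof (intro ballI allI impI)
  let ?\<kappa> = "\<lambda>v k. if k \<in> D then k \<notin> \<rho> v else \<kappa> v k"
  fix t N X
  assume t: "t \<in> {t\<in>T. \<not> \<rho> t \<subseteq> D}" and N: "unip (R - D) N" "\<forall>l\<in>R - D. par (N l) (\<rho> t - D)"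
    and X: "\<forall>k\<in>B \<union> D. X k \<subseteq> R - D \<and> (par (X k) (\<rho> t - D) \<longleftrightarrow> ?\<kappa> t k)"
  have fd: "\<And>v. finite (\<rho> v)" using fin sub by (auto intro: finite_subset)
  have E: "par A (\<rho> v - D) \<longleftrightarrow> par A (\<rho> v)" if "A \<subseteq> R - D" for A v
  proof -
    have "A \<inter> (\<rho> v - D) = A \<inter> \<rho> v" using that by auto
    then show ?thesis by (simp add: par_def)
  qed
  define N' where "N' l = (if l \<in> D then insert l (X l) else N l)" for l
  obtain rk :: "nat \<Rightarrow> nat" where rk: "\<forall>l\<in>R - D. N l \<subseteq> R - D \<and> l \<in> N l \<and> (\<forall>j\<in>N l. j \<noteq> l \<longrightarrow> rk j < rk l)"
    using N(1) unfolding unip_def by blast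
  obtain m where m: "\<And>l. l \<in> R \<Longrightarrow> rk l < m"
    using fin finite_nat_set_iff_bounded[of "rk ` R"] by auto
  have X1: "X k \<subseteq> R - D" if "k \<in> D" for k using X that by auto
  have "unip R N'"
  proof (rule unipI[where rk = "\<lambda>l. if l \<in> D then m else rk l"])
    show "N' l \<subseteq> R" if "l \<in> R" for l using rk that X1 D by (auto simp: N'_def)
    show "l \<in> N' l" if "l \<in> R" for l using rk that by (auto simp: N'_def)
    show "(if j \<in> D then m else rk j) < (if l \<in> D then m else rk l)"
      if "l \<in> R" "j \<in> N' l" "j \<noteq> l" for l j
      using rk that X1 m D by (auto simp: N'_def split: if_splits)
  qed
  moreover have par1: "par (insert l (X l)) (\<rho> v) \<longleftrightarrow> (par (X l) (\<rho> v) \<noteq> (l \<in> \<rho> v))" if "l \<in> D" for l v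
    using par_insert[OF fd] X1 that by blast
  moreover have "par (N' l) (\<rho> t)" if "l \<in> R" for l
  proof (cases "l \<in> D")
    case True
    then have "par (X l) (\<rho> t) \<longleftrightarrow> l \<notin> \<rho> t" using X E[OF X1[OF True], of t] by (metis True UnI2)
    then show ?thesis using par1[OF True] True by (simp add: N'_def)
  next
    case False
    then show ?thesis using that N(2) E[of "N l" t] rk by (auto simp: N'_def)
  qed
  moreover have "X k \<subseteq> R" if "k \<in> B" for k
    using X that by auto
  moreover have "par (X k) (\<rho> t) \<longleftrightarrow> \<kappa> t k" if "k \<in> B" for k
  proof -
    have "k \<notin> D" using that BR D by auto
    then show ?thesis using X that E[of "X k" t] by auto
  qed
  ultimately have "inst n t (orc n R B \<rho> \<kappa> N' X)"
    using realizableD[OF R] t by blast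
  moreover have "orc n R B \<rho> \<kappa> N' X v k = orc n (R - D) (B \<union> D) (\<lambda>v. \<rho> v - D) ?\<kappa> N X v k" for v k
  proof (cases "k \<in> D")
    case True
    then show ?thesis using par1[OF True, of v] E[OF X1[OF True]] D unfolding orc_def N'_def by auto
  next
    case False
    then show ?thesis using E[of "N k" v] E[of "X k" v] rk X BR unfolding orc_def N'_def by auto
  qed
  then have "orc n R B \<rho> \<kappa> N' X = orc n (R - D) (B \<union> D) (\<lambda>v. \<rho> v - D) ?\<kappa> N X" by blast
  ultimately show "inst n t (orc n (R - D) (B \<union> D) (\<lambda>v. \<rho> v - D) ?\<kappa> N X)" by simp
qed

section \<open>Transcripts: from the game to an algorithm\<close>

definition ans :: "nat \<Rightarrow> nat set \<Rightarrow> (vec \<Rightarrow> vec) \<Rightarrow> vec \<Rightarrow> vec" where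
  "ans n R \<kappa> v i \<longleftrightarrow> i < n \<and> (i \<in> R \<or> \<kappa> v i)"

lemma orc_empty: "\<rho> v = {} \<Longrightarrow> orc n R B \<rho> \<kappa> N X v = ans n R \<kappa> v"
  by (auto simp: orc_def ans_def fun_eq_iff)

text \<open>This is where determinism enters: every oracle that agrees with the recorded pairs is
  asked the same queries, so an outmap chosen only at the end is consistent with the whole history
  and with the guesses made on its prefixes.\<close>

definition transcript :: "((vec \<times> vec) list \<Rightarrow> vec) \<Rightarrow> (vec \<times> vec) list \<Rightarrow> bool" where
  "transcript query H \<longleftrightarrow> (\<forall>f. (\<forall>(v, a)\<in>set H. f v = a) \<longrightarrow> (\<forall>j\<le>length H. run query f j = take j H))"

lemma transcript_Nil: "transcript query []"
  by (simp add: transcript_def)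

lemma transcript_snoc:
  assumes "transcript query H"
  shows "transcript query (H @ [(query H, a)])"
  unfolding transcript_def
proof (intro allI impI)
  fix f j
  assume f: "\<forall>(v, b)\<in>set (H @ [(query H, a)]). f v = b" and j: "j \<le> length (H @ [(query H, a)])"
  have r: "run query f j = take j H" if "j \<le> length H" for j
    using assms f that unfolding transcript_def by simp
  show "run query f j = take j (H @ [(query H, a)])"
  proof (cases "j \<le> length H")
    case False
    then have "j = Suc (length H)" using j by simp
    then show ?thesis using r[of "length H"] f by simp
  qed (use r in simp)
qed

definition fools :: "nat \<Rightarrow> ((vec \<times> vec) list \<Rightarrow> vec) \<Rightarrow> ((vec \<times> vec) list \<Rightarrow> vec) \<Rightarrow> nat \<Rightarrow> bool" where
  "fools n query answer m \<longleftrightarrow> (\<exists>P A s. perm_mat n P \<and> upper_triangular n A \<and> invertible_mat n A \<and> s \<in> cube n \<and>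
           (\<forall>k<m. answer (run query (matousek_outmap n P A s) k) \<noteq> s))"

lemma foolsI:
  assumes "transcript query H" "inst n t f" "\<forall>(v, a)\<in>set H. f v = a"
    and "\<forall>j\<le>length H. answer (take j H) \<noteq> t"
  shows "fools n query answer (Suc (length H))"
proof -
  obtain P A where PA: "perm_mat n P" "upper_triangular n A" "invertible_mat n A" "t \<in> cube n"
    "matousek_outmap n P A t = f" using assms(2) unfolding inst_def by blast
  have "answer (run query f k) \<noteq> t" if "k < Suc (length H)" for k
  proof -
    have "run query f k = take k H" using assms(1,3) that unfolding transcript_def by simp
    then show ?thesis using assms(4) that by simp
  qed
  then show ?thesis using PA unfolding fools_def by blast
qed

lemma unip_exists:
  assumes "W \<subseteq> R" "W \<noteq> {}"
  obtains N where "unip R N" "\<And>i. i \<in> R \<Longrightarrow> par (N i) W"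
proof -
  obtain j where j: "j \<in> W" using assms by auto
  define N where "N i = (if i \<in> W then {i} else {i, j})" for i
  have "unip R N"
    by (rule unipI[where rk = "\<lambda>i. if i \<in> W then 0 else 1"]) (use j assms in \<open>auto simp: N_def split: if_splits\<close>)
  moreover have "par (N i) W" if "i \<in> R" for i
  proof (cases "i \<in> W")
    case False
    then have "N i \<inter> W = {j}" using j by (auto simp: N_def)
    then show ?thesis by (simp add: par_def)
  qed (simp add: N_def)
  ultimately show ?thesis using that by blast
qed

lemma realizable_inst:
  assumes R: "realizable n R B \<rho> \<kappa> T" and t: "t \<in> T" "\<rho> t \<subseteq> R" "\<rho> t \<noteq> {}"
    and N: "unip R N" "\<And>i. i \<in> R \<Longrightarrow> par (N i) (\<rho> t)"
  obtains X where "inst n t (orc n R B \<rho> \<kappa> N X)"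
proof -
  obtain j where j: "j \<in> \<rho> t" using t by auto
  show ?thesis
    by (rule that, rule realizableD[OF R t(1) N, of "\<lambda>k. if \<kappa> t k then {j} else {}"]) (use j t in auto)
qed

text \<open>All recorded queries have been projected to the empty set, so by
  \<open>orc_empty\<close> their answers are the same for every completion. In the last-query
  alternative the answer does depend on the completion, but all sinks in \<open>X\<close> admit the
  same one. There \<open>p\<close> forces \<open>B\<close> to be empty, because \<open>realz\<close>
  controls the rows in \<open>R\<close> only.\<close>

theorem awin_fools:
  assumes "awin q p R T \<rho> G" "realizable n R B \<rho> \<kappa> T" "p \<longrightarrow> B = {}" "B \<inter> R = {}"
    "finite R" "\<And>v. \<rho> v \<subseteq> R" "\<And>t. t \<in> T \<Longrightarrow> \<rho> t \<noteq> {}"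
    "transcript query H" "\<And>v a. (v, a) \<in> set H \<Longrightarrow> \<rho> v = {} \<and> a = ans n R \<kappa> v"
    "\<And>j. j < length H \<Longrightarrow> answer (take j H) \<in> G"
  shows "fools n query answer (length H + q + 1)"
  using assms
proof (induction q arbitrary: p R T \<rho> G B \<kappa> H)
  case (0 p R T \<rho> G B \<kappa> H)
  obtain t where t: "t \<in> T" "t \<notin> insert (answer H) G" using "0.prems"(1) by auto
  obtain N where N: "unip R N" "\<And>i. i \<in> R \<Longrightarrow> par (N i) (\<rho> t)"
    using unip_exists[OF "0.prems"(6) "0.prems"(7)[OF t(1)]] by blast
  obtain X where X: "inst n t (orc n R B \<rho> \<kappa> N X)"
    using realizable_inst[OF "0.prems"(2) t(1) "0.prems"(6) "0.prems"(7)[OF t(1)] N] by blast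
  have "\<forall>j\<le>length H. answer (take j H) \<noteq> t"
  proof (intro allI impI)
    fix j assume "j \<le> length H"
    then show "answer (take j H) \<noteq> t" using t(2) "0.prems"(10)[of j] by (cases "j = length H") auto
  qed
  then have "fools n query answer (Suc (length H))"
    by (intro foolsI[OF "0.prems"(8) X]) (use "0.prems"(9) orc_empty in fastforce)+
  then show ?case by simp
next
  case (Suc q p R T \<rho> G B \<kappa> H)
  define h where "h = answer H"
  define v where "v = query H"
  \<comment> \<open>A query already projected to the empty set reveals nothing. Treating it as the
    query \<open>R\<close> supplies the nonempty \<open>d\<close> that the game demands.\<close>
  define d where "d = (if \<rho> v = {} then R else \<rho> v)"
  have d: "d \<subseteq> R" "d \<noteq> {}" using Suc.prems(1,6) by (auto simp: d_def)
  have hG: "answer (take j (H @ [x])) \<in> insert h G" if "j < length (H @ [x])" for j x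
    using that Suc.prems(10)[of j] by (cases "j = length H") (auto simp: h_def)
  consider (F) i where "i \<in> d" "awin q p (R - {i}) {t\<in>T. i \<in> \<rho> t \<and> \<rho> t \<noteq> d}
        (\<lambda>t. (if i \<in> \<rho> t then sym_diff (\<rho> t) d else \<rho> t) - {i}) (insert h G)"
    | (L) D where "d \<subseteq> D" "D \<subseteq> R" "awin q False (R - D) {t\<in>T. \<not> \<rho> t \<subseteq> D} (\<lambda>t. \<rho> t - D) (insert h G)"
    | (S) X z where "p" "q = 0" "X \<subseteq> T" "\<forall>t\<in>X. realz R d z (\<rho> t)" "\<forall>h'. \<exists>t\<in>X. t \<notin> insert h' (insert h G)"
    using Suc.prems(1)[unfolded awin.simps, THEN conjunct2, THEN spec, THEN spec, THEN mp, OF conjI[OF d], of h]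
    by (elim disjE bexE exE conjE) (assumption | rule that)+
  then show ?case
  proof cases
    case F
    define \<kappa>' where "\<kappa>' = (\<lambda>v k. if k = i then i \<notin> \<rho> v else \<kappa> v k)"
    define \<rho>' where "\<rho>' = (\<lambda>v. (if i \<in> \<rho> v then sym_diff (\<rho> v) d else \<rho> v) - {i})"
    define H' where "H' = H @ [(v, ans n (R - {i}) \<kappa>' v)]"
    have real: "realizable n (R - {i}) B \<rho>' \<kappa>' {t\<in>T. i \<in> \<rho> t \<and> \<rho> t \<noteq> d}"
      unfolding \<rho>'_def \<kappa>'_def by (rule realizable_fix[OF Suc.prems(2,5,6) F(1) d(1) Suc.prems(4)])
    have "fools n query answer (length H' + q + 1)"
    proof (rule Suc.IH[OF _ real Suc.prems(3)])
      show "awin q p (R - {i}) {t\<in>T. i \<in> \<rho> t \<and> \<rho> t \<noteq> d} \<rho>' (insert h G)"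
        using F(2) unfolding \<rho>'_def .
      show "B \<inter> (R - {i}) = {}" "finite (R - {i})" using Suc.prems(4,5) by auto
      show "\<rho>' u \<subseteq> R - {i}" for u using Suc.prems(6)[of u] d by (auto simp: \<rho>'_def)
      show "\<rho>' t \<noteq> {}" if "t \<in> {t\<in>T. i \<in> \<rho> t \<and> \<rho> t \<noteq> d}" for t
        using that F(1) by (auto simp: \<rho>'_def)
      show "transcript query H'" unfolding H'_def v_def by (rule transcript_snoc) fact
      show "answer (take j H') \<in> insert h G" if "j < length H'" for j
        using hG that unfolding H'_def by blast
      show "\<rho>' u = {} \<and> a = ans n (R - {i}) \<kappa>' u" if "(u, a) \<in> set H'" for u a
      proof (cases "(u, a) \<in> set H")
        case True
        from Suc.prems(9)[OF True] show ?thesis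
          using F(1) d by (auto simp: \<rho>'_def ans_def \<kappa>'_def fun_eq_iff)
      next
        case False
        then have "u = v" "a = ans n (R - {i}) \<kappa>' v" using that by (auto simp: H'_def)
        then show ?thesis using F(1) by (cases "\<rho> v = {}") (auto simp: \<rho>'_def d_def)
      qed
    qed
    then show ?thesis by (simp add: H'_def)
  next
    case L
    define \<kappa>' where "\<kappa>' = (\<lambda>v k. if k \<in> D then k \<notin> \<rho> v else \<kappa> v k)"
    define H' where "H' = H @ [(v, ans n (R - D) \<kappa>' v)]"
    have real: "realizable n (R - D) (B \<union> D) (\<lambda>v. \<rho> v - D) \<kappa>' {t\<in>T. \<not> \<rho> t \<subseteq> D}"
      unfolding \<kappa>'_def by (rule realizable_split[OF Suc.prems(2,5,6) L(2) Suc.prems(4)])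
    have "fools n query answer (length H' + q + 1)"
    proof (rule Suc.IH[OF L(3) real])
      show "(B \<union> D) \<inter> (R - D) = {}" "finite (R - D)" using Suc.prems(4,5) by auto
      show "\<rho> u - D \<subseteq> R - D" for u using Suc.prems(6)[of u] by auto
      show "\<rho> t - D \<noteq> {}" if "t \<in> {t\<in>T. \<not> \<rho> t \<subseteq> D}" for t
        using that by auto
      show "transcript query H'" unfolding H'_def v_def by (rule transcript_snoc) fact
      show "answer (take j H') \<in> insert h G" if "j < length H'" for j
        using hG that unfolding H'_def by blast
      show "\<rho> u - D = {} \<and> a = ans n (R - D) \<kappa>' u" if "(u, a) \<in> set H'" for u a
      proof (cases "(u, a) \<in> set H")
        case True
        from Suc.prems(9)[OF True] show ?thesis
          using L(2) d by (auto simp: ans_def \<kappa>'_def fun_eq_iff)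
      next
        case False
        then have "u = v" "a = ans n (R - D) \<kappa>' v" using that by (auto simp: H'_def)
        then show ?thesis using L(1) by (auto simp: d_def split: if_splits)
      qed
    qed simp
    then show ?thesis by (simp add: H'_def)
  next
    case S
    define a where "a i \<longleftrightarrow> i < n \<and> (if i \<in> R then \<rho> v = {} \<or> i \<notin> z else \<kappa> v i)" for i
    define H' where "H' = H @ [(v, a)]"
    obtain t where t: "t \<in> X" "t \<notin> insert (answer H') (insert h G)" using S(5) by blast
    obtain N where N: "unip R N" "\<forall>i\<in>R. par (N i) (\<rho> t)" "\<forall>i\<in>R. par (N i) d \<longleftrightarrow> i \<in> z"
      using S(4) t(1) unfolding realz_def by blast
    have tT: "t \<in> T" using t(1) S(3) by auto
    obtain Y where Y: "inst n t (orc n R B \<rho> \<kappa> N Y)"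
      using realizable_inst[OF Suc.prems(2) tT Suc.prems(6) Suc.prems(7)[OF tT] N(1)] N(2) by blast
    have "fools n query answer (Suc (length H'))"
    proof (rule foolsI[OF _ Y])
      show "transcript query H'" unfolding H'_def v_def by (rule transcript_snoc) fact
      show "\<forall>j\<le>length H'. answer (take j H') \<noteq> t"
      proof (intro allI impI)
        fix j assume j: "j \<le> length H'"
        show "answer (take j H') \<noteq> t"
        proof (cases "j = length H'")
          case False
          then have "answer (take j H') \<in> insert h G" using hG j unfolding H'_def by (meson le_neq_implies_less)
          then show ?thesis using t(2) by auto
        qed (use t(2) in auto)
      qed
      show "\<forall>(u, b)\<in>set H'. orc n R B \<rho> \<kappa> N Y u = b"
      proof safe
        fix u b assume ub: "(u, b) \<in> set H'"
        show "orc n R B \<rho> \<kappa> N Y u = b"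
        proof (cases "(u, b) \<in> set H")
          case True
          from Suc.prems(9)[OF True] show ?thesis using orc_empty by blast
        next
          case False
          then have u: "u = v" "b = a" using ub by (auto simp: H'_def)
          have "B = {}" using S(1) Suc.prems(3) by simp
          then show ?thesis using N(3) by (cases "\<rho> v = {}") (auto simp: u fun_eq_iff orc_def a_def d_def)
        qed
      qed
    qed
    then show ?thesis using S(2) by (simp add: H'_def)
  qed
qed

text \<open>Accounting: the first query \<open>q0\<close> becomes the origin, its answer is all
  ones, and every nonempty label then belongs to exactly one vertex. \<open>n - 2\<close> queries
  remain, and \<open>g\<close> is the guess made before any query.\<close>

theorem fools_of_awin:
  assumes n: "n \<ge> 2" and
    win: "\<And>(T :: vec set) \<sigma> g. finite T \<Longrightarrow> (\<And>t. t \<in> T \<Longrightarrow> \<sigma> t \<noteq> {} \<and> \<sigma> t \<subseteq> {..<n}) \<Longrightarrow>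
      (\<And>W. W \<noteq> {} \<Longrightarrow> W \<subseteq> {..<n} \<Longrightarrow> card {t\<in>T. \<sigma> t = W} = 1) \<Longrightarrow> awin (n - 2) True {..<n} T \<sigma> {g}"
  shows "fools n query answer n"
proof -
  define q0 where "q0 = query []"
  define \<rho> where "\<rho> v = {i. i < n \<and> v i \<noteq> q0 i}" for v
  define \<kappa> :: "vec \<Rightarrow> vec" where "\<kappa> = (\<lambda>v k. False)"
  define T where "T = {t \<in> cube n. \<rho> t \<noteq> {}}"
  define H where "H = [(q0, ans n {..<n} \<kappa> q0)]"
  define dec where "dec W = (\<lambda>i. i < n \<and> (q0 i \<noteq> (i \<in> W)))" for W
  have dec1: "dec (\<rho> t) = t" if "t \<in> cube n" for t
  proof
    fix i show "dec (\<rho> t) i = t i"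
      using that by (cases "i < n") (auto simp: dec_def \<rho>_def cube_def)
  qed
  have dec2: "\<rho> (dec W) = W \<and> dec W \<in> cube n" if "W \<subseteq> {..<n}" for W
  proof -
    have "i \<in> \<rho> (dec W) \<longleftrightarrow> i \<in> W" for i
      using that by (cases "i < n") (auto simp: dec_def \<rho>_def)
    then show ?thesis by (auto simp: dec_def cube_def)
  qed
  have sub: "\<rho> v \<subseteq> {..<n}" for v by (auto simp: \<rho>_def)
  have "T \<subseteq> dec ` Pow {..<n}"
  proof
    fix t assume "t \<in> T"
    then have "dec (\<rho> t) = t" by (intro dec1) (simp add: T_def)
    then show "t \<in> dec ` Pow {..<n}" using sub[of t] by (metis PowI imageI)
  qed
  then have fin: "finite T" by (rule finite_subset) simp
  have one: "card {t\<in>T. \<rho> t = W} = 1" if "W \<noteq> {}" "W \<subseteq> {..<n}" for W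
  proof -
    have "t = dec W" if "t \<in> T" "\<rho> t = W" for t
      using dec1[of t] that by (simp add: T_def)
    then have "{t\<in>T. \<rho> t = W} = {dec W}" using dec2[OF that(2)] that(1) unfolding T_def by blast
    then show ?thesis by simp
  qed
  have real: "realizable n {..<n} {} \<rho> \<kappa> T"
    unfolding realizable_def
  proof (intro ballI allI impI)
    fix t N X
    assume t: "t \<in> T" and N: "unip {..<n} N" "\<forall>i\<in>{..<n}. par (N i) (\<rho> t)"
    obtain P A where PA: "perm_mat n P" "upper_triangular n A" "invertible_mat n A"
      "\<And>t v i. i < n \<Longrightarrow> matousek_outmap n P A t v i \<longleftrightarrow> par (N i) {j. j < n \<and> v j \<noteq> t j}"
      by (rule matousek_of_unip[OF N(1)]) (rule that)
    have "matousek_outmap n P A t v i = orc n {..<n} {} \<rho> \<kappa> N X v i" for v i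
    proof (cases "i < n")
      case True
      have "{j. j < n \<and> v j \<noteq> t j} = sym_diff (\<rho> v) (\<rho> t)" by (auto simp: \<rho>_def)
      moreover have "finite (\<rho> v)" "finite (\<rho> t)" by (auto simp: \<rho>_def)
      ultimately show ?thesis using PA(4)[OF True, of t v] par_sym_diff[of "\<rho> v" "\<rho> t" "N i"] N(2) True
        by (simp add: orc_def)
    next
      case False
      then show ?thesis by (simp add: orc_def \<kappa>_def matousek_outmap_def mat_vec_def)
    qed
    then have "matousek_outmap n P A t = orc n {..<n} {} \<rho> \<kappa> N X" by blast
    then show "inst n t (orc n {..<n} {} \<rho> \<kappa> N X)" using PA t unfolding inst_def T_def by blast
  qed
  have aw: "awin (n - 2) True {..<n} T \<rho> {answer []}"
  proof (rule win[OF fin])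
    show "\<rho> t \<noteq> {} \<and> \<rho> t \<subseteq> {..<n}" if "t \<in> T" for t
      using sub[of t] that unfolding T_def by blast
  qed (rule one)
  have "fools n query answer (length H + (n - 2) + 1)"
  proof (rule awin_fools[OF aw real])
    show "transcript query H"
      using transcript_snoc[OF transcript_Nil, of query] by (simp add: H_def q0_def)
    show "\<rho> t \<noteq> {}" if "t \<in> T" for t using that by (simp add: T_def)
    show "\<rho> v = {} \<and> a = ans n {..<n} \<kappa> v" if "(v, a) \<in> set H" for v a
      using that by (simp add: H_def \<rho>_def)
    show "answer (take j H) \<in> {answer []}" if "j < length H" for j
      using that by (simp add: H_def)
  qed (rule sub | simp)+
  moreover have "length H + (n - 2) + 1 = n" using n by (simp add: H_def)
  ultimately show ?thesis by simp
qed

section \<open>Labels and averaging\<close>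

declare awin.simps(2) [simp del]

text \<open>Uniform multiplicity survives both moves and reduces counting sinks to counting
  labels.\<close>

definition lab :: "nat \<Rightarrow> nat set \<Rightarrow> 'a set \<Rightarrow> ('a \<Rightarrow> nat set) \<Rightarrow> bool" where
  "lab l R T \<sigma> \<longleftrightarrow> finite R \<and> finite T \<and> (\<forall>t\<in>T. \<sigma> t \<noteq> {} \<and> \<sigma> t \<subseteq> R) \<and>
     (\<forall>W. W \<noteq> {} \<longrightarrow> W \<subseteq> R \<longrightarrow> card {t\<in>T. \<sigma> t = W} = l)"

abbreviation fixed_targets :: "nat set \<Rightarrow> nat \<Rightarrow> ('a \<Rightarrow> nat set) \<Rightarrow> 'a set \<Rightarrow> 'a set" where
  "fixed_targets d i \<sigma> T \<equiv> {t\<in>T. i \<in> \<sigma> t \<and> \<sigma> t \<noteq> d}"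

abbreviation fixed_label :: "nat set \<Rightarrow> nat \<Rightarrow> ('a \<Rightarrow> nat set) \<Rightarrow> 'a \<Rightarrow> nat set" where
  "fixed_label d i \<sigma> \<equiv> \<lambda>t. (if i \<in> \<sigma> t then sym_diff (\<sigma> t) d else \<sigma> t) - {i}"

lemma labD:
  assumes "lab l R T \<sigma>"
  shows "finite R" "finite T" "t \<in> T \<Longrightarrow> \<sigma> t \<noteq> {}" "t \<in> T \<Longrightarrow> \<sigma> t \<subseteq> R"
    "W \<noteq> {} \<Longrightarrow> W \<subseteq> R \<Longrightarrow> card {t\<in>T. \<sigma> t = W} = l"
  using assms unfolding lab_def by auto

lemma card_lab:
  assumes "lab l R T \<sigma>" "\<And>W. W \<in> \<W> \<Longrightarrow> W \<noteq> {} \<and> W \<subseteq> R"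
  shows "card {t\<in>T. \<sigma> t \<in> \<W>} = l * card \<W>"
proof -
  have "finite \<W>" using assms labD(1) by (metis Pow_iff finite_Pow_iff rev_finite_subset subsetI)
  moreover have "{t\<in>T. \<sigma> t \<in> \<W>} = (\<Union>W\<in>\<W>. {t\<in>T. \<sigma> t = W})" by auto
  moreover have "card (\<Union>W\<in>\<W>. {t\<in>T. \<sigma> t = W}) = (\<Sum>W\<in>\<W>. card {t\<in>T. \<sigma> t = W})"
    by (rule card_UN_disjoint) (use \<open>finite \<W>\<close> labD(2)[OF assms(1)] in auto)
  moreover have "(\<Sum>W\<in>\<W>. card {t\<in>T. \<sigma> t = W}) = (\<Sum>W\<in>\<W>. l)"
    by (rule sum.cong) (use labD(5)[OF assms(1)] assms(2) in auto)
  ultimately show ?thesis by simp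
qed

lemma card_targets:
  assumes "lab l R T \<sigma>"
  shows "card T = l * (2 ^ card R - 1)"
proof -
  have "{t\<in>T. \<sigma> t \<in> Pow R - {{}}} = T" using labD[OF assms] by auto
  moreover have "card {t\<in>T. \<sigma> t \<in> Pow R - {{}}} = l * card (Pow R - {{}})"
    by (rule card_lab[OF assms]) auto
  moreover have "card (Pow R - {{}}) = 2 ^ card R - 1"
    using labD(1)[OF assms] by (subst card_Diff_singleton) (auto simp: card_Pow)
  ultimately show ?thesis by simp
qed

text \<open>Adding \<open>d\<close> maps the labels containing \<open>i\<close> bijectively onto the
  subsets of \<open>R - {i}\<close>. The excluded label \<open>d\<close> is the one that would
  become empty.\<close>

lemma lab_fix:
  assumes L: "lab l R T \<sigma>" and d: "d \<subseteq> R" "i \<in> d"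
  shows "lab l (R - {i}) (fixed_targets d i \<sigma> T) (fixed_label d i \<sigma>)"
proof -
  have 1: "fixed_label d i \<sigma> t = W \<longleftrightarrow> \<sigma> t = sym_diff W d"
    if "i \<in> \<sigma> t" "i \<notin> W" for t W
  proof -
    have "sym_diff (\<sigma> t) d - {i} = sym_diff (\<sigma> t) d" using that d by auto
    then show ?thesis using that(1) by auto
  qed
  have "card {t \<in> fixed_targets d i \<sigma> T. fixed_label d i \<sigma> t = W} = l"
    if W: "W \<noteq> {}" "W \<subseteq> R - {i}" for W
  proof -
    have "i \<notin> W" using W by auto
    have "{t \<in> fixed_targets d i \<sigma> T. fixed_label d i \<sigma> t = W} = {t\<in>T. \<sigma> t = sym_diff W d}"
    proof (rule set_eqI)
      fix t
      define X where "X = sym_diff W d"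
      have X: "i \<in> X" "X \<noteq> d" using W d \<open>i \<notin> W\<close> by (auto simp: X_def)
      have "i \<in> \<sigma> t \<Longrightarrow> fixed_label d i \<sigma> t = W \<longleftrightarrow> \<sigma> t = X"
        unfolding X_def by (rule 1[OF _ \<open>i \<notin> W\<close>])
      then show "t \<in> {t \<in> fixed_targets d i \<sigma> T. fixed_label d i \<sigma> t = W} \<longleftrightarrow> t \<in> {t\<in>T. \<sigma> t = sym_diff W d}"
        unfolding mem_Collect_eq X_def[symmetric] using X by metis
    qed
    moreover have "sym_diff W d \<noteq> {}" "sym_diff W d \<subseteq> R" using W d by auto
    ultimately show ?thesis using labD(5)[OF L, of "sym_diff W d"] by simp
  qed
  moreover have "fixed_label d i \<sigma> t \<noteq> {} \<and> fixed_label d i \<sigma> t \<subseteq> R - {i}" if "t \<in> fixed_targets d i \<sigma> T" for t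
    using that labD(4)[OF L, of t] d by auto
  ultimately show ?thesis using labD(1,2)[OF L] unfolding lab_def by simp
qed

lemma lab_split:
  assumes L: "lab l R T \<sigma>" and D: "D \<subseteq> R"
  shows "lab (l * 2 ^ card D) (R - D) {t\<in>T. \<not> \<sigma> t \<subseteq> D} (\<lambda>t. \<sigma> t - D)"
proof -
  have fD: "finite D" using D labD(1)[OF L] by (rule finite_subset)
  have "card {t \<in> {t\<in>T. \<not> \<sigma> t \<subseteq> D}. \<sigma> t - D = W} = l * 2 ^ card D"
    if W: "W \<noteq> {}" "W \<subseteq> R - D" for W
  proof -
    have "{t \<in> {t\<in>T. \<not> \<sigma> t \<subseteq> D}. \<sigma> t - D = W} = {t\<in>T. \<sigma> t \<in> (\<lambda>E. W \<union> E) ` Pow D}"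
    proof (rule set_eqI)
      fix t
      have "\<sigma> t - D = W \<longleftrightarrow> \<sigma> t \<in> (\<lambda>E. W \<union> E) ` Pow D"
      proof
        assume "\<sigma> t - D = W"
        then have "\<sigma> t = W \<union> (\<sigma> t \<inter> D)" by auto
        then show "\<sigma> t \<in> (\<lambda>E. W \<union> E) ` Pow D" by blast
      qed (use W in auto)
      then show "t \<in> {t \<in> {t\<in>T. \<not> \<sigma> t \<subseteq> D}. \<sigma> t - D = W} \<longleftrightarrow> t \<in> {t\<in>T. \<sigma> t \<in> (\<lambda>E. W \<union> E) ` Pow D}"
        using W by auto
    qed
    moreover have "inj_on (\<lambda>E. W \<union> E) (Pow D)" using W by (intro inj_onI) blast
    ultimately show ?thesis using card_lab[OF L, of "(\<lambda>E. W \<union> E) ` Pow D"] W D fD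
      by (simp add: card_image card_Pow image_iff) blast
  qed
  moreover have "\<sigma> t - D \<noteq> {} \<and> \<sigma> t - D \<subseteq> R - D" if "t \<in> {t\<in>T. \<not> \<sigma> t \<subseteq> D}" for t
    using that labD(4)[OF L, of t] by auto
  ultimately show ?thesis using labD(1,2)[OF L] unfolding lab_def by simp
qed

lemma card_insert_Int_le:
  assumes "finite T"
  shows "card (T \<inter> insert h G) \<le> Suc (card (T \<inter> G))"
proof -
  have "T \<inter> insert h G \<subseteq> insert h (T \<inter> G)" by auto
  then have "card (T \<inter> insert h G) \<le> card (insert h (T \<inter> G))" using assms by (intro card_mono) auto
  also have "\<dots> \<le> Suc (card (T \<inter> G))" by (rule card_insert_le_m1) auto
  finally show ?thesis .
qed

text \<open>The extra 1 pays for the guess made after the last query.\<close>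

lemma awin_leaf:
  assumes "finite T" "card (T \<inter> G) + 1 < card T"
  shows "awin 0 p R T \<sigma> G"
  unfolding awin.simps
proof (intro allI)
  fix h
  have "card (T \<inter> insert h G) < card T" using card_insert_Int_le[OF assms(1), of h G] assms(2) by linarith
  then have "T \<inter> insert h G \<noteq> T" by auto
  then show "\<exists>t\<in>T. t \<notin> insert h G" by auto
qed

lemma awin_SucI:
  assumes "R \<noteq> {}"
    and "\<And>h d. d \<subseteq> R \<Longrightarrow> d \<noteq> {} \<Longrightarrow>
     (\<exists>i\<in>d. awin q p (R - {i}) (fixed_targets d i \<sigma> T) (fixed_label d i \<sigma>) (insert h G)) \<or>
     awin q False (R - d) {t\<in>T. \<not> \<sigma> t \<subseteq> d} (\<lambda>t. \<sigma> t - d) (insert h G) \<or>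
     (p \<and> q = 0 \<and> (\<exists>X\<subseteq>T. \<exists>z. (\<forall>t\<in>X. realz R d z (\<sigma> t)) \<and> card (X \<inter> insert h G) + 1 < card X))"
    and "finite T"
  shows "awin (Suc q) p R T \<sigma> G"
  unfolding awin.simps
proof (intro conjI allI impI)
  fix h d assume "d \<subseteq> R \<and> d \<noteq> {}"
  then have d: "d \<subseteq> R" "d \<noteq> {}" by auto
  have special: "\<forall>h'. \<exists>t\<in>X. t \<notin> insert h' (insert h G)" if "X \<subseteq> T" "card (X \<inter> insert h G) + 1 < card X" for X
    using awin_leaf[of X "insert h G" True "{}" "\<lambda>_. {}"] that assms(3) finite_subset by auto
  show "(\<exists>i\<in>d. awin q p (R - {i}) (fixed_targets d i \<sigma> T) (fixed_label d i \<sigma>) (insert h G)) \<or>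
     (\<exists>D. d \<subseteq> D \<and> D \<subseteq> R \<and> awin q False (R - D) {t\<in>T. \<not> \<sigma> t \<subseteq> D} (\<lambda>t. \<sigma> t - D) (insert h G)) \<or>
     (p \<and> q = 0 \<and> (\<exists>X\<subseteq>T. \<exists>z. (\<forall>t\<in>X. realz R d z (\<sigma> t)) \<and> (\<forall>h'. \<exists>t\<in>X. t \<notin> insert h' (insert h G))))"
    using assms(2)[OF d, of h]
  proof (elim disjE)
    assume L: "awin q False (R - d) {t\<in>T. \<not> \<sigma> t \<subseteq> d} (\<lambda>t. \<sigma> t - d) (insert h G)"
    show ?thesis by (rule disjI2, rule disjI1, rule exI[of _ d], intro conjI subset_refl d(1) L)
  next
    assume "p \<and> q = 0 \<and> (\<exists>X\<subseteq>T. \<exists>z. (\<forall>t\<in>X. realz R d z (\<sigma> t)) \<and> card (X \<inter> insert h G) + 1 < card X)"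
    then obtain X z where "p" "q = 0" "X \<subseteq> T" "\<forall>t\<in>X. realz R d z (\<sigma> t)" "card (X \<inter> insert h G) + 1 < card X"
      by blast
    then have "p \<and> q = 0 \<and> X \<subseteq> T \<and> (\<forall>t\<in>X. realz R d z (\<sigma> t)) \<and> (\<forall>h'. \<exists>t\<in>X. t \<notin> insert h' (insert h G))"
      using special by simp
    then show ?thesis by (intro disjI2) blast
  qed (rule disjI1)
qed (fact assms(1))

section \<open>Averaging the fixing move over the query\<close>

lemma sum_insert_Int_le:
  fixes w :: "'a \<Rightarrow> real"
  assumes "finite T" "\<And>t. t \<in> T \<Longrightarrow> 0 \<le> w t" "\<And>t. t \<in> T \<Longrightarrow> w t \<le> c" "0 \<le> c"
  shows "(\<Sum>t\<in>T \<inter> insert h G. w t) \<le> (\<Sum>t\<in>T \<inter> G. w t) + c"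
proof (cases "h \<in> T \<and> h \<notin> G")
  case True
  then have "T \<inter> insert h G = insert h (T \<inter> G)" by auto
  then show ?thesis using True assms by (simp add: add.commute)
next
  case False
  then have "T \<inter> insert h G = T \<inter> G" by auto
  then show ?thesis using assms by simp
qed

text \<open>Adding \<open>d\<close> exchanges zeros and ones inside \<open>d\<close>: the zeros in
  \<open>d - \<sigma> t\<close> disappear and the elements of \<open>\<sigma> t \<inter> d\<close>
  become zeros, among them \<open>i\<close>, which leaves \<open>R\<close>.\<close>

lemma fixed_zeros:
  assumes "finite R" "\<sigma> t \<subseteq> R" "d \<subseteq> R" "i \<in> d" "i \<in> \<sigma> t"
  shows "card (R - {i} - fixed_label d i \<sigma> t) = card (R - \<sigma> t) - card (d - \<sigma> t) + (card (\<sigma> t \<inter> d) - 1)"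
proof -
  have "R - {i} - fixed_label d i \<sigma> t = ((R - \<sigma> t) - (d - \<sigma> t)) \<union> (\<sigma> t \<inter> d - {i})"
    using assms by auto
  moreover have "card (((R - \<sigma> t) - (d - \<sigma> t)) \<union> (\<sigma> t \<inter> d - {i})) = card ((R - \<sigma> t) - (d - \<sigma> t)) + card (\<sigma> t \<inter> d - {i})"
    using assms by (intro card_Un_disjoint) (auto intro: finite_subset)
  moreover have "card ((R - \<sigma> t) - (d - \<sigma> t)) = card (R - \<sigma> t) - card (d - \<sigma> t)"
    using assms by (intro card_Diff_subset) (auto intro: finite_subset)
  moreover have "card (\<sigma> t \<inter> d - {i}) = card (\<sigma> t \<inter> d) - 1"
    using assms by (intro card_Diff_singleton) auto
  ultimately show ?thesis by simp
qed

lemma sum_fixed_swap: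
  fixes f :: "'a \<Rightarrow> nat \<Rightarrow> 'b :: comm_monoid_add"
  assumes "finite S" "finite d"
  shows "(\<Sum>i\<in>d. \<Sum>t\<in>{t\<in>S. i \<in> \<sigma> t \<and> \<sigma> t \<noteq> d}. f t i) = (\<Sum>t\<in>{t\<in>S. \<sigma> t \<noteq> d}. \<Sum>i\<in>\<sigma> t \<inter> d. f t i)"
proof -
  have "(\<Sum>i\<in>d. \<Sum>t\<in>{t\<in>S. i \<in> \<sigma> t \<and> \<sigma> t \<noteq> d}. f t i) = (\<Sum>i\<in>d. \<Sum>t\<in>{t\<in>{t\<in>S. \<sigma> t \<noteq> d}. i \<in> \<sigma> t}. f t i)"
    by (intro sum.cong) auto
  also have "\<dots> = (\<Sum>t\<in>{t\<in>S. \<sigma> t \<noteq> d}. \<Sum>i\<in>{i\<in>d. i \<in> \<sigma> t}. f t i)"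
    using assms by (intro sum.swap_restrict) auto
  also have "\<dots> = (\<Sum>t\<in>{t\<in>S. \<sigma> t \<noteq> d}. \<Sum>i\<in>\<sigma> t \<inter> d. f t i)"
    by (intro sum.cong) auto
  finally show ?thesis .
qed

text \<open>Double counting: a guess outlives the fixing of \<open>i\<close> only if
  \<open>i\<close> lies in \<open>\<sigma> t \<inter> d\<close>, so it is charged
  \<open>card (\<sigma> t \<inter> d)\<close> times in the sum over \<open>d\<close>. Some
  \<open>i\<close> does no worse than the average.\<close>

lemma average_fixed:
  fixes w :: "'a \<Rightarrow> real" and w' :: "nat \<Rightarrow> real"
  assumes fin: "finite R" "finite S" and d: "d \<subseteq> R" "d \<noteq> {}"
    and sub: "\<And>t. t \<in> S \<Longrightarrow> \<sigma> t \<subseteq> R" and pos: "\<And>t. t \<in> S \<Longrightarrow> 0 \<le> w t"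
    and le: "\<And>t. t \<in> S \<Longrightarrow> \<sigma> t \<inter> d \<noteq> {} \<Longrightarrow> \<sigma> t \<noteq> d \<Longrightarrow>
      real (card (\<sigma> t \<inter> d)) * w' (card (R - \<sigma> t) - card (d - \<sigma> t) + (card (\<sigma> t \<inter> d) - 1)) \<le> real (card d) * w t"
  shows "\<exists>i\<in>d. (\<Sum>t\<in>fixed_targets d i \<sigma> S. w' (card (R - {i} - fixed_label d i \<sigma> t))) \<le> (\<Sum>t\<in>S. w t)"
proof -
  have fd: "finite d" using d fin finite_subset by blast
  define s where "s i = (\<Sum>t\<in>fixed_targets d i \<sigma> S. w' (card (R - {i} - fixed_label d i \<sigma> t)))" for i
  have "(\<Sum>i\<in>d. s i) = (\<Sum>t\<in>{t\<in>S. \<sigma> t \<noteq> d}. \<Sum>i\<in>\<sigma> t \<inter> d. w' (card (R - {i} - fixed_label d i \<sigma> t)))"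
    unfolding s_def by (rule sum_fixed_swap[OF fin(2) fd])
  also have "\<dots> \<le> (\<Sum>t\<in>{t\<in>S. \<sigma> t \<noteq> d}. real (card d) * w t)"
  proof (rule sum_mono)
    fix t assume t: "t \<in> {t\<in>S. \<sigma> t \<noteq> d}"
    have "(\<Sum>i\<in>\<sigma> t \<inter> d. w' (card (R - {i} - fixed_label d i \<sigma> t)))
      = (\<Sum>i\<in>\<sigma> t \<inter> d. w' (card (R - \<sigma> t) - card (d - \<sigma> t) + (card (\<sigma> t \<inter> d) - 1)))"
      by (rule sum.cong) (use fixed_zeros[of R \<sigma> t d] fin(1) sub[of t] d(1) t in auto)
    also have "\<dots> \<le> real (card d) * w t"
      using le[of t] pos[of t] t by (cases "\<sigma> t \<inter> d = {}") auto
    finally show "(\<Sum>i\<in>\<sigma> t \<inter> d. w' (card (R - {i} - fixed_label d i \<sigma> t))) \<le> real (card d) * w t" .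
  qed
  also have "\<dots> \<le> (\<Sum>t\<in>S. real (card d) * w t)"
    using fin pos by (intro sum_mono2) auto
  also have "\<dots> = real (card d) * (\<Sum>t\<in>S. w t)" by (simp add: sum_distrib_left)
  finally have tot: "(\<Sum>i\<in>d. s i) \<le> real (card d) * (\<Sum>t\<in>S. w t)" .
  have "\<exists>i\<in>d. s i \<le> (\<Sum>t\<in>S. w t)"
  proof (rule ccontr)
    assume "\<not> ?thesis"
    then have "(\<Sum>i\<in>d. (\<Sum>t\<in>S. w t)) < (\<Sum>i\<in>d. s i)"
      using fd d by (intro sum_strict_mono) auto
    then show False using tot by simp
  qed
  then show ?thesis unfolding s_def .
qed

section \<open>The phase after a splitting move\<close>

text \<open>
  Cost of a guessed sink with \<open>b\<close> zeros in its label, at \<open>n = card R + b\<close>. The constant \<open>36/5\<close> and the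
  initial values make \<open>cost_fix_le\<close> and the doubling lemmas below hold for all \<open>n\<close>.
\<close>

definition cost :: "nat \<Rightarrow> real" where
  "cost n = (if n \<le> 1 then 1 else if n \<le> 3 then 1/2 else if n = 4 then 1/3 else if n = 5 then 1/4
     else 36 / (5 * (real n * (real n + 1))))"

lemma cost_simps [simp]: "cost 0 = 1" "cost (Suc 0) = 1" "cost 1 = 1" "cost 2 = 1/2" "cost 3 = 1/2" "cost 4 = 1/3" "cost 5 = 1/4"
  by (simp_all add: cost_def)

lemma cost_large: "6 \<le> n \<Longrightarrow> cost n = 36 / (5 * (real n * (real n + 1)))"
  by (simp add: cost_def)

lemma nat_le5: "(n::nat) \<le> 5 \<longleftrightarrow> n = 0 \<or> n = 1 \<or> n = 2 \<or> n = 3 \<or> n = 4 \<or> n = 5"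
  by auto

lemma cost_pos [simp]: "0 < cost n"
  by (cases "n \<le> 5") (auto simp: nat_le5 cost_large)

lemma cost_nonneg [simp]: "0 \<le> cost n"
  using cost_pos[of n] by linarith

lemma cost_large_le:
  assumes "6 \<le> m" "6 \<le> n" "p * (real n * (real n + 1)) \<le> q * (real m * (real m + 1))"
  shows "p * cost m \<le> q * cost n"
proof -
  define M where "M = real m * (real m + 1)"
  define N where "N = real n * (real n + 1)"
  have pos: "0 < M" "0 < N" using assms by (auto simp: M_def N_def intro: mult_pos_pos)
  have "p * N \<le> q * M" using assms(3) by (simp add: M_def N_def)
  then have "p / M \<le> q / N" using pos by (simp add: field_simps)
  then have "36 / 5 * (p / M) \<le> 36 / 5 * (q / N)"
    by (intro mult_left_mono) auto
  then show ?thesis using assms by (simp add: cost_large M_def N_def)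
qed

lemma cost_Suc_le: "cost (Suc n) \<le> cost n"
proof (cases "n \<le> 5")
  case True
  then show ?thesis by (auto simp: nat_le5 cost_def)
next
  case False
  then show ?thesis using cost_large_le[of "Suc n" n 1 1] by (simp add: algebra_simps)
qed

lemma cost_antimono: "m \<le> n \<Longrightarrow> cost n \<le> cost m"
  by (rule lift_Suc_antimono_le[of cost]) (rule cost_Suc_le)

text \<open>For fixed \<open>X\<close> and \<open>e\<close> the difference of the sides is linear in
  \<open>a\<close> with slope \<open>L\<close>. If \<open>L\<close> is negative the worst case is
  the largest admissible \<open>a\<close>, where \<open>3 * a = X - e\<close>; there three times the
  difference splits into nonnegative terms.\<close>

lemma cost_split_poly:
  fixes a X e :: real
  assumes "a \<ge> 1" "X \<ge> 3 * a + e" "X \<ge> 8" "e \<ge> 0"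
  shows "a * ((X + e) * (X + e + 1)) \<le> (2 * a + e) * ((X - 2) * (X - 1))"
proof -
  define L where "L = 2 * ((X - 2) * (X - 1)) - (X + e) * (X + e + 1)"
  have goal: "a * L + e * ((X - 2) * (X - 1)) \<ge> 0"
  proof (cases "L \<ge> 0")
    case True
    then show ?thesis using assms by (intro add_nonneg_nonneg mult_nonneg_nonneg) auto
  next
    case False
    then have "(X - e) * L \<le> (3 * a) * L" using assms by (intro mult_right_mono_neg) auto
    moreover have "(X - e) * L + 3 * (e * ((X - 2) * (X - 1))) = X * X * (X - 7) + (4 + e * e - 3 * e) * X + e * e * e + e * e + 2 * e"
      unfolding L_def by algebra
    moreover have "X * X * (X - 7) \<ge> 0" "(4 + e * e - 3 * e) * X \<ge> 0" "e * e * e + e * e + 2 * e \<ge> 0"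
    proof -
      have "4 + e * e - 3 * e = (e - 3/2) * (e - 3/2) + 7/4" by algebra
      then have "4 + e * e - 3 * e \<ge> 0" using zero_le_square[of "e - 3/2"] by linarith
      then show "(4 + e * e - 3 * e) * X \<ge> 0" using assms by simp
    qed (use assms in simp_all)
    ultimately show ?thesis by (simp add: mult.assoc) 
  qed
  then show ?thesis unfolding L_def by (simp add: algebra_simps)
qed

text \<open>If \<open>a\<close> is at least \<open>be + 2\<close>, the argument does not drop and
  monotonicity suffices. Otherwise the drop is paid for by the factor \<open>(a + be) / a\<close>,
  that is, by the choices of \<open>i\<close> that kill the guess.\<close>

lemma cost_fix_le:
  assumes "a \<ge> 1" "be \<ge> 1" "n \<ge> a + 2 * be"
  shows "real a * cost (n + a - be - 2) \<le> real (a + be) * cost n"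
proof (cases "be + 2 \<le> a")
  case True
  then have "cost (n + a - be - 2) \<le> cost n" by (intro cost_antimono) linarith
  then have "real a * cost (n + a - be - 2) \<le> real a * cost n" by (intro mult_left_mono) auto
  also have "\<dots> \<le> real (a + be) * cost n" by (intro mult_right_mono) auto
  finally show ?thesis .
next
  case False
  define m where "m = n + a - be - 2"
  have n: "n = m + be + 2 - a" and m: "2 * a + be \<le> m + 2" using assms False by (auto simp: m_def)
  show ?thesis
  proof (cases "m \<le> 5")
    case True
    then have "a \<le> 3" "be \<le> 5" using m assms by auto
    then have "a = 1 \<or> a = 2 \<or> a = 3" "be = 1 \<or> be = 2 \<or> be = 3 \<or> be = 4 \<or> be = 5" using assms by auto
    moreover have "m = 0 \<or> m = 1 \<or> m = 2 \<or> m = 3 \<or> m = 4 \<or> m = 5" using True by auto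
    ultimately have "real a * cost m \<le> real (a + be) * cost n"
      using m unfolding n by (elim disjE) (simp_all add: cost_def)
    then show ?thesis by (simp add: m_def)
  next
    case F2: False
    have rn: "real n = real m + 2 + real be - real a" using False by (simp add: n of_nat_diff)
    have n6: "6 \<le> n" using F2 False n by linarith
    have "real a * (real n * (real n + 1)) \<le> (real a + real be) * (real m * (real m + 1))"
    proof (cases "a = be + 1")
      case True
      have "real be * real m \<ge> real be * 6" using F2 by (intro mult_left_mono) auto
      then have "0 \<le> real be * real m - 2 * real be - 2" using assms by linarith
      then have "0 \<le> (real m + 1) * (real be * real m - 2 * real be - 2)" by (intro mult_nonneg_nonneg) auto
      moreover have "real n = real m + 1" "real a = real be + 1" using rn True by auto
      ultimately show ?thesis by (simp add: algebra_simps)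
    next
      case False
      then have "a \<le> be" using \<open>\<not> be + 2 \<le> a\<close> by simp
      have "real a * ((real m + 2 + (real be - real a)) * (real m + 2 + (real be - real a) + 1)) \<le>
         (2 * real a + (real be - real a)) * ((real m + 2 - 2) * (real m + 2 - 1))"
        by (rule cost_split_poly) (use assms F2 m \<open>a \<le> be\<close> in linarith)+
      moreover have "real m + 2 + (real be - real a) = real n" "2 * real a + (real be - real a) = real a + real be"
        "real m + 2 - 2 = real m" "real m + 2 - 1 = real m + 1" using rn by auto
      ultimately show ?thesis by (simp only:)
    qed
    then show ?thesis using cost_large_le[OF _ n6, of m] F2 unfolding m_def[symmetric] by simp
  qed
qed

text \<open>Splitting a singleton doubles the sinks per label and lowers \<open>card R\<close> plus
  the number of zeros by one or two, according to whether the coordinate was a one or a zero of the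
  label. This lemma and the next bound the price increase in these two cases by the same factor
  2.\<close>

lemma cost_Suc_double: "n \<ge> 1 \<Longrightarrow> cost n \<le> 2 * cost (Suc n)"
proof (cases "n \<le> 5")
  case True
  then show "n \<ge> 1 \<Longrightarrow> ?thesis" by (auto simp: nat_le5 cost_def)
next
  case False
  have "real n * real n \<ge> 6 * real n" using False by (intro mult_right_mono) auto
  then have "1 * ((real n + 1) * (real n + 1 + 1)) \<le> 2 * (real n * (real n + 1))"
    using False unfolding ring_distribs by linarith
  then show ?thesis using False cost_large_le[of n "Suc n" 1 2] by (simp add: add.commute)
qed

lemma cost_Suc2_double: "n \<ge> 1 \<Longrightarrow> cost n \<le> 2 * cost (n + 2)"
proof (cases "n \<le> 5")
  case True
  then show "n \<ge> 1 \<Longrightarrow> ?thesis" by (auto simp: nat_le5 cost_def)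
next
  case False
  have "real n * real n \<ge> 6 * real n" using False by (intro mult_right_mono) auto
  then have "1 * ((real n + 2) * (real n + 2 + 1)) \<le> 2 * (real n * (real n + 1))"
    using False unfolding ring_distribs by linarith
  then show ?thesis using False cost_large_le[of n "n + 2" 1 2] by (simp add: add.commute)
qed

text \<open>The sum over \<open>j\<close> prepays all future guesses, each at the highest price
  possible when it is made, that of a label without zeros. The right side is the total price of all
  sinks left once \<open>sl\<close> coordinates remain. Averaged fixing does not raise the price of
  the guesses; splitting a singleton at most doubles it while the right side doubles
  exactly.\<close>

lemma awin_slack:
  assumes "lab l R T \<sigma>" "card R = q + sl" "sl = 1 \<or> sl = 2"
    and "(\<Sum>t\<in>T \<inter> G. cost (card R + card (R - \<sigma> t))) + (\<Sum>j=sl..card R. cost j) < real l * (2 ^ sl - 1) * cost sl"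
  shows "awin q p R T \<sigma> G"
  using assms
proof (induction q arbitrary: l p R T \<sigma> G)
  case (0 l p R T \<sigma> G)
  note fin = labD(1,2)[OF "0.prems"(1)]
  have cR: "card R = sl" using "0.prems"(2) by simp
  \<comment> \<open>At the end all labels have the same price, also for \<open>sl = 2\<close>,
    because \<open>cost 2 = cost 3\<close>.\<close>
  have "cost (card R + card (R - \<sigma> t)) = cost sl" if "t \<in> T" for t
  proof -
    have "\<sigma> t \<noteq> {}" "\<sigma> t \<subseteq> R" using labD(3,4)[OF "0.prems"(1) that] by auto
    then have "card (\<sigma> t) \<ge> 1" "card (R - \<sigma> t) = card R - card (\<sigma> t)" "card (\<sigma> t) \<le> card R"
      using fin by (auto simp: card_Diff_subset finite_subset card_mono card_gt_0_iff Suc_le_eq)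
    then have "card (R - \<sigma> t) = 0 \<or> sl = 2 \<and> card (R - \<sigma> t) = 1" using cR "0.prems"(3) by auto
    then show ?thesis using cR by auto
  qed
  then have "(\<Sum>t\<in>T \<inter> G. cost (card R + card (R - \<sigma> t))) = real (card (T \<inter> G)) * cost sl" by simp
  then have "(real (card (T \<inter> G)) + 1) * cost sl < real l * (2 ^ sl - 1) * cost sl"
    using "0.prems"(4) cR by (simp add: algebra_simps)
  then have "real (card (T \<inter> G)) + 1 < real l * (2 ^ sl - 1)" by simp
  also have "\<dots> = real (card T)" using card_targets[OF "0.prems"(1)] cR by (simp add: of_nat_diff)
  finally have "card (T \<inter> G) + 1 < card T" by linarith
  then show ?case by (rule awin_leaf[OF fin(2)])
next
  case (Suc q l p R T \<sigma> G)
  note fin = labD(1,2)[OF Suc.prems(1)]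
  let ?r = "card R"
  have sub: "\<sigma> t \<noteq> {}" "\<sigma> t \<subseteq> R" "card (\<sigma> t) \<ge> 1" "card (\<sigma> t) + card (R - \<sigma> t) = ?r" if "t \<in> T" for t
  proof -
    show "\<sigma> t \<noteq> {}" "\<sigma> t \<subseteq> R" using labD(3,4)[OF Suc.prems(1) that] by auto
    then show "card (\<sigma> t) \<ge> 1" "card (\<sigma> t) + card (R - \<sigma> t) = ?r"
      using fin by (auto simp: card_Diff_subset finite_subset card_mono card_gt_0_iff Suc_le_eq)
  qed
  have range: "(\<Sum>j=sl..?r. cost j) = (\<Sum>j=sl..?r - 1. cost j) + cost ?r"
    using Suc.prems(2) by simp
  show ?case
  proof (rule awin_SucI[OF _ _ fin(2)])
    show "R \<noteq> {}" using Suc.prems(2) by auto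
    fix h d assume d: "d \<subseteq> R" "d \<noteq> {}"
    have fd: "finite d" using d fin finite_subset by blast
    let ?S = "T \<inter> insert h G"
    have S: "(\<Sum>t\<in>?S. cost (?r + card (R - \<sigma> t))) \<le> (\<Sum>t\<in>T \<inter> G. cost (?r + card (R - \<sigma> t))) + cost ?r"
      by (rule sum_insert_Int_le[OF fin(2)]) (auto intro: cost_antimono)
    show "(\<exists>i\<in>d. awin q p (R - {i}) (fixed_targets d i \<sigma> T) (fixed_label d i \<sigma>) (insert h G)) \<or>
     awin q False (R - d) {t\<in>T. \<not> \<sigma> t \<subseteq> d} (\<lambda>t. \<sigma> t - d) (insert h G) \<or>
     (p \<and> q = 0 \<and> (\<exists>X\<subseteq>T. \<exists>z. (\<forall>t\<in>X. realz R d z (\<sigma> t)) \<and> card (X \<inter> insert h G) + 1 < card X))"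
    proof (cases "card d = 1")
      case True
      then obtain x where x: "d = {x}" "x \<in> R" using d by (auto simp: card_1_singleton_iff)
      let ?T = "{t\<in>T. \<not> \<sigma> t \<subseteq> d}"
      have cR: "card (R - d) = ?r - 1" using x fin by simp
      have le: "cost (card (R - d) + card (R - d - (\<sigma> t - d))) \<le> 2 * cost (?r + card (R - \<sigma> t))" if "t \<in> ?T" for t
      proof (cases "x \<in> \<sigma> t")
        case True
        have "R - d - (\<sigma> t - d) = R - \<sigma> t" using True x by auto
        moreover have "?r \<ge> 2" using Suc.prems(2,3) by auto
        ultimately show ?thesis using cost_Suc_double[of "?r - 1 + card (R - \<sigma> t)"] cR by simp
      next
        case False
        have "R - d - (\<sigma> t - d) = (R - \<sigma> t) - {x}" using False x by auto
        then have "card (R - d - (\<sigma> t - d)) = card (R - \<sigma> t) - 1" using False x fin by simp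
        moreover have "card (R - \<sigma> t) \<ge> 1" using False x fin by (auto simp: Suc_le_eq card_gt_0_iff)
        moreover have "?r \<ge> 2" using Suc.prems(2,3) by auto
        moreover have "?r - 1 + (card (R - \<sigma> t) - 1) + 2 = ?r + card (R - \<sigma> t)"
          using calculation by linarith
        ultimately show ?thesis using cost_Suc2_double[of "?r - 1 + (card (R - \<sigma> t) - 1)"] cR by simp
      qed
      have "(\<Sum>t\<in>?T \<inter> insert h G. cost (card (R - d) + card (R - d - (\<sigma> t - d)))) \<le> (\<Sum>t\<in>?T \<inter> insert h G. 2 * cost (?r + card (R - \<sigma> t)))"
        by (rule sum_mono) (rule le, auto)
      also have "\<dots> \<le> (\<Sum>t\<in>?S. 2 * cost (?r + card (R - \<sigma> t)))"
        using fin by (intro sum_mono2) auto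
      also have "\<dots> = 2 * (\<Sum>t\<in>?S. cost (?r + card (R - \<sigma> t)))" by (simp add: sum_distrib_left)
      finally have A: "(\<Sum>t\<in>?T \<inter> insert h G. cost (card (R - d) + card (R - d - (\<sigma> t - d)))) \<le> 2 * (\<Sum>t\<in>?S. cost (?r + card (R - \<sigma> t)))" .
      have nn: "0 \<le> (\<Sum>j=sl..?r - 1. cost j)" by (rule sum_nonneg) simp
      have L: "lab (l * 2 ^ card d) (R - d) ?T (\<lambda>t. \<sigma> t - d)" by (rule lab_split[OF Suc.prems(1) d(1)])
      have "awin q False (R - d) ?T (\<lambda>t. \<sigma> t - d) (insert h G)"
      proof (rule Suc.IH[OF L _ Suc.prems(3)])
        show "card (R - d) = q + sl" using cR Suc.prems(2) by simp
        have "2 * (real l * (2 ^ sl - 1) * cost sl) = real (l * 2 ^ card d) * (2 ^ sl - 1) * cost sl"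
          using True by simp
        then show "(\<Sum>t\<in>?T \<inter> insert h G. cost (card (R - d) + card (R - d - (\<sigma> t - d)))) + (\<Sum>j=sl..card (R - d). cost j)
          < real (l * 2 ^ card d) * (2 ^ sl - 1) * cost sl"
          using A S range nn Suc.prems(4) unfolding cR by linarith
      qed
      then show ?thesis by blast
    next
      case False
      then have d2: "card d \<ge> 2" using d fd by (metis One_nat_def Suc_leI card_gt_0_iff le_neq_implies_less numeral_2_eq_2)
      have "\<exists>i\<in>d. (\<Sum>t\<in>fixed_targets d i \<sigma> ?S. cost (?r - 1 + card (R - {i} - fixed_label d i \<sigma> t)))
        \<le> (\<Sum>t\<in>?S. cost (?r + card (R - \<sigma> t)))"
      proof (rule average_fixed[OF fin(1) _ d])
        fix t assume t: "t \<in> ?S" "\<sigma> t \<inter> d \<noteq> {}" "\<sigma> t \<noteq> d"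
        define a where "a = card (\<sigma> t \<inter> d)"
        define be where "be = card (d - \<sigma> t)"
        have ft: "finite (\<sigma> t)" using sub(2) t(1) fin finite_subset by blast
        have D: "card d = a + be"
          unfolding a_def be_def using card_Int_Diff[OF fd, of "\<sigma> t"] by (simp add: Int_commute)
        have a1: "a \<ge> 1" using t(2) ft by (simp add: a_def Suc_le_eq card_gt_0_iff)
        have ab: "a \<le> card (\<sigma> t)" unfolding a_def using ft by (intro card_mono) auto
        have beb: "be \<le> card (R - \<sigma> t)" unfolding be_def using fin d by (intro card_mono) auto
        define n where "n = ?r + card (R - \<sigma> t)"
        have n: "n = card (\<sigma> t) + 2 * card (R - \<sigma> t)" using sub(4)[of t] t(1) by (simp add: n_def)
        have m: "?r - 1 + (card (R - \<sigma> t) - be + (a - 1)) = n + a - be - 2"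
          using beb a1 Suc.prems(2) by (simp add: n_def)
        have "real a * cost (n + a - be - 2) \<le> real (a + be) * cost n"
        proof (cases "be = 0")
          case True
          then have "n + a - be - 2 \<ge> n" using D d2 by simp
          then show ?thesis using True by (simp add: cost_antimono mult_left_mono)
        next
          case False
          then show ?thesis using a1 ab beb n by (intro cost_fix_le) auto
        qed
        then show "real (card (\<sigma> t \<inter> d)) * cost (?r - 1 + (card (R - \<sigma> t) - card (d - \<sigma> t) + (card (\<sigma> t \<inter> d) - 1)))
          \<le> real (card d) * cost (?r + card (R - \<sigma> t))"
          unfolding a_def[symmetric] be_def[symmetric] n_def[symmetric] D m .
      qed (use fin sub in auto)
      then obtain i where i: "i \<in> d" "(\<Sum>t\<in>fixed_targets d i \<sigma> ?S. cost (?r - 1 + card (R - {i} - fixed_label d i \<sigma> t)))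
        \<le> (\<Sum>t\<in>?S. cost (?r + card (R - \<sigma> t)))" by blast
      let ?T = "fixed_targets d i \<sigma> T"
      have cR: "card (R - {i}) = ?r - 1" using i d fin by auto
      have ST: "fixed_targets d i \<sigma> ?S = ?T \<inter> insert h G" by auto
      have L: "lab l (R - {i}) ?T (fixed_label d i \<sigma>)" by (rule lab_fix[OF Suc.prems(1) d(1) i(1)])
      have "awin q p (R - {i}) ?T (fixed_label d i \<sigma>) (insert h G)"
      proof (rule Suc.IH[OF L _ Suc.prems(3)])
        show "card (R - {i}) = q + sl" using cR Suc.prems(2) by simp
        show "(\<Sum>t\<in>?T \<inter> insert h G. cost (card (R - {i}) + card (R - {i} - fixed_label d i \<sigma> t))) + (\<Sum>j=sl..card (R - {i}). cost j)
          < real l * (2 ^ sl - 1) * cost sl"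
          using i(2) S range Suc.prems(4) unfolding cR ST by linarith
      qed
      then show ?thesis using i(1) by blast
    qed
  qed
qed

lemma cost_sums: "(\<Sum>j=1..2. cost j) = 3/2" "(\<Sum>j=2..3. cost j) = 1" "(\<Sum>j=1..5. cost j) = 31/12"
proof -
  have "{1..2} = {1, 2::nat}" "{2..3} = {2, 3::nat}" "{1..5} = {1, 2, 3, 4, 5::nat}" by auto
  then show "(\<Sum>j=1..2. cost j) = 3/2" "(\<Sum>j=2..3. cost j) = 1" "(\<Sum>j=1..5. cost j) = 31/12"
    by simp_all
qed

section \<open>Exact counts with four sinks per label\<close>

lemma lab_cards:
  assumes "lab l R T \<sigma>" "t \<in> T"
  shows "1 \<le> card (\<sigma> t)" "card (\<sigma> t) \<le> card R" "card (R - \<sigma> t) = card R - card (\<sigma> t)" "finite (\<sigma> t)"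
    "card (\<sigma> t) = card R \<longleftrightarrow> \<sigma> t = R"
proof -
  have R: "\<sigma> t \<noteq> {}" "\<sigma> t \<subseteq> R" "finite R" using labD[OF assms(1)] assms(2) by auto
  show f: "finite (\<sigma> t)" using R finite_subset by blast
  show "1 \<le> card (\<sigma> t)" using R f by (simp add: Suc_le_eq card_gt_0_iff)
  show "card (\<sigma> t) \<le> card R" using R by (intro card_mono)
  show "card (R - \<sigma> t) = card R - card (\<sigma> t)" using R f by (intro card_Diff_subset)
  show "card (\<sigma> t) = card R \<longleftrightarrow> \<sigma> t = R" using R card_subset_eq by metis
qed

lemma sum_card_inter:
  assumes "finite S" "finite d"
  shows "(\<Sum>i\<in>d. card (fixed_targets d i \<sigma> S)) = (\<Sum>t\<in>{t\<in>S. \<sigma> t \<noteq> d}. card (\<sigma> t \<inter> d))"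
  using sum_fixed_swap[OF assms, where \<sigma> = \<sigma> and f = "\<lambda>_ _. 1 :: nat"]
  by (simp only: card_eq_sum)

lemma card_Un3_disjoint:
  assumes "finite A" "finite B" "finite C" "A \<inter> B = {}" "A \<inter> C = {}" "B \<inter> C = {}"
  shows "card (A \<union> B \<union> C) = card A + card B + card C"
  using assms by (simp add: card_Un_disjoint Int_Un_distrib2)

lemma ex_le_average:
  fixes f :: "nat \<Rightarrow> nat"
  assumes "finite d" "(\<Sum>i\<in>d. f i) < card d * Suc k"
  shows "\<exists>i\<in>d. f i \<le> k"
proof (rule ccontr)
  assume "\<not> ?thesis"
  then have "(\<Sum>i\<in>d. Suc k) \<le> (\<Sum>i\<in>d. f i)" by (intro sum_mono) (auto simp: not_le Suc_le_eq)
  then show False using assms by simp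
qed

text \<open>For \<open>d = R\<close>, fixing \<open>u\<close> keeps just the four sinks labelled
  \<open>{u}\<close>, which is enough if at most two of them are guessed, the new guess included.
  The last hypothesis secures this for \<open>x\<close> or \<open>y\<close>. A singleton is split,
  leaving eight sinks against at most six guesses.\<close>

lemma awin_two_one:
  assumes L: "lab 4 R T \<sigma>" and R: "R = {x, y}" "x \<noteq> y"
    and S: "card (T \<inter> G) \<le> 5"
    and n: "card {t\<in>T \<inter> G. \<sigma> t = {x}} + card {t\<in>T \<inter> G. \<sigma> t = {y}} \<le> 4 \<or>
      card {t\<in>T \<inter> G. \<sigma> t = {x}} \<le> 1 \<or> card {t\<in>T \<inter> G. \<sigma> t = {y}} \<le> 1"
  shows "awin 1 p R T \<sigma> G"
proof -
  note fin = labD(1,2)[OF L]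
  show ?thesis unfolding One_nat_def
  proof (rule awin_SucI[OF _ _ fin(2)])
    show "R \<noteq> {}" using R by simp
    fix h d assume d: "d \<subseteq> R" "d \<noteq> {}"
    have S': "card (T \<inter> insert h G) \<le> 6" using card_insert_Int_le[OF fin(2), of h G] S by linarith
    show "(\<exists>i\<in>d. awin 0 p (R - {i}) (fixed_targets d i \<sigma> T) (fixed_label d i \<sigma>) (insert h G)) \<or>
     awin 0 False (R - d) {t\<in>T. \<not> \<sigma> t \<subseteq> d} (\<lambda>t. \<sigma> t - d) (insert h G) \<or>
     (p \<and> 0 = 0 \<and> (\<exists>X\<subseteq>T. \<exists>z. (\<forall>t\<in>X. realz R d z (\<sigma> t)) \<and> card (X \<inter> insert h G) + 1 < card X))"
    proof (cases "d = R")
      case True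
      have single: "fixed_targets d u \<sigma> T = {t\<in>T. \<sigma> t = {u}}" if u: "u \<in> R" for u
        using labD(4)[OF L] labD(3)[OF L] R u unfolding True by auto
      have win: "awin 0 p (R - {u}) (fixed_targets d u \<sigma> T) (fixed_label d u \<sigma>) (insert h G)"
        if u: "u \<in> R" "card ({t\<in>T. \<sigma> t = {u}} \<inter> insert h G) \<le> 2" for u
        by (rule awin_leaf) (use u fin labD(5)[OF L, of "{u}"] single[OF u(1)] in auto)
      have le: "card ({t\<in>T. \<sigma> t = {u}} \<inter> insert h G) \<le> Suc (card {t\<in>T \<inter> G. \<sigma> t = {u}})" for u
      proof -
        have "{t\<in>T. \<sigma> t = {u}} \<inter> G = {t\<in>T \<inter> G. \<sigma> t = {u}}" by auto
        then show ?thesis using card_insert_Int_le[of "{t\<in>T. \<sigma> t = {u}}" h G] fin by simp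
      qed
      have le2: "card ({t\<in>T. \<sigma> t = {x}} \<inter> insert h G) + card ({t\<in>T. \<sigma> t = {y}} \<inter> insert h G)
        \<le> Suc (card {t\<in>T \<inter> G. \<sigma> t = {x}} + card {t\<in>T \<inter> G. \<sigma> t = {y}})"
      proof (cases "h \<in> T \<and> \<sigma> h = {x}")
        case True
        then have "{t\<in>T. \<sigma> t = {y}} \<inter> insert h G = {t\<in>T \<inter> G. \<sigma> t = {y}}" using R by auto
        then show ?thesis using le[of x] by simp
      next
        case False
        then have "{t\<in>T. \<sigma> t = {x}} \<inter> insert h G = {t\<in>T \<inter> G. \<sigma> t = {x}}" by auto
        then show ?thesis using le[of y] by simp
      qed
      have "card ({t\<in>T. \<sigma> t = {x}} \<inter> insert h G) \<le> 2 \<or> card ({t\<in>T. \<sigma> t = {y}} \<inter> insert h G) \<le> 2"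
        using n le[of x] le[of y] le2 by linarith
      then show ?thesis using win R True by blast
    next
      case False
      then have d1: "d = {x} \<or> d = {y}" using d R by auto
      then have "card d = 1" "d \<subseteq> R" using R by auto
      moreover have "card (R - d) = 1" using d1 R by auto
      ultimately have "card {t\<in>T. \<not> \<sigma> t \<subseteq> d} = 8"
        using card_targets[OF lab_split[OF L]] by simp
      moreover have "card ({t\<in>T. \<not> \<sigma> t \<subseteq> d} \<inter> insert h G) \<le> card (T \<inter> insert h G)"
        using fin by (intro card_mono) auto
      ultimately have "awin 0 False (R - d) {t\<in>T. \<not> \<sigma> t \<subseteq> d} (\<lambda>t. \<sigma> t - d) (insert h G)"
        using S' fin by (intro awin_leaf) auto
      then show ?thesis by blast
    qed
  qed
qed

lemma awin_two_one_le4: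
  assumes L: "lab 4 R T \<sigma>" and R: "card R = 2" and S: "card (T \<inter> G) \<le> 4"
  shows "awin 1 p R T \<sigma> G"
proof -
  note fin = labD(1,2)[OF L]
  obtain x y where xy: "R = {x, y}" "x \<noteq> y" using R by (auto simp: card_2_iff)
  have "card {t\<in>T \<inter> G. \<sigma> t = {x}} + card {t\<in>T \<inter> G. \<sigma> t = {y}} = card ({t\<in>T \<inter> G. \<sigma> t = {x}} \<union> {t\<in>T \<inter> G. \<sigma> t = {y}})"
    using fin xy by (intro card_Un_disjoint[symmetric]) auto
  also have "\<dots> \<le> card (T \<inter> G)" using fin by (intro card_mono) auto
  finally show ?thesis using S by (intro awin_two_one[OF L xy]) auto
qed

text \<open>Serves a pair queried in dimension five. There the exchange of weights for costs is too
  lossy, for example for a label with two zeros both in the pair, so guesses are counted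
  instead.\<close>

lemma awin_three_two:
  assumes L: "lab 4 R T \<sigma>" and R: "card R = 3" and S: "card (T \<inter> G) \<le> 5"
  shows "awin 2 p R T \<sigma> G"
proof -
  note fin = labD(1,2)[OF L]
  show ?thesis unfolding numeral_2_eq_2
  proof (rule awin_SucI[OF _ _ fin(2)])
    show "R \<noteq> {}" using R by auto
    fix h d assume d: "d \<subseteq> R" "d \<noteq> {}"
    have fd: "finite d" using d fin finite_subset by blast
    let ?S = "T \<inter> insert h G"
    have fS: "finite ?S" using fin by simp
    have S': "card ?S \<le> 6" using card_insert_Int_le[OF fin(2), of h G] S by linarith
    have ST: "fixed_targets d i \<sigma> ?S = fixed_targets d i \<sigma> T \<inter> insert h G" for i by auto
    have "card d = 1 \<or> card d = 2 \<or> card d = 3"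
      using d R fin fd card_mono[OF fin(1) d(1)] card_gt_0_iff[of d] by auto
    then consider "card d = 1" | "card d = 2" | "card d = 3" by blast
    then show "(\<exists>i\<in>d. awin (Suc 0) p (R - {i}) (fixed_targets d i \<sigma> T) (fixed_label d i \<sigma>) (insert h G)) \<or>
     awin (Suc 0) False (R - d) {t\<in>T. \<not> \<sigma> t \<subseteq> d} (\<lambda>t. \<sigma> t - d) (insert h G) \<or>
     (p \<and> Suc 0 = 0 \<and> (\<exists>X\<subseteq>T. \<exists>z. (\<forall>t\<in>X. realz R d z (\<sigma> t)) \<and> card (X \<inter> insert h G) + 1 < card X))"
    proof cases
      case 1
      let ?T = "{t\<in>T. \<not> \<sigma> t \<subseteq> d}"
      have cR: "card (R - d) = 2" using 1 R fd d by (simp add: card_Diff_subset)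
      have "(\<Sum>t\<in>?T \<inter> insert h G. cost (card (R - d) + card (R - d - (\<sigma> t - d)))) \<le> (\<Sum>t\<in>?T \<inter> insert h G. 1/2)"
        by (rule sum_mono) (use cost_antimono[of 2] cR in simp)
      also have "\<dots> \<le> (\<Sum>t\<in>?S. 1/2 :: real)" using fS by (intro sum_mono2) auto
      also have "\<dots> \<le> 3" using S' by simp
      finally have le: "(\<Sum>t\<in>?T \<inter> insert h G. cost (card (R - d) + card (R - d - (\<sigma> t - d)))) \<le> 3" .
      have "awin 1 False (R - d) ?T (\<lambda>t. \<sigma> t - d) (insert h G)"
      proof (rule awin_slack[OF lab_split[OF L d(1)], of 1 1])
        show "(\<Sum>t\<in>?T \<inter> insert h G. cost (card (R - d) + card (R - d - (\<sigma> t - d)))) + (\<Sum>j = 1..card (R - d). cost j)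
          < real (4 * 2 ^ card d) * (2 ^ 1 - 1) * cost 1"
          using le cost_sums(1) unfolding 1 cR by simp
      qed (use cR in simp_all)
      then show ?thesis by simp
    next
      case 2
      then obtain x y where xy: "d = {x, y}" "x \<noteq> y" by (auto simp: card_2_iff)
      have "card (R - d) = 1" using 2 R fd d by (simp add: card_Diff_subset)
      then obtain z where z: "R - d = {z}" by (auto simp: card_1_singleton_iff)
      have Rz: "R = {x, y, z}" and zd: "z \<noteq> x" "z \<noteq> y" using z xy d by auto
      let ?full = "{t\<in>?S. \<sigma> t = R}"
      let ?part = "\<lambda>i. {t\<in>?S. i \<in> \<sigma> t \<and> \<sigma> t \<noteq> R \<and> \<sigma> t \<noteq> d}"
      have full4: "card ?full \<le> 4"
      proof -
        have "card ?full \<le> card {t\<in>T. \<sigma> t = R}" using fin by (intro card_mono) auto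
        then show ?thesis using labD(5)[OF L, of R] Rz by simp
      qed
      have "card (?full \<union> ?part x \<union> ?part y) = card ?full + card (?part x) + card (?part y)"
      proof -
        have "?part x \<inter> ?part y = {}"
        proof -
          have "\<sigma> t = R \<or> \<sigma> t = d" if "x \<in> \<sigma> t" "y \<in> \<sigma> t" "t \<in> T" for t
            using that labD(4)[OF L, of t] Rz xy by auto
          then show ?thesis by blast
        qed
        moreover have "?full \<inter> ?part x = {}" "?full \<inter> ?part y = {}" by auto
        ultimately show ?thesis using fin by (intro card_Un3_disjoint) simp_all
      qed
      moreover have "card (?full \<union> ?part x \<union> ?part y) \<le> card ?S" using fS by (intro card_mono) auto
      ultimately have tot: "card ?full + card (?part x) + card (?part y) \<le> 6" using S' by linarith
      \<comment> \<open>Fixing \<open>u\<close> turns full labels into \<open>{z}\<close>, and only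
        labels counted in \<open>?part u\<close> can become \<open>{v}\<close>. As \<open>u\<close>
        has the smaller part, either that part holds at most one guess or at most four guesses
        survive.\<close>
      have win: "awin 1 p (R - {u}) (fixed_targets d u \<sigma> T) (fixed_label d u \<sigma>) (insert h G)"
        if u: "u \<in> d" "v \<in> d" "v \<noteq> u" and le: "card (?part u) \<le> card (?part v)" "card ?full + card (?part u) + card (?part v) \<le> 6" for u v
      proof (rule awin_two_one[OF lab_fix[OF L d(1) u(1)]])
        have Ruv: "R = {u, v, z}" "d = {u, v}" "z \<noteq> u" "z \<noteq> v" using u Rz xy zd by auto
        show "R - {u} = {z, v}" "z \<noteq> v" using Ruv u by auto
        have eq: "fixed_targets d u \<sigma> T \<inter> insert h G = ?full \<union> ?part u"
        proof -
          have "d \<noteq> R" "u \<in> R" using Ruv by auto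
          then show ?thesis by auto
        qed
        have "card (fixed_targets d u \<sigma> T \<inter> insert h G) \<le> card ?full + card (?part u)"
          unfolding eq by (rule card_Un_le)
        then show 5: "card (fixed_targets d u \<sigma> T \<inter> insert h G) \<le> 5"
          using le full4 by linarith
        let ?n = "\<lambda>w. {t \<in> fixed_targets d u \<sigma> T \<inter> insert h G. fixed_label d u \<sigma> t = {w}}"
        have "?n v \<subseteq> ?part u"
        proof
          fix t assume t: "t \<in> ?n v"
          have "\<sigma> t \<noteq> R"
          proof
            assume "\<sigma> t = R"
            then have "fixed_label d u \<sigma> t = {z}" using Ruv u by auto
            then show False using t Ruv by auto
          qed
          then show "t \<in> ?part u" using t by blast
        qed
        then have nv: "card (?n v) \<le> card (?part u)" using fin by (intro card_mono) auto
        have "card (?n z) + card (?n v) = card (?n z \<union> ?n v)"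
          using fin Ruv by (intro card_Un_disjoint[symmetric]) auto
        also have "\<dots> \<le> card (fixed_targets d u \<sigma> T \<inter> insert h G)" using fin by (intro card_mono) auto
        also have "\<dots> \<le> card ?full + card (?part u)" unfolding eq by (rule card_Un_le)
        finally show "card (?n z) + card (?n v) \<le> 4 \<or> card (?n z) \<le> 1 \<or> card (?n v) \<le> 1"
          using nv le full4 by linarith
      qed
      show ?thesis
      proof (cases "card (?part x) \<le> card (?part y)")
        case True
        then show ?thesis using win[of x y] xy tot by auto
      next
        case False
        then show ?thesis using win[of y x] xy tot by auto
      qed
    next
      case 3
      then have dR: "d = R" using d R fin by (simp add: card_subset_eq)
      have "(\<Sum>i\<in>d. card (fixed_targets d i \<sigma> ?S)) = (\<Sum>t\<in>{t\<in>?S. \<sigma> t \<noteq> d}. card (\<sigma> t \<inter> d))"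
        by (rule sum_card_inter[OF fS fd])
      also have "\<dots> \<le> (\<Sum>t\<in>{t\<in>?S. \<sigma> t \<noteq> d}. 2)"
      proof (rule sum_mono)
        fix t assume t: "t \<in> {t\<in>?S. \<sigma> t \<noteq> d}"
        then have "card (\<sigma> t) \<noteq> card R" "card (\<sigma> t) \<le> card R" using lab_cards[OF L, of t] dR by auto
        moreover have "card (\<sigma> t \<inter> d) \<le> card (\<sigma> t)" using lab_cards(4)[OF L] t by (intro card_mono) auto
        ultimately show "card (\<sigma> t \<inter> d) \<le> 2" using R by linarith
      qed
      also have "\<dots> \<le> 12"
      proof -
        have "card {t\<in>?S. \<sigma> t \<noteq> d} \<le> card ?S" using fin by (intro card_mono) auto
        then show ?thesis using S' by simp
      qed
      finally have "\<exists>i\<in>d. card (fixed_targets d i \<sigma> ?S) \<le> 4" using 3 fd by (intro ex_le_average) auto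
      then obtain i where i: "i \<in> d" "card (fixed_targets d i \<sigma> ?S) \<le> 4" by blast
      have "awin 1 p (R - {i}) (fixed_targets d i \<sigma> T) (fixed_label d i \<sigma>) (insert h G)"
      proof (rule awin_two_one_le4[OF lab_fix[OF L d(1) i(1)]])
        show "card (R - {i}) = 2" using i(1) d(1) R fin(1) by (simp add: subset_iff)
        show "card (fixed_targets d i \<sigma> T \<inter> insert h G) \<le> 4" using i(2) unfolding ST .
      qed
      then show ?thesis using i(1) by auto
    qed
  qed
qed

section \<open>Small dimensions\<close>

lemma realz_full:
  assumes R: "finite R" and W: "W \<subseteq> R" "W \<noteq> {}" and i: "i \<in> R" "i \<notin> W"
  shows "realz R R (R - {i}) W"
proof -
  obtain j where j: "j \<in> W" "j \<in> R" "j \<noteq> i" using W i by auto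
  have fW: "finite W" using W R finite_subset by blast
  \<comment> \<open>Rows outside \<open>W\<close> borrow \<open>j\<close> to be odd on
    \<open>W\<close>. This makes row \<open>i\<close> even on \<open>R\<close>, as wanted; the other
    such rows add \<open>i\<close> as well to become odd on \<open>R\<close> again.\<close>
  define N where "N k = (if k = j then {j} else if k = i then {i, j} else if k \<in> W then {k} else {k, i, j})" for k
  have "unip R N"
    by (rule unipI[where rk = "\<lambda>k. if k = j then 0 else if k = i then 1 else 2"])
      (use i j in \<open>auto simp: N_def split: if_splits\<close>)
  moreover have "par (N k) W" if "k \<in> R" for k
    using i j fW by (auto simp: N_def par_insert)
  moreover have "par (N k) R \<longleftrightarrow> k \<in> R - {i}" if "k \<in> R" for k
    using i j R that by (auto simp: N_def par_insert)
  ultimately show ?thesis unfolding realz_def by blast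
qed

text \<open>On the last query nothing later has to stay uninformative, so more sinks can share an
  answer: five of the seven labels are compatible with the zero set \<open>{a}\<close>, all except
  \<open>{b}\<close> and \<open>{a, b}\<close>, whereas fixing \<open>a\<close> would keep only
  three.\<close>

lemma realz_pair:
  assumes R: "R = {a, b, c}" "a \<noteq> b" "a \<noteq> c" "b \<noteq> c" and W: "W \<subseteq> R"
    and aW: "a \<in> W \<and> W \<noteq> {a, b} \<or> a \<notin> W \<and> c \<in> W"
  shows "realz R {a, b} {a} W"
proof (cases "a \<in> W")
  case True
  have fW: "finite W" using W R finite_subset by fastforce
  have bc: "b \<in> W \<Longrightarrow> c \<in> W" using True aW W R by auto
  define N where "N k = (if k = a then {a} else if k = b then (if b \<in> W then {a, b, c} else {a, b})
    else if c \<in> W then {c} else {a, b, c})" for k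
  have "unip R N"
    by (rule unipI[where rk = "\<lambda>k. if k = a then 0 else if (k = b) = (b \<in> W) then 2 else 1"])
      (use R bc in \<open>auto simp: N_def split: if_splits\<close>)
  moreover have "par (N k) W" if "k \<in> R" for k
    using that R fW True bc by (auto simp: N_def par_insert)
  moreover have "par (N k) {a, b} \<longleftrightarrow> k \<in> {a}" if "k \<in> R" for k
    using that R bc by (auto simp: N_def par_insert)
  ultimately show ?thesis unfolding realz_def by blast
next
  case False
  then have cW: "c \<in> W" using aW by auto
  have fW: "finite W" using W R finite_subset by fastforce
  define N where "N k = (if k = c then {c} else if k = a then {a, c}
    else if b \<in> W then {b, a} else {b, a, c})" for k
  have "unip R N"
    by (rule unipI[where rk = "\<lambda>k. if k = c then 0 else if k = a then 1 else 2"])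
      (use R in \<open>auto simp: N_def split: if_splits\<close>)
  moreover have "par (N k) W" if "k \<in> R" for k
    using that R fW cW False by (auto simp: N_def par_insert)
  moreover have "par (N k) {a, b} \<longleftrightarrow> k \<in> {a}" if "k \<in> R" for k
    using that R by (auto simp: N_def par_insert)
  ultimately show ?thesis unfolding realz_def by blast
qed

text \<open>Seven sinks and one query. Two earlier guesses are always tolerable; the alternative
  with only singleton labels covers what is left after fixing inside a triple in dimension
  four.\<close>

lemma awin_three_one:
  assumes L: "lab 1 R T \<sigma>" and R: "card R = 3"
    and S: "card (T \<inter> G) \<le> 2 \<or> (\<forall>t\<in>T \<inter> G. card (\<sigma> t) = 1)"
  shows "awin 1 True R T \<sigma> G"
proof -
  note fin = labD(1,2)[OF L]
  have one: "card {t\<in>T. \<sigma> t = W} \<le> 1" for W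
  proof (cases "W \<noteq> {} \<and> W \<subseteq> R")
    case False
    then have e: "{t\<in>T. \<sigma> t = W} = {}" using labD(3,4)[OF L] by auto
    show ?thesis unfolding e by simp
  qed (simp add: labD(5)[OF L])
  show ?thesis unfolding One_nat_def
  proof (rule awin_SucI[OF _ _ fin(2)])
    show "R \<noteq> {}" using R by auto
    fix h d assume d: "d \<subseteq> R" "d \<noteq> {}"
    have fd: "finite d" using d fin finite_subset by blast
    let ?S = "T \<inter> insert h G"
    have S': "card ?S \<le> 3 \<or> (\<forall>t\<in>T \<inter> G. card (\<sigma> t) = 1)"
      using S card_insert_Int_le[OF fin(2), of h G] by linarith
    have "card d = 1 \<or> card d = 2 \<or> card d = 3"
      using d R fin fd card_mono[OF fin(1) d(1)] card_gt_0_iff[of d] by auto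
    then consider "card d = 1" | "card d = 2" | "card d = 3" by blast
    then show "(\<exists>i\<in>d. awin 0 True (R - {i}) (fixed_targets d i \<sigma> T) (fixed_label d i \<sigma>) (insert h G)) \<or>
     awin 0 False (R - d) {t\<in>T. \<not> \<sigma> t \<subseteq> d} (\<lambda>t. \<sigma> t - d) (insert h G) \<or>
     (True \<and> 0 = 0 \<and> (\<exists>X\<subseteq>T. \<exists>z. (\<forall>t\<in>X. realz R d z (\<sigma> t)) \<and> card (X \<inter> insert h G) + 1 < card X))"
    proof cases
      case 1
      have "card ?S \<le> 4"
      proof (cases "card ?S \<le> 3")
        case False
        then have 1: "\<forall>t\<in>T \<inter> G. card (\<sigma> t) = 1" using S' by blast
        have "T \<inter> G \<subseteq> {t\<in>T. \<sigma> t \<in> (\<lambda>x. {x}) ` R}"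
        proof
          fix t assume t: "t \<in> T \<inter> G"
          then obtain x where x: "\<sigma> t = {x}" using 1 card_1_singletonE by blast
          then have "x \<in> R" using labD(4)[OF L, of t] t by simp
          then show "t \<in> {t\<in>T. \<sigma> t \<in> (\<lambda>x. {x}) ` R}" using t x by simp
        qed
        then have "card (T \<inter> G) \<le> card {t\<in>T. \<sigma> t \<in> (\<lambda>x. {x}) ` R}" using fin by (intro card_mono) auto
        also have "\<dots> = 1 * card ((\<lambda>x. {x}) ` R)" by (rule card_lab[OF L]) auto
        also have "\<dots> = 3" using R by (simp add: card_image)
        finally show ?thesis using card_insert_Int_le[OF fin(2), of h G] by linarith
      qed simp
      moreover have "card ({t\<in>T. \<not> \<sigma> t \<subseteq> d} \<inter> insert h G) \<le> card ?S"
        using fin by (intro card_mono) auto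
      moreover have "card (R - d) = 2" using 1 R fd d by (simp add: card_Diff_subset)
      then have "card {t\<in>T. \<not> \<sigma> t \<subseteq> d} = 6"
        using card_targets[OF lab_split[OF L d(1)]] 1 by simp
      ultimately have "awin 0 False (R - d) {t\<in>T. \<not> \<sigma> t \<subseteq> d} (\<lambda>t. \<sigma> t - d) (insert h G)"
        using fin by (intro awin_leaf) auto
      then show ?thesis by blast
    next
      case 2
      then obtain a b where ab: "d = {a, b}" "a \<noteq> b" by (auto simp: card_2_iff)
      have "card (R - d) = 1" using 2 R fd d by (simp add: card_Diff_subset)
      then obtain c where c: "R - d = {c}" by (auto simp: card_1_singleton_iff)
      have Rc: "R = {a, b, c}" "a \<noteq> b" "a \<noteq> c" "b \<noteq> c" using c ab d by auto
      define X where "X = {t\<in>T. a \<in> \<sigma> t \<and> \<sigma> t \<noteq> {a, b} \<or> a \<notin> \<sigma> t \<and> c \<in> \<sigma> t}"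
      define Y where "Y = {t\<in>T. \<sigma> t \<in> {{b}, {a, b}}}"
      have "T - Y \<subseteq> X"
      proof
        fix t assume t: "t \<in> T - Y"
        then have "\<sigma> t \<noteq> {}" "\<sigma> t \<subseteq> {a, b, c}" "\<sigma> t \<noteq> {b}" "\<sigma> t \<noteq> {a, b}"
          using labD(3,4)[OF L, of t] Rc by (auto simp: Y_def)
        moreover have "\<sigma> t \<subseteq> {b}" if "a \<notin> \<sigma> t" "c \<notin> \<sigma> t" using that calculation(2) by auto
        ultimately show "t \<in> X" using t unfolding X_def by blast
      qed
      moreover have "card Y = 1 * card {{b}, {a, b}}" unfolding Y_def
        by (rule card_lab[OF L]) (use Rc in auto)
      then have "card Y = 2" using Rc by auto
      moreover have "card T = 7" using card_targets[OF L] R by simp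
      moreover have "card (T - Y) = card T - card Y" using fin by (intro card_Diff_subset) (auto simp: Y_def)
      ultimately have X5: "card X \<ge> 5" using fin card_mono[of X "T - Y"] by (auto simp: X_def)
      have X3: "card (X \<inter> insert h G) \<le> 3"
      proof (cases "card ?S \<le> 3")
        case True
        have "card (X \<inter> insert h G) \<le> card ?S" using fin by (intro card_mono) (auto simp: X_def)
        then show ?thesis using True by linarith
      next
        case False
        then have 1: "\<forall>t\<in>T \<inter> G. card (\<sigma> t) = 1" using S' by blast
        have "X \<inter> insert h G \<subseteq> insert h ({t\<in>T. \<sigma> t = {a}} \<union> {t\<in>T. \<sigma> t = {c}})"
        proof
          fix t assume t: "t \<in> X \<inter> insert h G"
          show "t \<in> insert h ({t\<in>T. \<sigma> t = {a}} \<union> {t\<in>T. \<sigma> t = {c}})"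
          proof (cases "t = h")
            case False
            then have "t \<in> T \<inter> G" using t by (simp add: X_def)
            moreover from this obtain x where x: "\<sigma> t = {x}" using 1 card_1_singletonE by blast
            moreover have "a \<in> \<sigma> t \<or> c \<in> \<sigma> t" using t by (auto simp: X_def)
            ultimately show ?thesis by auto
          qed simp
        qed
        then have "card (X \<inter> insert h G) \<le> card (insert h ({t\<in>T. \<sigma> t = {a}} \<union> {t\<in>T. \<sigma> t = {c}}))"
          using fin by (intro card_mono) auto
        also have "\<dots> \<le> Suc (card ({t\<in>T. \<sigma> t = {a}} \<union> {t\<in>T. \<sigma> t = {c}}))" by (rule card_insert_le_m1) auto
        also have "\<dots> \<le> Suc (card {t\<in>T. \<sigma> t = {a}} + card {t\<in>T. \<sigma> t = {c}})" using card_Un_le by simp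
        also have "\<dots> \<le> 3" using one[of "{a}"] one[of "{c}"] by simp
        finally show ?thesis .
      qed
      have "X \<subseteq> T" by (auto simp: X_def)
      moreover have "\<forall>t\<in>X. realz R d {a} (\<sigma> t)"
        unfolding ab(1) using realz_pair[OF Rc] labD(4)[OF L] by (auto simp: X_def)
      ultimately show ?thesis using X3 X5 by (intro disjI2 conjI exI[of _ X] exI[of _ "{a}"]) auto
    next
      case 3
      then have dR: "d = R" using d R fin by (simp add: card_subset_eq)
      let ?P = "\<lambda>i. fixed_targets d i \<sigma> T"
      let ?Q = "\<lambda>i. {t\<in>T. i \<notin> \<sigma> t}"
      \<comment> \<open>\<open>?P i\<close> and \<open>?Q i\<close> are disjoint families of three
        sinks. The first survives fixing \<open>i\<close>, the second shares the last answer with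
        zero set \<open>R - {i}\<close>. Three guesses cannot hit both of them twice.\<close>
      have "\<exists>i\<in>R. card (?P i \<inter> insert h G) \<le> 1 \<or> card (?Q i \<inter> insert h G) \<le> 1"
      proof (cases "card ?S \<le> 3")
        case True
        obtain i where i: "i \<in> R" using d by auto
        have "card (?P i \<inter> insert h G) + card (?Q i \<inter> insert h G) = card ((?P i \<inter> insert h G) \<union> (?Q i \<inter> insert h G))"
          using fin by (intro card_Un_disjoint[symmetric]) auto
        also have "\<dots> \<le> card ?S" using fin by (intro card_mono) auto
        finally have "card (?P i \<inter> insert h G) \<le> 1 \<or> card (?Q i \<inter> insert h G) \<le> 1" using True by linarith
        then show ?thesis using i by blast
      next
        case False
        then have 1: "\<forall>t\<in>T \<inter> G. card (\<sigma> t) = 1" using S' by blast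
        \<comment> \<open>With \<open>i\<close> outside the label of the new guess, only the sink
          labelled \<open>{i}\<close> can be a guess that survives.\<close>
        obtain i where i: "i \<in> R" "h \<in> T \<Longrightarrow> \<sigma> h \<noteq> R \<Longrightarrow> i \<notin> \<sigma> h"
          using d labD(4)[OF L, of h] by (cases "h \<in> T \<and> \<sigma> h \<noteq> R") auto
        have "?P i \<inter> insert h G \<subseteq> {t\<in>T. \<sigma> t = {i}}"
        proof
          fix t assume t: "t \<in> ?P i \<inter> insert h G"
          then have "t \<noteq> h" using i(2) dR by auto
          then have "t \<in> T \<inter> G" using t by simp
          moreover from this obtain x where x: "\<sigma> t = {x}" using 1 card_1_singletonE by blast
          ultimately show "t \<in> {t\<in>T. \<sigma> t = {i}}" using t by simp
        qed
        then have "card (?P i \<inter> insert h G) \<le> card {t\<in>T. \<sigma> t = {i}}" using fin by (intro card_mono) auto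
        then show ?thesis using one[of "{i}"] i(1) by (meson order_trans)
      qed
      then obtain i where i: "i \<in> R" "card (?P i \<inter> insert h G) \<le> 1 \<or> card (?Q i \<inter> insert h G) \<le> 1" by blast
      have cR: "card (R - {i}) = 2" using i R fin by simp
      show ?thesis
      proof (cases "card (?P i \<inter> insert h G) \<le> 1")
        case True
        have "card (?P i) = 3" using card_targets[OF lab_fix[OF L d(1), of i]] i dR cR by simp
        then have "awin 0 True (R - {i}) (?P i) (fixed_label d i \<sigma>) (insert h G)"
          using True fin by (intro awin_leaf) auto
        then show ?thesis using i(1) dR by blast
      next
        case False
        have "card {t\<in>T. \<sigma> t \<in> Pow (R - {i}) - {{}}} = 1 * card (Pow (R - {i}) - {{}})"
          by (rule card_lab[OF L]) auto
        moreover have "card (Pow (R - {i}) - {{}}) = 3"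
          using cR fin by (subst card_Diff_singleton) (auto simp: card_Pow)
        moreover have "{t\<in>T. \<sigma> t \<in> Pow (R - {i}) - {{}}} = ?Q i"
          using labD(3,4)[OF L] by auto
        ultimately have "card (?Q i) = 3" by simp
        moreover have "\<forall>t\<in>?Q i. realz R d (R - {i}) (\<sigma> t)"
          unfolding dR using realz_full[OF fin(1)] labD(3,4)[OF L] i(1) by auto
        ultimately show ?thesis using i(2) False by (intro disjI2 conjI exI[of _ "?Q i"] exI[of _ "R - {i}"]) auto
      qed
    qed
  qed
qed

text \<open>The prices 3 and 2 bound the size of every proper label, so for \<open>d = R\<close> the
  price total of at most 10 after a new guess lies below 12 and some fixing leaves at most two
  guesses. The bound 7 also limits the earlier guesses to three, and if there are three, at most one
  misses fewer than two coordinates.\<close>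

lemma awin_four_two:
  assumes L: "lab 1 R T \<sigma>" and R: "card R = 4"
    and S: "(\<Sum>t\<in>T \<inter> G. if card (R - \<sigma> t) \<le> 1 then 3 else 2::nat) \<le> 7"
  shows "awin 2 True R T \<sigma> G"
proof -
  note fin = labD(1,2)[OF L]
  have Rne: "R \<noteq> {}" using R by auto
  define g where "g t = (if card (R - \<sigma> t) \<le> 1 then 3 else 2::nat)" for t
  have gS: "(\<Sum>t\<in>T \<inter> G. g t) \<le> 7" using S by (simp add: g_def)
  have "(\<Sum>t\<in>T \<inter> G. 2) \<le> (\<Sum>t\<in>T \<inter> G. g t)" by (rule sum_mono) (simp add: g_def)
  then have S3: "card (T \<inter> G) \<le> 3" using gS by simp
  show ?thesis unfolding numeral_2_eq_2
  proof (rule awin_SucI[OF _ _ fin(2)])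
    show "R \<noteq> {}" using R by auto
    fix h d assume d: "d \<subseteq> R" "d \<noteq> {}"
    have fd: "finite d" using d fin finite_subset by blast
    let ?S = "T \<inter> insert h G"
    have fS: "finite ?S" using fin by simp
    have S4: "card ?S \<le> 4" using card_insert_Int_le[OF fin(2), of h G] S3 by linarith
    have g10: "(\<Sum>t\<in>?S. g t) \<le> 10"
    proof (cases "h \<in> T \<and> h \<notin> G")
      case True
      then have "?S = insert h (T \<inter> G)" by auto
      moreover have "g h \<le> 3" by (simp add: g_def)
      ultimately show ?thesis using True gS fin by simp
    next
      case False
      then have "?S = T \<inter> G" by auto
      then show ?thesis using gS by simp
    qed
    have ST: "fixed_targets d i \<sigma> ?S = fixed_targets d i \<sigma> T \<inter> insert h G" for i by auto
    have win: "awin (Suc 0) True (R - {i}) (fixed_targets d i \<sigma> T) (fixed_label d i \<sigma>) (insert h G)"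
      if i: "i \<in> d" "card (fixed_targets d i \<sigma> ?S) \<le> 2 \<or> (\<forall>t\<in>fixed_targets d i \<sigma> ?S. card (fixed_label d i \<sigma> t) = 1)" for i
    proof -
      have "awin 1 True (R - {i}) (fixed_targets d i \<sigma> T) (fixed_label d i \<sigma>) (insert h G)"
      proof (rule awin_three_one[OF lab_fix[OF L d(1) i(1)]])
        show "card (R - {i}) = 3" using i(1) d(1) R fin(1) by (simp add: subset_iff)
        show "card (fixed_targets d i \<sigma> T \<inter> insert h G) \<le> 2 \<or> (\<forall>t\<in>fixed_targets d i \<sigma> T \<inter> insert h G. card (fixed_label d i \<sigma> t) = 1)"
          using i(2) unfolding ST .
      qed
      then show ?thesis by simp
    qed
    have card_inter: "card (\<sigma> t \<inter> d) \<le> card (\<sigma> t)" if "t \<in> T" for t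
      using lab_cards(4)[OF L that] by (intro card_mono) auto
    have "card d = 1 \<or> card d = 2 \<or> card d = 3 \<or> card d = 4"
      using d R fin fd card_mono[OF fin(1) d(1)] card_gt_0_iff[of d] by auto
    then consider "card d = 1" | "card d = 2" | "card d = 3" | "card d = 4" by blast
    then show "(\<exists>i\<in>d. awin (Suc 0) True (R - {i}) (fixed_targets d i \<sigma> T) (fixed_label d i \<sigma>) (insert h G)) \<or>
     awin (Suc 0) False (R - d) {t\<in>T. \<not> \<sigma> t \<subseteq> d} (\<lambda>t. \<sigma> t - d) (insert h G) \<or>
     (True \<and> Suc 0 = 0 \<and> (\<exists>X\<subseteq>T. \<exists>z. (\<forall>t\<in>X. realz R d z (\<sigma> t)) \<and> card (X \<inter> insert h G) + 1 < card X))"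
    proof cases
      case 1
      let ?T = "{t\<in>T. \<not> \<sigma> t \<subseteq> d}"
      let ?U = "{t\<in>?T. \<sigma> t - d = R - d}"
      have cR: "card (R - d) = 3" using 1 R fd d by (simp add: card_Diff_subset)
      note L' = lab_split[OF L d(1)]
      have "R - d \<noteq> {}" using cR by (metis card.empty zero_neq_numeral)
      then have "card ?U = 2" using labD(5)[OF L', of "R - d"] 1 by fastforce
      have ins: "?T \<inter> insert h G = {t\<in>?S. \<not> \<sigma> t \<subseteq> d}" by auto
      \<comment> \<open>At most two sinks have a full label on the remaining three coordinates and
        cost 1/2; all others cost at most 1/3. Four guesses cost at most 5/3, and with the prepaid 1
        this stays below the capacity \<open>2 * 3 * (1/2) = 3\<close>.\<close>
      have le: "cost (card (R - d) + card (R - d - (\<sigma> t - d))) \<le> 1/3 + (if t \<in> ?U then 1/6 else 0)" if "t \<in> ?T" for t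
      proof (cases "t \<in> ?U")
        case False
        have "R - d - (\<sigma> t - d) \<noteq> {}" using False labD(4)[OF L, of t] that d by auto
        then have "1 \<le> card (R - d - (\<sigma> t - d))" using fin by (simp add: Suc_le_eq card_gt_0_iff)
        then have "cost (card (R - d) + card (R - d - (\<sigma> t - d))) \<le> cost 4" using cR by (intro cost_antimono) simp
        then show ?thesis unfolding if_not_P[OF False] by simp
      next
        case True
        then have e: "R - d - (\<sigma> t - d) = {}" by auto
        show ?thesis unfolding if_P[OF True] e cR by simp
      qed
      have "(\<Sum>t\<in>?T \<inter> insert h G. cost (card (R - d) + card (R - d - (\<sigma> t - d)))) \<le> (\<Sum>t\<in>?T \<inter> insert h G. 1/3 + (if t \<in> ?U then 1/6 else 0))"
        by (rule sum_mono) (rule le, blast)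
      also have "\<dots> = (\<Sum>t\<in>?T \<inter> insert h G. 1/3) + (\<Sum>t\<in>?T \<inter> insert h G. if t \<in> ?U then 1/6 else 0)"
        by (rule sum.distrib)
      also have "(\<Sum>t\<in>?T \<inter> insert h G. 1/3 :: real) \<le> 4/3"
      proof -
        have "card (?T \<inter> insert h G) \<le> card ?S" using fin by (intro card_mono) auto
        then show ?thesis using S4 by simp
      qed
      also have "(\<Sum>t\<in>?T \<inter> insert h G. if t \<in> ?U then 1/6 else 0 :: real) \<le> (\<Sum>t\<in>?U. 1/6)"
      proof -
        have "(\<Sum>t\<in>?T \<inter> insert h G. if t \<in> ?U then 1/6 else 0 :: real) = (\<Sum>t\<in>(?T \<inter> insert h G) \<inter> ?U. 1/6)"
          using fin by (subst sum.inter_restrict) auto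
        also have "\<dots> \<le> (\<Sum>t\<in>?U. 1/6)" using fin by (intro sum_mono2) auto
        finally show ?thesis .
      qed
      also have "(\<Sum>t\<in>?U. 1/6 :: real) = 1/3" using \<open>card ?U = 2\<close> by simp
      finally have le2: "(\<Sum>t\<in>?T \<inter> insert h G. cost (card (R - d) + card (R - d - (\<sigma> t - d)))) \<le> 4/3 + 1/3" by simp
      have "awin (Suc 0) False (R - d) ?T (\<lambda>t. \<sigma> t - d) (insert h G)"
      proof (rule awin_slack[OF L', of _ 2])
        show "(\<Sum>t\<in>?T \<inter> insert h G. cost (card (R - d) + card (R - d - (\<sigma> t - d)))) + (\<Sum>j = 2..card (R - d). cost j)
          < real (1 * 2 ^ card d) * (2 ^ 2 - 1) * cost 2"
          using le2 cost_sums(2) unfolding 1 cR by simp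
      qed (use cR in simp_all)
      then show ?thesis by blast
    next
      case 2
      have "awin 1 False (R - d) {t\<in>T. \<not> \<sigma> t \<subseteq> d} (\<lambda>t. \<sigma> t - d) (insert h G)"
      proof (rule awin_two_one_le4)
        show "lab 4 (R - d) {t\<in>T. \<not> \<sigma> t \<subseteq> d} (\<lambda>t. \<sigma> t - d)" using lab_split[OF L d(1)] 2 by simp
        show "card (R - d) = 2" using 2 R fd d by (simp add: card_Diff_subset)
        have "card ({t\<in>T. \<not> \<sigma> t \<subseteq> d} \<inter> insert h G) \<le> card ?S" using fin by (intro card_mono) auto
        then show "card ({t\<in>T. \<not> \<sigma> t \<subseteq> d} \<inter> insert h G) \<le> 4" using S4 by linarith
      qed
      then show ?thesis by simp
    next
      case 3
      then have "card (R - d) = 1" using R fd d by (simp add: card_Diff_subset)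
      then obtain w where w: "R - d = {w}" by (auto simp: card_1_singleton_iff)
      then have Rw: "R = insert w d" "w \<notin> d" using d by auto
      let ?u = "\<lambda>t. if \<sigma> t = d then 0 else card (\<sigma> t \<inter> d)"
      let ?full = "{t\<in>?S. \<sigma> t = R}"
      have u2: "?u t \<le> 2 + (if \<sigma> t = R then 1 else 0)" if "t \<in> ?S" for t
      proof (cases "d \<subseteq> \<sigma> t")
        case True
        then have "\<sigma> t = d \<or> \<sigma> t = R" using labD(4)[OF L, of t] that Rw by auto
        moreover have "card (R \<inter> d) = 3" using 3 d by (simp add: Int_absorb1)
        ultimately show ?thesis by auto
      next
        case False
        then have "card (\<sigma> t \<inter> d) < card d" using fd by (intro psubset_card_mono) auto
        then show ?thesis using 3 by simp
      qed
      have full1: "card ?full \<le> 1"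
      proof -
        have "card ?full \<le> card {t\<in>T. \<sigma> t = R}" using fin by (intro card_mono) auto
        then show ?thesis using labD(5)[OF L Rne] by simp
      qed
      \<comment> \<open>If every fixing leaves three guesses, the count 9 is attained with equality:
        four guesses, one labelled \<open>R\<close>, the others meeting \<open>d\<close> in exactly
        two points. The price bound 10 then allows at most one more label containing
        \<open>w\<close>. Fixing a coordinate outside that label makes all surviving labels
        singletons, which \<open>awin_three_one\<close> admits.\<close>
      show ?thesis
      proof (rule ccontr)
        assume notwin: "\<not> ?thesis"
        have no: "\<not> card (fixed_targets d i \<sigma> ?S) \<le> 2"
          "\<exists>t\<in>fixed_targets d i \<sigma> ?S. card (fixed_label d i \<sigma> t) \<noteq> 1" if "i \<in> d" for i
          using win[OF that] that notwin by blast+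
        have "(9::nat) = (\<Sum>i\<in>d. 3)" using 3 by simp
        also have "\<dots> \<le> (\<Sum>i\<in>d. card (fixed_targets d i \<sigma> ?S))"
          using no(1) by (intro sum_mono) (simp add: not_le Suc_le_eq numeral_3_eq_3 numeral_2_eq_2)
        also have "\<dots> = (\<Sum>t\<in>{t\<in>?S. \<sigma> t \<noteq> d}. card (\<sigma> t \<inter> d))"
          by (rule sum_card_inter[OF fS fd])
        also have "\<dots> = (\<Sum>t\<in>?S. ?u t)"
          using fS by (intro sum.mono_neutral_cong_left) auto
        finally have u9: "9 \<le> (\<Sum>t\<in>?S. ?u t)" .
        have "(\<Sum>t\<in>?S. if \<sigma> t = R then 1 else 0 :: nat) = (\<Sum>t\<in>?full. 1)"
          by (rule sum.inter_filter[symmetric]) (rule fS)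
        then have tot_eq: "(\<Sum>t\<in>?S. 2 + (if \<sigma> t = R then 1 else 0)) = 2 * card ?S + card ?full"
          by (simp only: sum.distrib) simp
        then have tot: "(\<Sum>t\<in>?S. 2 + (if \<sigma> t = R then 1 else 0)) \<le> (9::nat)" using full1 S4 by linarith
        have eq: "?u t = 2 + (if \<sigma> t = R then 1 else 0)" if "t \<in> ?S" for t
        proof (rule ccontr)
          assume "\<not> ?thesis"
          then have lt: "?u t < 2 + (if \<sigma> t = R then 1 else 0)" using u2[OF that] by linarith
          have "(\<Sum>t\<in>?S. ?u t) < (\<Sum>t\<in>?S. 2 + (if \<sigma> t = R then 1 else 0))"
            by (rule sum_strict_mono_ex1[OF fS]) (use u2 lt that in blast)+
          then show False using u9 tot by linarith
        qed
        have "(\<Sum>t\<in>?S. ?u t) = (\<Sum>t\<in>?S. 2 + (if \<sigma> t = R then 1 else 0))"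
          by (rule sum.cong[OF refl]) (rule eq)
        then have "(\<Sum>t\<in>?S. 2 + (if \<sigma> t = R then 1 else 0)) \<ge> (9::nat)" using u9 by linarith
        then have c4: "card ?S = 4" "card ?full = 1"
          using full1 S4 tot_eq by linarith+
        let ?M = "{t\<in>?S. \<sigma> t \<noteq> R \<and> w \<in> \<sigma> t}"
        have gle: "2 + (if t \<in> ?full \<union> ?M then 1 else 0) \<le> g t" if "t \<in> ?S" for t
        proof (cases "t \<in> ?full \<union> ?M")
          case True
          have "card (R - \<sigma> t) \<le> 1"
          proof (cases "\<sigma> t = R")
            case False
            then have "card (\<sigma> t \<inter> d) = 2" "w \<in> \<sigma> t" using eq[OF that] True by (auto split: if_splits)
            moreover have "R - \<sigma> t = d - \<sigma> t" using Rw \<open>w \<in> \<sigma> t\<close> by auto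
            moreover have "card d = card (\<sigma> t \<inter> d) + card (d - \<sigma> t)"
              using card_Int_Diff[OF fd, of "\<sigma> t"] by (simp add: Int_commute)
            ultimately show ?thesis using 3 by simp
          qed simp
          then show ?thesis by (simp add: g_def)
        next
          case False
          then show ?thesis unfolding if_not_P[OF False] by (simp add: g_def)
        qed
        have "(\<Sum>t\<in>?S. 2 + (if t \<in> ?full \<union> ?M then 1 else 0)) \<le> (\<Sum>t\<in>?S. g t)"
          by (rule sum_mono) (rule gle)
        moreover have "(\<Sum>t\<in>?S. 2 + (if t \<in> ?full \<union> ?M then 1 else 0)) = 2 * card ?S + card (?full \<union> ?M)"
        proof -
          have "(\<Sum>t\<in>?S. if t \<in> ?full \<union> ?M then 1 else 0 :: nat) = (\<Sum>t\<in>{t\<in>?S. t \<in> ?full \<union> ?M}. 1)"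
            by (rule sum.inter_filter[symmetric]) (rule fS)
          moreover have "{t\<in>?S. t \<in> ?full \<union> ?M} = ?full \<union> ?M" by blast
          ultimately have "(\<Sum>t\<in>?S. if t \<in> ?full \<union> ?M then 1 else 0 :: nat) = card (?full \<union> ?M)"
            by (simp only: card_eq_sum)
          then show ?thesis by (simp only: sum.distrib) simp
        qed
        moreover have "card (?full \<union> ?M) = card ?full + card ?M"
          using fin by (intro card_Un_disjoint) auto
        ultimately have M1: "card ?M \<le> 1" using g10 c4 by linarith
        have "\<exists>i\<in>d. \<forall>t\<in>?M. i \<notin> \<sigma> t"
        proof (cases "?M = {}")
          case True
          then show ?thesis using d by blast
        next
          case False
          then have "card ?M = 1" using M1 fin by (simp add: card_gt_0_iff le_antisym Suc_le_eq)
          then obtain m where m: "?M = {m}" by (auto simp: card_1_singleton_iff)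
          then have "m \<in> ?S" "\<sigma> m \<noteq> R" by auto
          then have "card (\<sigma> m \<inter> d) = 2" using eq[of m] by (auto split: if_splits)
          then have "\<not> d \<subseteq> \<sigma> m" using 3 by (auto simp: Int_absorb1)
          then show ?thesis unfolding m by auto
        qed
        then obtain i where i: "i \<in> d" "\<forall>t\<in>?M. i \<notin> \<sigma> t" by blast
        obtain t where t: "t \<in> ?S" "i \<in> \<sigma> t" "\<sigma> t \<noteq> d" "card (fixed_label d i \<sigma> t) \<noteq> 1"
          using no(2)[OF i(1)] by blast
        have lab: "fixed_label d i \<sigma> t = sym_diff (\<sigma> t) d" using t(2) i(1) by auto
        show False
        proof (cases "\<sigma> t = R")
          case True
          then have "sym_diff (\<sigma> t) d = {w}" using Rw by auto
          then show False using t(4) lab by simp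
        next
          case False
          then have "w \<notin> \<sigma> t" using i(2) t by blast
          then have "sym_diff (\<sigma> t) d = d - \<sigma> t" using labD(4)[OF L, of t] t(1) Rw by auto
          moreover have "card (\<sigma> t \<inter> d) = 2" using eq[OF t(1)] False by (auto split: if_splits)
          moreover have "card d = card (\<sigma> t \<inter> d) + card (d - \<sigma> t)"
            using card_Int_Diff[OF fd, of "\<sigma> t"] by (simp add: Int_commute)
          ultimately show False using t(4) lab 3 by simp
        qed
      qed
    next
      case 4
      then have dR: "d = R" using d R fin by (simp add: card_subset_eq)
      have "(\<Sum>i\<in>d. card (fixed_targets d i \<sigma> ?S)) = (\<Sum>t\<in>{t\<in>?S. \<sigma> t \<noteq> d}. card (\<sigma> t \<inter> d))"
        by (rule sum_card_inter[OF fS fd])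
      also have "\<dots> \<le> (\<Sum>t\<in>{t\<in>?S. \<sigma> t \<noteq> d}. g t)"
      proof (rule sum_mono)
        fix t assume t: "t \<in> {t\<in>?S. \<sigma> t \<noteq> d}"
        then have "card (\<sigma> t) \<noteq> 4" "card (\<sigma> t) \<le> 4" "card (R - \<sigma> t) = 4 - card (\<sigma> t)" using lab_cards[OF L, of t] dR R by auto
        then show "card (\<sigma> t \<inter> d) \<le> g t" using card_inter[of t] t by (auto simp: g_def)
      qed
      also have "\<dots> \<le> (\<Sum>t\<in>?S. g t)" using fin by (intro sum_mono2) auto
      finally have "\<exists>i\<in>d. card (fixed_targets d i \<sigma> ?S) \<le> 2" using 4 fd g10 by (intro ex_le_average) auto
      then show ?thesis using win by blast
    qed
  qed
qed

section \<open>Weights for the phase before a splitting move\<close>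

definition tail_weight :: "nat \<Rightarrow> real" where
  "tail_weight m = 19008 / ((real m + 2) * (real m + 4) * (real m + 6) * (real m + 8))"

text \<open>
  \<open>weight r b\<close> is the price of a guessed sink whose label has \<open>b\<close> zeros in \<open>card R = r\<close>; the
  tail is \<open>16 * 1188\<close> over a product chosen so that \<open>budget (r - 1) - budget r\<close> telescopes to \<open>weight r 0\<close>,
  the price of a new guess.
\<close>

definition weight :: "nat \<Rightarrow> nat \<Rightarrow> real" where
  "weight r b = (if r = 4 then (if b \<le> 1 then 3/8 else 1/4)
    else if r = 5 then (if b \<le> 1 then 1/4 else if b = 2 then 3/16 else if b = 3 then 1/6 else 3/20)
    else if r = 6 \<and> b = 0 then 3/16 else if r = 6 \<and> b = 1 then 1/6
    else tail_weight (2 * r + b))"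

text \<open>The formula gives 11/20 at 6; adding \<open>weight 6 0 = 3/16\<close> and
  \<open>weight 5 0 = 1/4\<close> yields 59/80 and 79/80. The last value must not exceed 1, that is,
  the eight eighths behind the integer bound 7 in dimension four. With the tail formula in place of
  \<open>weight 6 0\<close> it would.\<close>

definition budget :: "nat \<Rightarrow> real" where
  "budget r = (if r = 4 then 79/80 else if r = 5 then 59/80
     else 396 / ((real r + 2) * (real r + 3) * (real r + 4)))"

lemma tail_weight_pos: "0 < tail_weight m"
  by (simp add: tail_weight_def add_nonneg_pos)

lemma tail_weight_antimono: "m \<le> n \<Longrightarrow> tail_weight n \<le> tail_weight m"
  unfolding tail_weight_def by (intro divide_left_mono mult_mono mult_pos_pos) auto

lemma weight_pos: "0 < weight r b"
  by (simp add: weight_def tail_weight_pos)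

lemma weight_nonneg: "0 \<le> weight r b"
  using weight_pos by (rule less_imp_le)

lemma budget_pos: "0 < budget r"
  by (simp add: budget_def add_nonneg_pos)

lemma weight_large: "7 \<le> r \<Longrightarrow> weight r b = tail_weight (2 * r + b)"
  by (auto simp: weight_def)

lemma weight_le_0:
  assumes "5 \<le> r"
  shows "weight r b \<le> weight r 0"
proof -
  consider "r = 5" | "r = 6" | "7 \<le> r" using assms by linarith
  then show ?thesis
  proof cases
    case 1 then show ?thesis by (simp add: weight_def)
  next
    case 2
    have "tail_weight (12 + b) \<le> 3 / 16" if "2 \<le> b"
    proof -
      have "tail_weight (12 + b) \<le> tail_weight 14" using that by (intro tail_weight_antimono) simp
      also have "\<dots> \<le> 3 / 16" by (simp add: tail_weight_def)
      finally show ?thesis .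
    qed
    then show ?thesis using 2 by (simp add: weight_def)
  next
    case 3 then show ?thesis by (simp add: weight_large tail_weight_antimono)
  qed
qed

lemma budget_step:
  assumes "5 \<le> r"
  shows "budget (r - 1) = budget r + weight r 0"
proof (cases "r \<le> 6")
  case True
  then have "r = 5 \<or> r = 6" using assms by auto
  then show ?thesis by (auto simp: budget_def weight_def)
next
  case False
  define u where "u = real r - 7"
  have r: "real r = u + 7" "real (r - 1) = u + 6" "u \<ge> 0" using False by (auto simp: u_def)
  have e1: "budget (r - 1) = 396 / ((u + 8) * (u + 9) * (u + 10))"
  proof -
    have "r - 1 \<noteq> 4" "r - 1 \<noteq> 5" using False by auto
    then show ?thesis unfolding budget_def r by (simp add: add.commute)
  qed
  have e2: "budget r = 396 / ((u + 9) * (u + 10) * (u + 11))"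
    using False unfolding budget_def r by (simp add: add.commute)
  have e3: "weight r 0 = 1188 / ((u + 8) * (u + 9) * (u + 10) * (u + 11))"
  proof -
    have "weight r 0 = 19008 / ((2 * (u + 8)) * (2 * (u + 9)) * (2 * (u + 10)) * (2 * (u + 11)))"
      using False r by (simp add: weight_large tail_weight_def algebra_simps)
    also have "(2 * (u + 8)) * (2 * (u + 9)) * (2 * (u + 10)) * (2 * (u + 11)) = 16 * ((u + 8) * (u + 9) * (u + 10) * (u + 11))"
      by algebra
    finally show ?thesis by simp
  qed
  have "396 / (a * b * c) = 396 / (b * c * e) + 1188 / (a * b * c * e)"
    if "0 < a" "0 < b" "0 < c" "0 < e" "396 * e = 396 * a + 1188" for a b c e :: real
  proof -
    have "396 / (b * c * e) = 396 * a / (a * b * c * e)" "396 / (a * b * c) = 396 * e / (a * b * c * e)"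
      using that(1-4) by simp_all
    then show ?thesis unfolding that(5) by (simp add: add_divide_distrib)
  qed
  then show ?thesis unfolding e1 e2 e3 using r(3) by simp
qed

text \<open>The tail telescopes, so prepaid guesses cost less than 227/60 from \<open>j = 1\<close>
  and less than 167/60 from \<open>j = 2\<close>. These stay below 4 and 3, the capacities after
  splitting a pair and a singleton, in every dimension.\<close>

lemma sum_cost: "5 \<le> m \<Longrightarrow> (\<Sum>j=1..m. cost j) = 227/60 - 36 / (5 * (real m + 1))"
proof (induction m rule: nat_induct_at_least)
  case base
  then show ?case using cost_sums(3) by simp
next
  case (Suc m)
  have c: "cost (Suc m) = 36 / (5 * ((real m + 1) * (real m + 2)))" using Suc.hyps by (simp add: cost_large algebra_simps)
  have "36 / (5 * (real m + 1)) - 36 / (5 * (real m + 2)) = 36 / (5 * ((real m + 1) * (real m + 2)))"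
  proof -
    define x where "x = real m + 1"
    have x: "0 < x" "real m + 2 = x + 1" by (simp_all add: x_def)
    have "36 / (5 * x) - 36 / (5 * (x + 1)) = 36 / (5 * (x * (x + 1)))"
      using x(1) by (simp add: divide_simps)
    then show ?thesis unfolding x(2) unfolding x_def .
  qed
  then have "227/60 - 36 / (5 * (real m + 1)) + 36 / (5 * ((real m + 1) * (real m + 2))) = 227/60 - 36 / (5 * (real m + 2))"
    by linarith
  then show ?case using Suc.IH c by (simp add: add.commute)
qed

lemma sum_cost2: "5 \<le> m \<Longrightarrow> (\<Sum>j=2..m. cost j) = 167/60 - 36 / (5 * (real m + 1))"
  using sum_cost[of m] sum.atLeast_Suc_atMost[of 1 m cost] by (simp add: numeral_2_eq_2)

text \<open>\<open>f\<close> is the fixing inequality at the largest admissible \<open>a\<close>,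
  with \<open>k\<close> the drop of the argument. Fixed values of \<open>k\<close> up to 8, and
  \<open>k = e + 9\<close> with \<open>y = 2 * k + 1 + v\<close> beyond, make every coefficient
  nonnegative.\<close>

lemma weight_fix_poly:
  fixes v e :: real
  assumes "0 \<le> v" "0 \<le> e"
  defines "f \<equiv> \<lambda>y k :: real. (2 * y + k - 7) * ((y^2 - 9) * (y^2 - 1)) - (y - 2 * k + 4) * (((y + k)^2 - 9) * ((y + k)^2 - 1))"
  shows "0 \<le> f (v + 19) 3" "0 \<le> f (v + 19) 4" "0 \<le> f (v + 19) 5" "0 \<le> f (v + 19) 6" "0 \<le> f (v + 19) 7" "0 \<le> f (v + 19) 8" "0 \<le> f (2 * e + v + 19) (e + 9)"
proof -
  have "f (v + 19) 3 = 408255 + 227335 * v ^ 1 + 36066 * v ^ 2 + 2506 * v ^ 3 + 81 * v ^ 4 + 1 * v ^ 5"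
    unfolding f_def by algebra
  then show "0 \<le> f (v + 19) 3" using assms(1,2) by simp
  have "f (v + 19) 4 = 316800 + 202720 * v ^ 1 + 33904 * v ^ 2 + 2428 * v ^ 3 + 80 * v ^ 4 + 1 * v ^ 5"
    unfolding f_def by algebra
  then show "0 \<le> f (v + 19) 4" using assms(1,2) by simp
  have "f (v + 19) 5 = 323595 + 188823 * v ^ 1 + 32114 * v ^ 2 + 2354 * v ^ 3 + 79 * v ^ 4 + 1 * v ^ 5"
    unfolding f_def by algebra
  then show "0 \<le> f (v + 19) 5" using assms(1,2) by simp
  have "f (v + 19) 6 = 460416 + 188128 * v ^ 1 + 30744 * v ^ 2 + 2284 * v ^ 3 + 78 * v ^ 4 + 1 * v ^ 5"
    unfolding f_def by algebra
  then show "0 \<le> f (v + 19) 6" using assms(1,2) by simp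
  have "f (v + 19) 7 = 763335 + 203287 * v ^ 1 + 29842 * v ^ 2 + 2218 * v ^ 3 + 77 * v ^ 4 + 1 * v ^ 5"
    unfolding f_def by algebra
  then show "0 \<le> f (v + 19) 7" using assms(1,2) by simp
  have "f (v + 19) 8 = 1272960 + 237120 * v ^ 1 + 29456 * v ^ 2 + 2156 * v ^ 3 + 76 * v ^ 4 + 1 * v ^ 5"
    unfolding f_def by algebra
  then show "0 \<le> f (v + 19) 8" using assms(1,2) by simp
  have "f (2 * e + v + 19) (e + 9) = 2034675 + 292615 * v ^ 1 + 29634 * v ^ 2 + 2098 * v ^ 3 + 75 * v ^ 4 + 1 * v ^ 5 + 1489360 * e ^ 1 + 185900 * e ^ 1 * v ^ 1 + 13064 * e ^ 1 * v ^ 2 + 544 * e ^ 1 * v ^ 3 + 9 * e ^ 1 * v ^ 4 + 404290 * e ^ 2 + 39482 * e ^ 2 * v ^ 1 + 1770 * e ^ 2 * v ^ 2 + 34 * e ^ 2 * v ^ 3 + 52320 * e ^ 3 + 3492 * e ^ 3 * v ^ 1 + 76 * e ^ 3 * v ^ 2 + 3275 * e ^ 4 + 111 * e ^ 4 * v ^ 1 + 80 * e ^ 5"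
    unfolding f_def by algebra
  then show "0 \<le> f (2 * e + v + 19) (e + 9)" using assms(1,2) by simp
qed

text \<open>Positivity is needed only for \<open>c + u\<close> at least 5. Cutting that region into
  \<open>u = 0, ..., 4\<close> and \<open>u\<close> at least 5 makes all expanded coefficients
  nonnegative; \<open>single_poly\<close> does the same with 6.\<close>

lemma pair_poly:
  fixes c u :: real
  assumes "0 \<le> c" "0 \<le> u"
  defines "f \<equiv> \<lambda>c u :: real. 48 * ((2*c + 1 + u) * (2*c + 2 + u)) * ((c + u + 4) * (c + u + 5) * (c + u + 6)) - (3*c + 2*u + 10) * (3*c + 2*u + 12) * (3*c + 2*u + 14) * (3*c + 2*u + 16) * (c + u + 2)"
  shows "0 \<le> f (c + 5) 0" "0 \<le> f (c + 4) 1" "0 \<le> f (c + 3) 2" "0 \<le> f (c + 2) 3" "0 \<le> f (c + 1) 4" "0 \<le> f c (u + 5)"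
proof -
  have "f (c + 5) 0 = 2024865 + 1641351 * c ^ 1 + 482886 * c ^ 2 + 66570 * c ^ 3 + 4377 * c ^ 4 + 111 * c ^ 5"
    unfolding f_def by algebra
  then show "0 \<le> f (c + 5) 0" using assms(1,2) by simp
  have "f (c + 4) 1 = 1558080 + 1408368 * c ^ 1 + 441756 * c ^ 2 + 63480 * c ^ 3 + 4293 * c ^ 4 + 111 * c ^ 5"
    unfolding f_def by algebra
  then show "0 \<le> f (c + 4) 1" using assms(1,2) by simp
  have "f (c + 3) 2 = 1125225 + 1181751 * c ^ 1 + 400806 * c ^ 2 + 60378 * c ^ 3 + 4209 * c ^ 4 + 111 * c ^ 5"
    unfolding f_def by algebra
  then show "0 \<le> f (c + 3) 2" using assms(1,2) by simp
  have "f (c + 2) 3 = 730752 + 962640 * c ^ 1 + 360108 * c ^ 2 + 57264 * c ^ 3 + 4125 * c ^ 4 + 111 * c ^ 5"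
    unfolding f_def by algebra
  then show "0 \<le> f (c + 2) 3" using assms(1,2) by simp
  have "f (c + 1) 4 = 378945 + 752151 * c ^ 1 + 319734 * c ^ 2 + 54138 * c ^ 3 + 4041 * c ^ 4 + 111 * c ^ 5"
    unfolding f_def by algebra
  then show "0 \<le> f (c + 1) 4" using assms(1,2) by simp
  have "f c (u + 5) = 73920 + 271072 * u ^ 1 + 109568 * u ^ 2 + 17280 * u ^ 3 + 1216 * u ^ 4 + 32 * u ^ 5 + 551376 * c ^ 1 + 363952 * c ^ 1 * u ^ 1 + 78880 * c ^ 1 * u ^ 2 + 7040 * c ^ 1 * u ^ 3 + 224 * c ^ 1 * u ^ 4 + 279756 * c ^ 2 + 113244 * c ^ 2 * u ^ 1 + 14544 * c ^ 2 * u ^ 2 + 600 * c ^ 2 * u ^ 3 + 51000 * c ^ 3 + 12684 * c ^ 3 * u ^ 1 + 768 * c ^ 3 * u ^ 2 + 3957 * c ^ 4 + 471 * c ^ 4 * u ^ 1 + 111 * c ^ 5"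
    unfolding f_def by algebra
  then show "0 \<le> f c (u + 5)" using assms(1,2) by simp
qed

lemma single_poly:
  fixes c u :: real
  assumes "0 \<le> c" "0 \<le> u"
  defines "f \<equiv> \<lambda>c u :: real. 48 * ((2*c + 1 + u) * (2*c + 2 + u)) * ((c + u + 3) * (c + u + 4) * (c + u + 5)) - (3*c + 2*u + 7) * (3*c + 2*u + 9) * (3*c + 2*u + 11) * (3*c + 2*u + 13) * (c + u + 2)"
  shows "0 \<le> f (c + 6) 0" "0 \<le> f (c + 5) 1" "0 \<le> f (c + 4) 2" "0 \<le> f (c + 3) 3" "0 \<le> f (c + 2) 4" "0 \<le> f (c + 1) 5" "0 \<le> f c (u + 6)"
proof -
  have "f (c + 6) 0 = 3794040 + 2477367 * c ^ 1 + 627456 * c ^ 2 + 77466 * c ^ 3 + 4680 * c ^ 4 + 111 * c ^ 5"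
    unfolding f_def by algebra
  then show "0 \<le> f (c + 6) 0" using assms(1,2) by simp
  have "f (c + 5) 1 = 3219840 + 2214144 * c ^ 1 + 583536 * c ^ 2 + 74292 * c ^ 3 + 4596 * c ^ 4 + 111 * c ^ 5"
    unfolding f_def by algebra
  then show "0 \<le> f (c + 5) 1" using assms(1,2) by simp
  have "f (c + 4) 2 = 2670840 + 1955343 * c ^ 1 + 539688 * c ^ 2 + 71106 * c ^ 3 + 4512 * c ^ 4 + 111 * c ^ 5"
    unfolding f_def by algebra
  then show "0 \<le> f (c + 4) 2" using assms(1,2) by simp
  have "f (c + 3) 3 = 2152128 + 1702176 * c ^ 1 + 495984 * c ^ 2 + 67908 * c ^ 3 + 4428 * c ^ 4 + 111 * c ^ 5"
    unfolding f_def by algebra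
  then show "0 \<le> f (c + 3) 3" using assms(1,2) by simp
  have "f (c + 2) 4 = 1668600 + 1455831 * c ^ 1 + 452496 * c ^ 2 + 64698 * c ^ 3 + 4344 * c ^ 4 + 111 * c ^ 5"
    unfolding f_def by algebra
  then show "0 \<le> f (c + 2) 4" using assms(1,2) by simp
  have "f (c + 1) 5 = 1224960 + 1217472 * c ^ 1 + 409296 * c ^ 2 + 61476 * c ^ 3 + 4260 * c ^ 4 + 111 * c ^ 5"
    unfolding f_def by algebra
  then show "0 \<le> f (c + 1) 5" using assms(1,2) by simp
  have "f c (u + 6) = 825720 + 612655 * u ^ 1 + 166528 * u ^ 2 + 21432 * u ^ 3 + 1328 * u ^ 4 + 32 * u ^ 5 + 988239 * c ^ 1 + 508616 * c ^ 1 * u ^ 1 + 94576 * c ^ 1 * u ^ 2 + 7600 * c ^ 1 * u ^ 3 + 224 * c ^ 1 * u ^ 4 + 366456 * c ^ 2 + 132090 * c ^ 2 * u ^ 1 + 15552 * c ^ 2 * u ^ 2 + 600 * c ^ 2 * u ^ 3 + 58242 * c ^ 3 + 13464 * c ^ 3 * u ^ 1 + 768 * c ^ 3 * u ^ 2 + 4176 * c ^ 4 + 471 * c ^ 4 * u ^ 1 + 111 * c ^ 5"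
    unfolding f_def by algebra
  then show "0 \<le> f c (u + 6)" using assms(1,2) by simp
qed

section \<open>The fixing inequality for the weights\<close>

lemma weight_fix5:
  assumes "b < 5" "be \<le> b" "1 \<le> a" "a \<le> 5 - b" "3 \<le> a + be" "be = 0 \<Longrightarrow> a < 5 - b"
  shows "real a * weight 4 (b - be + (a - 1)) \<le> real (a + be) * weight 5 b"
proof -
  have ne: "be \<noteq> 0 \<or> a < 5 - b" using assms(6) by auto
  consider "b = 0" | "b = 1" | "b = 2" | "b = 3" | "b = 4" using assms(1) by linarith
  then show ?thesis
  proof cases
    case 1
    then have "be = 0" "a = 1 \<or> a = 2 \<or> a = 3 \<or> a = 4 \<or> a = 5" using assms(2-4) by auto
    then show ?thesis using assms(5) ne unfolding 1
      by (elim disjE) (simp_all add: weight_def tail_weight_def)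
  next
    case 2
    then have "be = 0 \<or> be = 1" "a = 1 \<or> a = 2 \<or> a = 3 \<or> a = 4" using assms(2-4) by auto
    then show ?thesis using assms(5) ne unfolding 2
      by (elim disjE) (simp_all add: weight_def tail_weight_def)
  next
    case 3
    then have "be = 0 \<or> be = 1 \<or> be = 2" "a = 1 \<or> a = 2 \<or> a = 3" using assms(2-4) by auto
    then show ?thesis using assms(5) ne unfolding 3
      by (elim disjE) (simp_all add: weight_def tail_weight_def)
  next
    case 4
    then have "be = 0 \<or> be = 1 \<or> be = 2 \<or> be = 3" "a = 1 \<or> a = 2" using assms(2-4) by auto
    then show ?thesis using assms(5) ne unfolding 4
      by (elim disjE) (simp_all add: weight_def tail_weight_def)
  next
    case 5
    then have "be = 0 \<or> be = 1 \<or> be = 2 \<or> be = 3 \<or> be = 4" "a = 1" using assms(2-4) by auto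
    then show ?thesis using assms(5) ne unfolding 5
      by (elim disjE) (simp_all add: weight_def tail_weight_def)
  qed
qed

lemma weight_fix6:
  assumes "b < 6" "be \<le> b" "1 \<le> a" "a \<le> 6 - b" "3 \<le> a + be" "be = 0 \<Longrightarrow> a < 6 - b"
  shows "real a * weight 5 (b - be + (a - 1)) \<le> real (a + be) * weight 6 b"
proof -
  have ne: "be \<noteq> 0 \<or> a < 6 - b" using assms(6) by auto
  consider "b = 0" | "b = 1" | "b = 2" | "b = 3" | "b = 4" | "b = 5" using assms(1) by linarith
  then show ?thesis
  proof cases
    case 1
    then have "be = 0" "a = 1 \<or> a = 2 \<or> a = 3 \<or> a = 4 \<or> a = 5 \<or> a = 6" using assms(2-4) by auto
    then show ?thesis using assms(5) ne unfolding 1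
      by (elim disjE) (simp_all add: weight_def tail_weight_def)
  next
    case 2
    then have "be = 0 \<or> be = 1" "a = 1 \<or> a = 2 \<or> a = 3 \<or> a = 4 \<or> a = 5" using assms(2-4) by auto
    then show ?thesis using assms(5) ne unfolding 2
      by (elim disjE) (simp_all add: weight_def tail_weight_def)
  next
    case 3
    then have "be = 0 \<or> be = 1 \<or> be = 2" "a = 1 \<or> a = 2 \<or> a = 3 \<or> a = 4" using assms(2-4) by auto
    then show ?thesis using assms(5) ne unfolding 3
      by (elim disjE) (simp_all add: weight_def tail_weight_def)
  next
    case 4
    then have "be = 0 \<or> be = 1 \<or> be = 2 \<or> be = 3" "a = 1 \<or> a = 2 \<or> a = 3" using assms(2-4) by auto
    then show ?thesis using assms(5) ne unfolding 4
      by (elim disjE) (simp_all add: weight_def tail_weight_def)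
  next
    case 5
    then have "be = 0 \<or> be = 1 \<or> be = 2 \<or> be = 3 \<or> be = 4" "a = 1 \<or> a = 2" using assms(2-4) by auto
    then show ?thesis using assms(5) ne unfolding 5
      by (elim disjE) (simp_all add: weight_def tail_weight_def)
  next
    case 6
    then have "be = 0 \<or> be = 1 \<or> be = 2 \<or> be = 3 \<or> be = 4 \<or> be = 5" "a = 1" using assms(2-4) by auto
    then show ?thesis using assms(5) ne unfolding 6
      by (elim disjE) (simp_all add: weight_def tail_weight_def)
  qed
qed

lemma weight_fix7:
  assumes "b < 7" "be \<le> b" "1 \<le> a" "a \<le> 7 - b" "3 \<le> a + be" "be = 0 \<Longrightarrow> a < 7 - b"
  shows "real a * weight 6 (b - be + (a - 1)) \<le> real (a + be) * weight 7 b"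
proof -
  have ne: "be \<noteq> 0 \<or> a < 7 - b" using assms(6) by auto
  consider "b = 0" | "b = 1" | "b = 2" | "b = 3" | "b = 4" | "b = 5" | "b = 6" using assms(1) by linarith
  then show ?thesis
  proof cases
    case 1
    then have "be = 0" "a = 1 \<or> a = 2 \<or> a = 3 \<or> a = 4 \<or> a = 5 \<or> a = 6 \<or> a = 7" using assms(2-4) by auto
    then show ?thesis using assms(5) ne unfolding 1
      by (elim disjE) (simp_all add: weight_def tail_weight_def)
  next
    case 2
    then have "be = 0 \<or> be = 1" "a = 1 \<or> a = 2 \<or> a = 3 \<or> a = 4 \<or> a = 5 \<or> a = 6" using assms(2-4) by auto
    then show ?thesis using assms(5) ne unfolding 2
      by (elim disjE) (simp_all add: weight_def tail_weight_def)
  next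
    case 3
    then have "be = 0 \<or> be = 1 \<or> be = 2" "a = 1 \<or> a = 2 \<or> a = 3 \<or> a = 4 \<or> a = 5" using assms(2-4) by auto
    then show ?thesis using assms(5) ne unfolding 3
      by (elim disjE) (simp_all add: weight_def tail_weight_def)
  next
    case 4
    then have "be = 0 \<or> be = 1 \<or> be = 2 \<or> be = 3" "a = 1 \<or> a = 2 \<or> a = 3 \<or> a = 4" using assms(2-4) by auto
    then show ?thesis using assms(5) ne unfolding 4
      by (elim disjE) (simp_all add: weight_def tail_weight_def)
  next
    case 5
    then have "be = 0 \<or> be = 1 \<or> be = 2 \<or> be = 3 \<or> be = 4" "a = 1 \<or> a = 2 \<or> a = 3" using assms(2-4) by auto
    then show ?thesis using assms(5) ne unfolding 5
      by (elim disjE) (simp_all add: weight_def tail_weight_def)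
  next
    case 6
    then have "be = 0 \<or> be = 1 \<or> be = 2 \<or> be = 3 \<or> be = 4 \<or> be = 5" "a = 1 \<or> a = 2" using assms(2-4) by auto
    then show ?thesis using assms(5) ne unfolding 6
      by (elim disjE) (simp_all add: weight_def tail_weight_def)
  next
    case 7
    then have "be = 0 \<or> be = 1 \<or> be = 2 \<or> be = 3 \<or> be = 4 \<or> be = 5 \<or> be = 6" "a = 1" using assms(2-4) by auto
    then show ?thesis using assms(5) ne unfolding 7
      by (elim disjE) (simp_all add: weight_def tail_weight_def)
  qed
qed

lemma cost_weight_frac:
  fixes X D W s :: real
  assumes "0 < X" "0 < D" "0 < W" "0 < s" "W * s \<le> 48 * X * D"
  shows "36 / (5 * X) * (396 / D) \<le> 19008 / W * (36 / (5 * s))"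
proof -
  have "1 / (X * D) \<le> 48 / (W * s)" using assms by (simp add: divide_simps mult.commute mult.left_commute)
  then have "36 * 396 / 5 * (1 / (X * D)) \<le> 36 * 396 / 5 * (48 / (W * s))" by (intro mult_left_mono) auto
  then show ?thesis by (simp add: mult.commute mult.left_commute)
qed

text \<open>\<open>k\<close> is the drop of the argument, and \<open>be = k - 3 + a\<close>. Without
  a drop monotonicity suffices. For \<open>k = 1\<close> and \<open>k = 2\<close> the assumption
  \<open>three\<close> forces \<open>a\<close> to be at least 3 and 2; from 3 on the claim is linear
  in \<open>a\<close> and is settled at an extreme value.\<close>

lemma tail_weight_fix:
  assumes a: "1 \<le> a" and k: "m' + 3 + be = m + a" and m: "14 \<le> m'" "2 * a + 3 * be \<le> m" and three: "3 \<le> a + be"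
  shows "real a * tail_weight m' \<le> real (a + be) * tail_weight m"
proof (cases "m \<le> m'")
  case True
  have "real a * tail_weight m' \<le> real a * tail_weight m" using True by (intro mult_left_mono tail_weight_antimono) auto
  also have "\<dots> \<le> real (a + be) * tail_weight m" using tail_weight_pos[of m] by (intro mult_right_mono) auto
  finally show ?thesis .
next
  case False
  define k where "k = real m - real m'"
  \<comment> \<open>The shift by 5 centres the denominator at \<open>y\<close>: it becomes
    \<open>(y - 3) * (y - 1) * (y + 1) * (y + 3)\<close>.\<close>
  define y where "y = real m' + 5"
  define A where "A = ((y + k)^2 - 9) * ((y + k)^2 - 1)"
  define B where "B = (y^2 - 9) * (y^2 - 1)"
  have y: "19 \<le> y" using m by (simp add: y_def)
  have k1: "1 \<le> k" using False by (simp add: k_def)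
  have be: "real be = k - 3 + real a" using k by (simp add: k_def)
  have tm': "tail_weight m' = 19008 / B" and tm: "tail_weight m = 19008 / A"
    unfolding tail_weight_def A_def B_def k_def y_def by (simp_all add: power2_eq_square algebra_simps)
  have pos: "0 < A" "0 < B"
  proof -
    have "0 < tail_weight m" "0 < tail_weight m'" by (rule tail_weight_pos)+
    then show "0 < A" "0 < B" unfolding tm tm' by (simp_all add: zero_less_divide_iff)
  qed
  have "real a * A \<le> (real a + real be) * B"
  proof -
    have "m = m' + 1 \<or> m = m' + 2 \<or> m' + 3 \<le> m" using False by linarith
    then consider "k = 1" "3 \<le> a" | "k = 2" "2 \<le> a" | "3 \<le> k" using k a three unfolding k_def by linarith
    then show ?thesis
    proof cases
      case 1
      have e: "4 * B - 3 * A = y^4 - 12 * y^3 - 28 * y^2 + 48 * y + 36"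
        unfolding A_def B_def 1 by algebra
      have "y^4 - 12 * y^3 - 28 * y^2 = y^2 * (y * (y - 12) - 28)" by algebra
      moreover have "19 * 7 \<le> y * (y - 12)" using y by (intro mult_mono) auto
      ultimately have "0 \<le> y^4 - 12 * y^3 - 28 * y^2" by simp
      then have "3 * A \<le> 4 * B" using e y by linarith
      then have "real a * (3 * A) \<le> real a * (4 * B)" by (intro mult_left_mono) auto
      moreover have "(4 * real a) * B \<le> (3 * (2 * real a - 2)) * B" using 1(2) pos by (intro mult_right_mono) auto
      ultimately show ?thesis unfolding be 1 by (simp add: algebra_simps)
    next
      case 2
      have "3 * B - 2 * A = (y - 19) * ((y + 3) * ((y - 1) * (y + 1)))"
        unfolding A_def B_def 2 by algebra
      moreover have "0 \<le> (y - 19) * ((y + 3) * ((y - 1) * (y + 1)))" using y by simp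
      ultimately have "2 * A \<le> 3 * B" by linarith
      then have "real a * (2 * A) \<le> real a * (3 * B)" by (intro mult_left_mono) auto
      moreover have "(3 * real a) * B \<le> (2 * (2 * real a - 1)) * B" using 2(2) pos by (intro mult_right_mono) auto
      ultimately show ?thesis unfolding be 2 by (simp add: algebra_simps)
    next
      case 3
      have a': "1 \<le> real a" using a by simp
      have a5: "5 * real a \<le> y - 2 * k + 4" using m(2) k by (simp add: y_def k_def)
      have yk: "2 * k + 1 \<le> y" using a5 a' by linarith
      have f0: "0 \<le> (2 * y + k - 7) * B - (y - 2 * k + 4) * A"
      proof -
        have "m = m' + 3 \<or> m = m' + 4 \<or> m = m' + 5 \<or> m = m' + 6 \<or> m = m' + 7 \<or> m = m' + 8 \<or> m' + 9 \<le> m"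
          using 3 unfolding k_def by linarith
        then consider "k = 3" | "k = 4" | "k = 5" | "k = 6" | "k = 7" | "k = 8" | "9 \<le> k"
          unfolding k_def by linarith
        then show ?thesis unfolding A_def B_def
        proof cases
          case 7
          have "0 \<le> y - 2 * (k - 9) - 19" using yk by simp
          then show "0 \<le> (2 * y + k - 7) * ((y^2 - 9) * (y^2 - 1)) - (y - 2 * k + 4) * (((y + k)^2 - 9) * ((y + k)^2 - 1))"
            using weight_fix_poly(7)[of "y - 2 * (k - 9) - 19" "k - 9"] 7 by simp
        qed (use weight_fix_poly(1-6)[of "y - 19" 0] y in simp_all)
      qed
      \<comment> \<open>After eliminating \<open>be\<close> the claim reads
        \<open>a * (A - 2 * B) \<le> (k - 3) * B\<close>. If \<open>A\<close> exceeds
        \<open>2 * B\<close> it is hardest for \<open>5 * a = y - 2 * k + 4\<close>, the case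
        treated by \<open>f0\<close>.\<close>
      show ?thesis
      proof (cases "A \<le> 2 * B")
        case True
        then have "real a * A \<le> real a * (2 * B)" by (intro mult_left_mono) auto
        also have "\<dots> \<le> (real a + real be) * B" unfolding be using 3 pos by (simp add: algebra_simps)
        finally show ?thesis .
      next
        case False
        have "(5 * real a) * (A - 2 * B) \<le> (y - 2 * k + 4) * (A - 2 * B)"
          using False a5 by (intro mult_right_mono) auto
        then show ?thesis using f0 unfolding be by (simp add: algebra_simps)
      qed
    qed
  qed
  moreover define q where "q = real a + real be"
  ultimately have "real a * A \<le> q * B" by simp
  then have "real a / B \<le> q / A" using pos by (simp add: field_simps)
  then have "19008 * (real a / B) \<le> 19008 * (q / A)" by (rule mult_left_mono) simp
  then show ?thesis unfolding tm tm' q_def by (simp add: mult.commute)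
qed

lemma weight_fix:
  assumes r: "5 \<le> r" and b: "b < r" "be \<le> b" and a: "1 \<le> a" "a \<le> r - b" and three: "3 \<le> a + be"
    and ne: "be = 0 \<Longrightarrow> a < r - b"
  shows "real a * weight (r - 1) (b - be + (a - 1)) \<le> real (a + be) * weight r b"
proof -
  \<comment> \<open>Dimensions 5 to 7 involve tabulated weights, so all admissible triples were
    enumerated for them.\<close>
  consider "r = 5" | "r = 6" | "r = 7" | "8 \<le> r" using r by linarith
  then show ?thesis
  proof cases
    case 1 then show ?thesis using weight_fix5[of b be a] assms by simp
  next
    case 2 then show ?thesis using weight_fix6[of b be a] assms by simp
  next
    case 3 then show ?thesis using weight_fix7[of b be a] assms by simp
  next
    case 4
    have "real a * tail_weight (2 * (r - 1) + (b - be + (a - 1))) \<le> real (a + be) * tail_weight (2 * r + b)"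
      by (rule tail_weight_fix) (use 4 assms in linarith)+
    then show ?thesis using 4 by (simp add: weight_large)
  qed
qed

section \<open>Exchanging weights for costs at the first split\<close>

lemma cost_numerals [simp]: "cost 6 = 6/35" "cost 7 = 9/70" "cost 8 = 1/10" "cost 9 = 2/25" "cost 10 = 18/275" "cost 11 = 3/55"
  "cost (Suc (Suc (Suc (Suc 0)))) = 1/3" "cost (Suc (Suc (Suc (Suc (Suc 0))))) = 1/4" "cost (Suc (Suc (Suc (Suc (Suc (Suc 0)))))) = 6/35"
  by (simp_all add: cost_def)

text \<open>After splitting a pair, four sinks share each label and one coordinate is spare, so the
  capacity is 4 minus the prepaid guesses. The two bounds on \<open>n\<close> reflect that a label
  with \<open>b\<close> zeros keeps at least \<open>b - 2\<close> of them. As the guesses weigh less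
  than \<open>budget (r - 1)\<close> in total, this comparison per guess keeps their total cost
  below the capacity.\<close>

lemma cost_weight_pair:
  assumes r: "6 \<le> r" and b: "b < r" and n: "r - 2 \<le> n" "r + b \<le> n + 4"
  shows "cost n * budget (r - 1) \<le> weight r b * (4 - (\<Sum>j=1..r - 2. cost j))"
proof -
  define n0 where "n0 = max (r - 2) (r + b - 4)"
  have "cost n \<le> cost n0" using n by (intro cost_antimono) (auto simp: n0_def)
  then have "cost n * budget (r - 1) \<le> cost n0 * budget (r - 1)"
    using budget_pos[of "r - 1"] by (intro mult_right_mono) auto
  also have "\<dots> \<le> weight r b * (4 - (\<Sum>j=1..r - 2. cost j))"
  proof -
    consider "r = 6" | "r = 7" | "8 \<le> r" using r by linarith
    then show ?thesis
    proof cases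
      case 1
      have "{1..4} = {1, 2, 3, 4::nat}" by auto
      then have s: "(\<Sum>j=1..4. cost j) = 7/3" by simp
      have "b = 0 \<or> b = 1 \<or> b = 2 \<or> b = 3 \<or> b = 4 \<or> b = 5" using 1 b by auto
      then have "cost (max 4 (b + 2)) * (59/80) \<le> weight 6 b * (5/3)"
        by (elim disjE) (simp_all add: weight_def tail_weight_def)
      then show ?thesis unfolding n0_def 1 by (simp add: budget_def s[unfolded One_nat_def])
    next
      case 2
      have "b = 0 \<or> b = 1 \<or> b = 2 \<or> b = 3 \<or> b = 4 \<or> b = 5 \<or> b = 6" using 2 b by auto
      then have "cost (max 5 (b + 3)) * (396/720) \<le> weight 7 b * (17/12)"
        by (elim disjE) (simp_all add: weight_def tail_weight_def)
      then show ?thesis unfolding n0_def 2 by (simp add: budget_def cost_sums(3)[unfolded One_nat_def] add.commute)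
    next
      case 3
      \<comment> \<open>\<open>c\<close> and \<open>u\<close> are natural numbers that express
        \<open>r\<close> and the binding bound \<open>n0\<close> by one formula, whether or not
        \<open>b\<close> exceeds 2.\<close>
      define c where "c = max b 2 - 2"
      define u where "u = r - c - 3"
      have rc: "r = c + 3 + u" and n0: "n0 = 2 * c + 1 + u" and cu: "5 \<le> c + u"
        using 3 b by (auto simp: c_def u_def n0_def max_def)
      have m: "2 * r + b \<le> 3 * c + 8 + 2 * u" using rc by (auto simp: c_def)
      let ?W = "(3 * real c + 2 * real u + 10) * (3 * real c + 2 * real u + 12) * (3 * real c + 2 * real u + 14) * (3 * real c + 2 * real u + 16)"
      let ?X = "(2 * real c + 1 + real u) * (2 * real c + 2 + real u)"
      let ?D = "(real c + real u + 4) * (real c + real u + 5) * (real c + real u + 6)"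
      let ?s = "real c + real u + 2"
      have poly: "0 \<le> 48 * ?X * ?D - ?W * ?s"
      proof -
        have "u = 0 \<or> u = 1 \<or> u = 2 \<or> u = 3 \<or> u = 4 \<or> 5 \<le> u" by linarith
        then show ?thesis
        proof (elim disjE)
          assume "5 \<le> u"
          then show ?thesis using pair_poly(6)[of "real c" "real u - 5"] by simp
        qed (use cu pair_poly(1)[of "real c - 5" 0] pair_poly(2)[of "real c - 4" 0] pair_poly(3)[of "real c - 3" 0]
            pair_poly(4)[of "real c - 2" 0] pair_poly(5)[of "real c - 1" 0] in simp_all)
      qed
      have fr: "36 / (5 * ?X) * (396 / ?D) \<le> 19008 / ?W * (36 / (5 * ?s))"
        by (rule cost_weight_frac) (use poly in \<open>auto intro!: mult_pos_pos add_nonneg_pos\<close>)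
      have cn: "cost n0 = 36 / (5 * ?X)"
        using cu unfolding n0 by (subst cost_large) (auto simp: algebra_simps)
      have bd: "budget (r - 1) = 396 / ?D"
        using cu unfolding rc by (simp add: budget_def algebra_simps)
      have wt: "19008 / ?W * (36 / (5 * ?s)) \<le> weight r b * (4 - (\<Sum>j=1..r - 2. cost j))"
      proof (rule mult_mono)
        have "19008 / ?W = tail_weight (3 * c + 8 + 2 * u)" by (simp add: tail_weight_def algebra_simps)
        also have "\<dots> \<le> weight r b" using 3 m by (simp add: weight_large tail_weight_antimono)
        finally show "19008 / ?W \<le> weight r b" .
        have "r - 2 = c + u + 1" using rc by simp
        then have "(\<Sum>j=1..r - 2. cost j) = 227/60 - 36 / (5 * ?s)"
          using cu by (subst sum_cost) auto
        \<comment> \<open>Only the tail of the remaining capacity is used; its constant part 13/60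
          is given away.\<close>
        then show "36 / (5 * ?s) \<le> 4 - (\<Sum>j=1..r - 2. cost j)" by simp
      qed (auto intro: weight_nonneg)
      show ?thesis unfolding cn bd by (rule order_trans[OF fr wt])
    qed
  qed
  finally show ?thesis .
qed

text \<open>Splitting a singleton leaves two spare coordinates: two sinks for each of three final
  labels, at price 1/2, give the capacity 3.\<close>

lemma cost_weight_single:
  assumes r: "5 \<le> r" and b: "b < r" and n: "r - 1 \<le> n" "r + b \<le> n + 2"
  shows "cost n * budget (r - 1) \<le> weight r b * (3 - (\<Sum>j=2..r - 1. cost j))"
proof -
  define n0 where "n0 = max (r - 1) (r + b - 2)"
  have "cost n \<le> cost n0" using n by (intro cost_antimono) (auto simp: n0_def)
  then have "cost n * budget (r - 1) \<le> cost n0 * budget (r - 1)"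
    using budget_pos[of "r - 1"] by (intro mult_right_mono) auto
  also have "\<dots> \<le> weight r b * (3 - (\<Sum>j=2..r - 1. cost j))"
  proof -
    consider "r = 5" | "r = 6" | "r = 7" | "8 \<le> r" using r by linarith
    then show ?thesis
    proof cases
      case 1
      have "{2..4} = {2, 3, 4::nat}" by auto
      then have s: "(\<Sum>j=2..4. cost j) = 4/3" by simp
      have "b = 0 \<or> b = 1 \<or> b = 2 \<or> b = 3 \<or> b = 4" using 1 b by auto
      then have "cost (max 4 (b + 3)) * (79/80) \<le> weight 5 b * (5/3)"
        by (elim disjE) (simp_all add: weight_def tail_weight_def)
      then show ?thesis unfolding n0_def 1 by (simp add: budget_def s add.commute)
    next
      case 2
      have "b = 0 \<or> b = 1 \<or> b = 2 \<or> b = 3 \<or> b = 4 \<or> b = 5" using 2 b by auto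
      then have "cost (max 5 (b + 4)) * (59/80) \<le> weight 6 b * (17/12)"
        by (elim disjE) (simp_all add: weight_def tail_weight_def)
      moreover have s: "(\<Sum>j=2..5. cost j) = 19/12" by (subst sum_cost2) simp_all
      ultimately show ?thesis unfolding n0_def 2 by (simp add: budget_def s add.commute)
    next
      case 3
      have "b = 0 \<or> b = 1 \<or> b = 2 \<or> b = 3 \<or> b = 4 \<or> b = 5 \<or> b = 6" using 3 b by auto
      then have "cost (max 6 (b + 5)) * (396/720) \<le> weight 7 b * (13/60 + 36/35)"
        by (elim disjE) (simp_all add: weight_def tail_weight_def)
      moreover have s: "(\<Sum>j=2..6. cost j) = 167/60 - 36/35" by (subst sum_cost2) simp_all
      ultimately show ?thesis unfolding n0_def 3 by (simp add: budget_def s add.commute)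
    next
      case 4
      define c where "c = max b 1 - 1"
      define u where "u = r - c - 2"
      have rc: "r = c + 2 + u" and n0: "n0 = 2 * c + 1 + u" and cu: "6 \<le> c + u"
        using 4 b by (auto simp: c_def u_def n0_def max_def)
      have m: "2 * r + b \<le> 3 * c + 5 + 2 * u" using rc by (auto simp: c_def)
      let ?W = "(3 * real c + 2 * real u + 7) * (3 * real c + 2 * real u + 9) * (3 * real c + 2 * real u + 11) * (3 * real c + 2 * real u + 13)"
      let ?X = "(2 * real c + 1 + real u) * (2 * real c + 2 + real u)"
      let ?D = "(real c + real u + 3) * (real c + real u + 4) * (real c + real u + 5)"
      let ?s = "real c + real u + 2"
      have poly: "0 \<le> 48 * ?X * ?D - ?W * ?s"
      proof -
        have "u = 0 \<or> u = 1 \<or> u = 2 \<or> u = 3 \<or> u = 4 \<or> u = 5 \<or> 6 \<le> u" by linarith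
        then show ?thesis
        proof (elim disjE)
          assume "6 \<le> u"
          then show ?thesis using single_poly(7)[of "real c" "real u - 6"] by simp
        qed (use cu single_poly(1)[of "real c - 6" 0] single_poly(2)[of "real c - 5" 0] single_poly(3)[of "real c - 4" 0]
            single_poly(4)[of "real c - 3" 0] single_poly(5)[of "real c - 2" 0] single_poly(6)[of "real c - 1" 0] in simp_all)
      qed
      have fr: "36 / (5 * ?X) * (396 / ?D) \<le> 19008 / ?W * (36 / (5 * ?s))"
        by (rule cost_weight_frac) (use poly in \<open>auto intro!: mult_pos_pos add_nonneg_pos\<close>)
      have cn: "cost n0 = 36 / (5 * ?X)"
        using cu unfolding n0 by (subst cost_large) (auto simp: algebra_simps)
      have bd: "budget (r - 1) = 396 / ?D"
        using cu unfolding rc by (simp add: budget_def algebra_simps)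
      have wt: "19008 / ?W * (36 / (5 * ?s)) \<le> weight r b * (3 - (\<Sum>j=2..r - 1. cost j))"
      proof (rule mult_mono)
        have "19008 / ?W = tail_weight (3 * c + 5 + 2 * u)" by (simp add: tail_weight_def algebra_simps)
        also have "\<dots> \<le> weight r b" using 4 m by (simp add: weight_large tail_weight_antimono)
        finally show "19008 / ?W \<le> weight r b" .
        have "r - 1 = c + u + 1" using rc by simp
        then have "(\<Sum>j=2..r - 1. cost j) = 167/60 - 36 / (5 * ?s)"
          using cu by (subst sum_cost2) auto
        then show "36 / (5 * ?s) \<le> 3 - (\<Sum>j=2..r - 1. cost j)" by simp
      qed (auto intro: weight_nonneg)
      show ?thesis unfolding cn bd by (rule order_trans[OF fr wt])
    qed
  qed
  finally show ?thesis .
qed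

section \<open>The adversary in every dimension\<close>

text \<open>When \<open>r\<close> falls by one, the budget grows by exactly the price of the new
  guess, so averaged fixing of three or more coordinates preserves the invariant. Singletons and
  pairs are split and handed to \<open>awin_slack\<close>, except for a pair in dimension five;
  dimension four is a base case.\<close>

lemma awin_many:
  assumes "lab 1 R T \<sigma>" "card R = q + 2" "4 \<le> card R"
    and "(\<Sum>t\<in>T \<inter> G. weight (card R) (card (R - \<sigma> t))) < budget (card R)"
  shows "awin q True R T \<sigma> G"
  using assms
proof (induction q arbitrary: R T \<sigma> G)
  case 0
  then show ?case by simp
next
  case (Suc q R T \<sigma> G)
  note L = Suc.prems(1)
  note fin = labD(1,2)[OF L]
  let ?r = "card R"
  show ?case
  proof (cases "?r = 4")
    case True
    have "(\<Sum>t\<in>T \<inter> G. weight ?r (card (R - \<sigma> t)))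
      = (\<Sum>t\<in>T \<inter> G. real (if card (R - \<sigma> t) \<le> 1 then 3 else 2::nat) / 8)"
      by (rule sum.cong) (auto simp: True weight_def)
    also have "\<dots> = real (\<Sum>t\<in>T \<inter> G. if card (R - \<sigma> t) \<le> 1 then 3 else 2::nat) / 8"
      by (simp only: sum_divide_distrib of_nat_sum)
    finally have "real (\<Sum>t\<in>T \<inter> G. if card (R - \<sigma> t) \<le> 1 then 3 else 2::nat) < 8"
      using Suc.prems(4) True by (simp add: budget_def)
    then have "(\<Sum>t\<in>T \<inter> G. if card (R - \<sigma> t) \<le> 1 then 3 else 2::nat) \<le> 7" by linarith
    then have "awin 2 True R T \<sigma> G" by (rule awin_four_two[OF L True])
    moreover have "Suc q = 2" using True Suc.prems(2) by simp
    ultimately show ?thesis by (simp only:)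
  next
    case False
    then have r5: "5 \<le> ?r" using Suc.prems(3) by simp
    have cards: "card (R - \<sigma> t) < ?r" "card (\<sigma> t) = ?r - card (R - \<sigma> t)" if "t \<in> T" for t
      using lab_cards(1-3)[OF L that] by linarith+
    show ?thesis
    proof (rule awin_SucI[OF _ _ fin(2)])
      show "R \<noteq> {}" using r5 by auto
      fix h d assume d: "d \<subseteq> R" "d \<noteq> {}"
      have fd: "finite d" using d fin finite_subset by blast
      let ?S = "T \<inter> insert h G"
      let ?w = "\<lambda>t. weight ?r (card (R - \<sigma> t))"
      have "(\<Sum>t\<in>?S. ?w t) \<le> (\<Sum>t\<in>T \<inter> G. ?w t) + weight ?r 0"
        by (rule sum_insert_Int_le[OF fin(2)]) (use r5 in \<open>auto intro: weight_nonneg weight_le_0\<close>)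
      then have S: "(\<Sum>t\<in>?S. ?w t) < budget (?r - 1)"
        using Suc.prems(4) budget_step[OF r5] by linarith
      have zeros: "card (R - d - (\<sigma> t - d)) + card d \<ge> card (R - \<sigma> t)" for t
      proof -
        have "R - \<sigma> t \<subseteq> (R - d - (\<sigma> t - d)) \<union> d" by auto
        then have "card (R - \<sigma> t) \<le> card ((R - d - (\<sigma> t - d)) \<union> d)" using fin fd by (intro card_mono) auto
        also have "\<dots> \<le> card (R - d - (\<sigma> t - d)) + card d" by (rule card_Un_le)
        finally show ?thesis .
      qed
      have cRd: "card (R - d) = ?r - card d" using fd d by (simp add: card_Diff_subset)
      have split: "awin q False (R - d) {t\<in>T. \<not> \<sigma> t \<subseteq> d} (\<lambda>t. \<sigma> t - d) (insert h G)"
        if sl: "sl = 1 \<or> sl = 2" and q: "card (R - d) = q + sl" and U: "U = real (2 ^ card d) * (2 ^ sl - 1) * cost sl - (\<Sum>j=sl..card (R - d). cost j)"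
          and le: "\<And>t. t \<in> T \<Longrightarrow> cost (card (R - d) + card (R - d - (\<sigma> t - d))) * budget (?r - 1) \<le> ?w t * U" for sl U
      proof (rule awin_slack[OF lab_split[OF L d(1)] q sl])
        let ?T = "{t\<in>T. \<not> \<sigma> t \<subseteq> d}"
        let ?c = "\<lambda>t. cost (card (R - d) + card (R - d - (\<sigma> t - d)))"
        have bp: "0 < budget (?r - 1)" by (rule budget_pos)
        \<comment> \<open>Positivity of \<open>U\<close> is read off from \<open>le\<close> at any
          sink; the one labelled \<open>R\<close> certainly exists.\<close>
        have "card {t\<in>T. \<sigma> t = R} = 1" by (rule labD(5)[OF L]) (use r5 in auto)
        then obtain t0 where t0: "t0 \<in> T" by (auto simp: card_1_singleton_iff)
        have "0 < ?c t0 * budget (?r - 1)" using bp by simp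
        then have "0 < ?w t0 * U" using le[OF t0] by linarith
        then have Up: "0 < U" using weight_pos zero_less_mult_pos by blast
        have "(\<Sum>t\<in>?T \<inter> insert h G. ?c t) * budget (?r - 1) = (\<Sum>t\<in>?T \<inter> insert h G. ?c t * budget (?r - 1))"
          by (rule sum_distrib_right)
        also have "\<dots> \<le> (\<Sum>t\<in>?T \<inter> insert h G. ?w t * U)" by (rule sum_mono) (rule le, auto)
        also have "\<dots> \<le> (\<Sum>t\<in>?S. ?w t * U)"
          using fin Up by (intro sum_mono2) (auto intro: mult_nonneg_nonneg weight_nonneg)
        also have "\<dots> = (\<Sum>t\<in>?S. ?w t) * U" by (rule sum_distrib_right[symmetric])
        also have "\<dots> < budget (?r - 1) * U" using S Up by (rule mult_strict_right_mono)
        finally have "(\<Sum>t\<in>?T \<inter> insert h G. ?c t) * budget (?r - 1) < U * budget (?r - 1)" by (simp add: mult.commute)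
        then have "(\<Sum>t\<in>?T \<inter> insert h G. ?c t) < U" using bp by simp
        then show "(\<Sum>t\<in>?T \<inter> insert h G. ?c t) + (\<Sum>j=sl..card (R - d). cost j) < real (1 * 2 ^ card d) * (2 ^ sl - 1) * cost sl"
          unfolding U by simp
      qed
      have "1 \<le> card d" using d fd by (simp add: Suc_le_eq card_gt_0_iff)
      then consider "card d = 1" | "card d = 2" "?r = 5" | "card d = 2" "6 \<le> ?r" | "3 \<le> card d"
        using r5 by linarith
      then show "(\<exists>i\<in>d. awin q True (R - {i}) (fixed_targets d i \<sigma> T) (fixed_label d i \<sigma>) (insert h G)) \<or>
       awin q False (R - d) {t\<in>T. \<not> \<sigma> t \<subseteq> d} (\<lambda>t. \<sigma> t - d) (insert h G) \<or>
       (True \<and> q = 0 \<and> (\<exists>X\<subseteq>T. \<exists>z. (\<forall>t\<in>X. realz R d z (\<sigma> t)) \<and> card (X \<inter> insert h G) + 1 < card X))"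
      proof cases
        case 1
        have "awin q False (R - d) {t\<in>T. \<not> \<sigma> t \<subseteq> d} (\<lambda>t. \<sigma> t - d) (insert h G)"
        proof (rule split[of 2 "3 - (\<Sum>j=2..?r - 1. cost j)"])
          show "card (R - d) = q + 2" using cRd 1 Suc.prems(2) by simp
          show "3 - (\<Sum>j=2..?r - 1. cost j) = real (2 ^ card d) * (2 ^ 2 - 1) * cost 2 - (\<Sum>j=2..card (R - d). cost j)"
            unfolding cRd 1 by simp
          show "cost (card (R - d) + card (R - d - (\<sigma> t - d))) * budget (?r - 1) \<le> ?w t * (3 - (\<Sum>j=2..?r - 1. cost j))"
            if "t \<in> T" for t
            by (rule cost_weight_single[OF r5]) (use cards[OF that] zeros[of t] cRd 1 in linarith)+
        qed simp
        then show ?thesis by blast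
      next
        case 2
        \<comment> \<open>Five guesses at the least price 3/20 would already exceed the budget
          59/80, so there were at most four, and five with the new one.\<close>
        have "3/20 \<le> ?w t" if "t \<in> T" for t using cards(1)[OF that] 2(2) by (auto simp: weight_def)
        then have "(\<Sum>t\<in>T \<inter> G. 3/20) \<le> (\<Sum>t\<in>T \<inter> G. ?w t)" by (intro sum_mono) auto
        then have "real (card (T \<inter> G)) * (3/20) < 59/80" using Suc.prems(4) 2(2) by (simp add: budget_def)
        then have "card (T \<inter> G) \<le> 4" by linarith
        then have "card ?S \<le> 5" using card_insert_Int_le[OF fin(2), of h G] by linarith
        moreover have "card ({t\<in>T. \<not> \<sigma> t \<subseteq> d} \<inter> insert h G) \<le> card ?S" using fin by (intro card_mono) auto
        ultimately have S5: "card ({t\<in>T. \<not> \<sigma> t \<subseteq> d} \<inter> insert h G) \<le> 5" by linarith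
        have "lab 4 (R - d) {t\<in>T. \<not> \<sigma> t \<subseteq> d} (\<lambda>t. \<sigma> t - d)" using lab_split[OF L d(1)] 2 by simp
        then have "awin 2 False (R - d) {t\<in>T. \<not> \<sigma> t \<subseteq> d} (\<lambda>t. \<sigma> t - d) (insert h G)"
          by (rule awin_three_two) (use cRd 2 S5 in auto)
        moreover have "q = 2" using 2 Suc.prems(2) by simp
        ultimately show ?thesis by blast
      next
        case 3
        have "awin q False (R - d) {t\<in>T. \<not> \<sigma> t \<subseteq> d} (\<lambda>t. \<sigma> t - d) (insert h G)"
        proof (rule split[of 1 "4 - (\<Sum>j=1..?r - 2. cost j)"])
          show "card (R - d) = q + 1" using cRd 3 Suc.prems(2) by simp
          show "4 - (\<Sum>j=1..?r - 2. cost j) = real (2 ^ card d) * (2 ^ 1 - 1) * cost 1 - (\<Sum>j=1..card (R - d). cost j)"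
            unfolding cRd 3(1) by simp
          show "cost (card (R - d) + card (R - d - (\<sigma> t - d))) * budget (?r - 1) \<le> ?w t * (4 - (\<Sum>j=1..?r - 2. cost j))"
            if "t \<in> T" for t
            by (rule cost_weight_pair[OF 3(2)]) (use cards[OF that] zeros[of t] cRd 3 in linarith)+
        qed simp
        then show ?thesis by blast
      next
        case 4
        have "\<exists>i\<in>d. (\<Sum>t\<in>fixed_targets d i \<sigma> ?S. weight (?r - 1) (card (R - {i} - fixed_label d i \<sigma> t))) \<le> (\<Sum>t\<in>?S. ?w t)"
        proof (rule average_fixed[OF fin(1) _ d])
          fix t assume t: "t \<in> ?S" "\<sigma> t \<inter> d \<noteq> {}" "\<sigma> t \<noteq> d"
          define a where "a = card (\<sigma> t \<inter> d)"
          define be where "be = card (d - \<sigma> t)"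
          have tT: "t \<in> T" using t(1) by simp
          have ft: "finite (\<sigma> t)" by (rule lab_cards(4)[OF L tT])
          have D: "card d = a + be"
            unfolding a_def be_def using card_Int_Diff[OF fd, of "\<sigma> t"] by (simp add: Int_commute)
          have a1: "1 \<le> a" using t(2) ft by (simp add: a_def Suc_le_eq card_gt_0_iff)
          have ab: "a \<le> card (\<sigma> t)" unfolding a_def using ft by (intro card_mono) auto
          have beb: "be \<le> card (R - \<sigma> t)" unfolding be_def using fin d by (intro card_mono) auto
          have ne: "a < card (\<sigma> t)" if "be = 0"
          proof -
            have "d \<subseteq> \<sigma> t" using that fd by (auto simp: be_def)
            then have "\<sigma> t \<inter> d \<subset> \<sigma> t" using t(3) by auto
            then show ?thesis unfolding a_def using ft by (rule psubset_card_mono[rotated])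
          qed
          have "real a * weight (?r - 1) (card (R - \<sigma> t) - be + (a - 1)) \<le> real (a + be) * ?w t"
            by (rule weight_fix[OF r5 cards(1)[OF tT] beb a1]) (use ab ne cards(2)[OF tT] D 4 in simp_all)
          then show "real (card (\<sigma> t \<inter> d)) * weight (?r - 1) (card (R - \<sigma> t) - card (d - \<sigma> t) + (card (\<sigma> t \<inter> d) - 1))
            \<le> real (card d) * ?w t"
            unfolding a_def[symmetric] be_def[symmetric] D .
        qed (use fin labD(4)[OF L] weight_nonneg in auto)
        then obtain i where i: "i \<in> d" "(\<Sum>t\<in>fixed_targets d i \<sigma> ?S. weight (?r - 1) (card (R - {i} - fixed_label d i \<sigma> t))) \<le> (\<Sum>t\<in>?S. ?w t)"
          by blast
        have cR: "card (R - {i}) = ?r - 1" using i(1) d(1) fin(1) by (simp add: subset_iff)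
        have ST: "fixed_targets d i \<sigma> ?S = fixed_targets d i \<sigma> T \<inter> insert h G" by auto
        have "awin q True (R - {i}) (fixed_targets d i \<sigma> T) (fixed_label d i \<sigma>) (insert h G)"
        proof (rule Suc.IH[OF lab_fix[OF L d(1) i(1)]])
          show "card (R - {i}) = q + 2" "4 \<le> card (R - {i})" using cR Suc.prems(2) r5 by auto
          show "(\<Sum>t\<in>fixed_targets d i \<sigma> T \<inter> insert h G. weight (card (R - {i})) (card (R - {i} - fixed_label d i \<sigma> t))) < budget (card (R - {i}))"
            using i(2) S unfolding cR ST by linarith
        qed
        then show ?thesis using i(1) by blast
      qed
    qed
  qed
qed

lemma weight_less_budget:
  assumes "4 \<le> n"
  shows "weight n 0 < budget n"
proof (cases "n \<le> 6")
  case True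
  then have "n = 4 \<or> n = 5 \<or> n = 6" using assms by auto
  then show ?thesis by (auto simp: weight_def budget_def)
next
  case False
  define x where "x = real n"
  define D where "D = (x + 2) * (x + 3) * (x + 4)"
  have x: "6 < x" using False by (simp add: x_def)
  then have D: "0 < D" by (simp add: D_def)
  have "(2 * x + 2) * (2 * x + 4) * (2 * x + 6) * (2 * x + 8) = 16 * ((x + 1) * D)"
    unfolding D_def by algebra
  then have "weight n 0 = 19008 / (16 * ((x + 1) * D))"
    using False by (simp add: weight_large tail_weight_def x_def)
  also have "\<dots> = 1188 / ((x + 1) * D)" by simp
  also have "\<dots> < 396 / D" using x D by (simp add: divide_simps)
  also have "\<dots> = budget n" using False by (simp add: budget_def D_def x_def)
  finally show ?thesis .
qed

lemma awin_initial:
  assumes L: "lab 1 R T \<sigma>" and R: "card R = n" "2 \<le> n"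
  shows "awin (n - 2) True R T \<sigma> {g}"
proof -
  note fin = labD(1,2)[OF L]
  have one: "card (T \<inter> {g}) \<le> 1" using card_mono[of "{g}" "T \<inter> {g}"] by auto
  consider "n = 2" | "n = 3" | "4 \<le> n" using R(2) by linarith
  then show ?thesis
  proof cases
    case 1
    then have "card T = 3" using card_targets[OF L] R(1) by simp
    then have "awin 0 True R T \<sigma> {g}" using one fin(2) by (intro awin_leaf) auto
    then show ?thesis using 1 by simp
  next
    case 2
    then have "awin 1 True R T \<sigma> {g}" using R(1) one by (intro awin_three_one[OF L]) auto
    then show ?thesis using 2 by simp
  next
    case 3
    show ?thesis
    proof (rule awin_many[OF L])
      have "(\<Sum>t\<in>T \<inter> {g}. weight n (card (R - \<sigma> t))) \<le> weight n 0"
      proof (cases "g \<in> T")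
        case True
        have "weight n b \<le> weight n 0" for b using 3 weight_le_0[of n b] by (cases "n = 4") (auto simp: weight_def)
        then show ?thesis using True by simp
      qed (simp add: weight_nonneg)
      also have "weight n 0 < budget n" by (rule weight_less_budget[OF 3])
      finally show "(\<Sum>t\<in>T \<inter> {g}. weight (card R) (card (R - \<sigma> t))) < budget (card R)" unfolding R(1) .
    qed (use R 3 in auto)
  qed
qed

theorem theorem1:
  fixes n :: nat
    and query :: "(vec \<times> vec) list \<Rightarrow> vec"
    and answer :: "(vec \<times> vec) list \<Rightarrow> vec"
  assumes "n \<ge> 2"
  shows "\<exists>P A s. perm_mat n P \<and> upper_triangular n A \<and> invertible_mat n A \<and> s \<in> cube n \<and>
           (\<forall>k<n. answer (run query (matousek_outmap n P A s) k) \<noteq> s)"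
proof -
  have "fools n query answer n"
  proof (rule fools_of_awin[OF assms])
    fix T :: "vec set" and \<sigma> :: "vec \<Rightarrow> nat set" and g
    assume "finite T" "\<And>t. t \<in> T \<Longrightarrow> \<sigma> t \<noteq> {} \<and> \<sigma> t \<subseteq> {..<n}"
      "\<And>W. W \<noteq> {} \<Longrightarrow> W \<subseteq> {..<n} \<Longrightarrow> card {t\<in>T. \<sigma> t = W} = 1"
    then have "lab 1 {..<n} T \<sigma>" unfolding lab_def by simp
    then show "awin (n - 2) True {..<n} T \<sigma> {g}" by (rule awin_initial) (use assms in auto)
  qed
  then show ?thesis unfolding fools_def .
qed

end
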